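(* Let $d\in\{2,3\}$, let $\mathcal{O}$ be a nonempty bounded open subset of $\mathbb{R}^d$ of class $C^2$, and let $\psi:\mathcal{O}\to\mathbb{R}$ satisfy $\psi\in C^2(\mathcal{O};\mathbb{R})$, $\psi>0$ and $|\nabla\psi|>0$ on $\mathcal{O}$. Let $\alpha\in\mathbb{R}\setminus\{-1\}$. There exist $C>0$ and $\widehat\tau>1$ such that for all $\tau\ge\widehat\tau$ there exists $\widehat s(\tau)$ such that for all $s\ge\widehat s(\tau)$ and for all $(z,\pi)\in(H_0^2(\mathcal{O};\mathbb{C}))^d\times H_0^1(\mathcal{O};\mathbb{C})$ the following inequalities hold: $$\int_{\mathcal{O}}\big(|\nabla z|^2+s^2\tau^2e^{2\tau\psi}|z|^2\big)e^{2se^{\tau\psi}}\,dx\le C\int_{\mathcal{O}}\big(se^{\tau\psi}|\mathrm{div}\,z+\alpha\pi|^2+\tau^{-2}|\nabla\pi-\Delta z|^2\big)e^{2se^{\tau\psi}}\,dx,$$ $$\int_{\mathcal{O}}s\tau^2e^{\tau\psi}\big(|\mathrm{curl}\,z|^2+|\mathrm{div}\,z-\pi|^2\big)e^{2se^{\tau\psi}}\,dx\le C\int_{\mathcal{O}}|\nabla\pi-\Delta z|^2e^{2se^{\tau\psi}}\,dx.$$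
   Context: For $d=2$, $\mathrm{curl}\,z=\partial_{x_1}z_2-\partial_{x_2}z_1$ (scalar); for $d=3$, $\mathrm{curl}\,z$ is the usual curl. $\mathrm{div}\,z=\sum_j\partial_{x_j}z_j$ and $\nabla z=(\partial_{x_j}z_i)_{i,j}$.
   Formalization: The hypotheses on ψ are read up to the boundary: ψ and its derivatives of order at most 2 extend continuously to the closure of O, and |∇ψ| ≥ c > 0 on O for some constant c; with ψ ∈ C²(O) and |∇ψ| > 0 only on the open set O the claim is false. *)

theory Defs
  imports "HOL-Analysis.Analysis"
begin

section \<open>Classical derivatives and regularity\<close>

definition pderiv_at :: "'d \<Rightarrow> (real^'d::finite \<Rightarrow> 'b::real_normed_vector) \<Rightarrow> real^'d \<Rightarrow> 'b" where
  "pderiv_at j f x = frechet_derivative f (at x) (axis j 1)"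

definition pderivs :: "'d list \<Rightarrow> (real^'d::finite \<Rightarrow> 'b::real_normed_vector) \<Rightarrow> real^'d \<Rightarrow> 'b" where
  "pderivs js f = foldr pderiv_at js f"

definition grad :: "(real^'d::finite \<Rightarrow> real) \<Rightarrow> real^'d \<Rightarrow> real^'d" where
  "grad f x = (\<chi> j. pderiv_at j f x)"

text \<open>Only meaningful for open \<open>S\<close>.\<close>

primrec C_on :: "nat \<Rightarrow> (real^'d::finite) set \<Rightarrow> (real^'d \<Rightarrow> 'b::real_normed_vector) \<Rightarrow> bool" where
  "C_on 0 S f \<longleftrightarrow> continuous_on S f"
| "C_on (Suc k) S f \<longleftrightarrow> f differentiable_on S \<and> (\<forall>j. C_on k S (pderiv_at j f))"

text \<open>\<open>C_closure k S f\<close> is the usual meaning of \<open>f\<close> being of class \<open>C\<^sup>k\<close> on \<open>S\<close> up to the boundary: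
  all derivatives of order at most \<open>k\<close> extend continuously from the open set \<open>S\<close> to its closure.\<close>

definition C_closure :: "nat \<Rightarrow> (real^'d::finite) set \<Rightarrow> (real^'d \<Rightarrow> 'b::real_normed_vector) \<Rightarrow> bool" where
  "C_closure k S f \<longleftrightarrow> C_on k S f \<and>
     (\<forall>js. length js \<le> k \<longrightarrow>
        (\<exists>g. continuous_on (closure S) g \<and> (\<forall>x\<in>S. g x = pderivs js f x)))"

text \<open>Open sets of class \<open>C\<^sup>k\<close>: near each boundary point, after a rigid change of coordinates \<open>T\<close>, the
  set is the strict epigraph, in the direction of coordinate \<open>j\<close>, of a \<open>C\<^sup>k\<close> function of the other
  \<open>d - 1\<close> coordinates.  Such a function is encoded as a \<open>C\<^sup>k\<close> function \<open>\<gamma>\<close> on the whole space which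
  does not depend on coordinate \<open>j\<close>.\<close>

definition open_class_C :: "nat \<Rightarrow> (real^'d::finite) set \<Rightarrow> bool" where
  "open_class_C k S \<longleftrightarrow> open S \<and>
     (\<forall>x0 \<in> frontier S. \<exists>r>0. \<exists>(T :: real^'d \<Rightarrow> real^'d) (j :: 'd) (\<gamma> :: real^'d \<Rightarrow> real).
        orthogonal_transformation T \<and> C_on k UNIV \<gamma> \<and>
        (\<forall>y t. \<gamma> (y + t *\<^sub>R axis j 1) = \<gamma> y) \<and>
        S \<inter> ball x0 r = {x \<in> ball x0 r. \<gamma> (T x) < T x $ j})"


section \<open>Weak derivatives and Sobolev spaces\<close>

definition test_fun :: "(real^'d::finite) set \<Rightarrow> (real^'d \<Rightarrow> complex) \<Rightarrow> bool" where
  "test_fun S \<eta> \<longleftrightarrow> (\<forall>k. C_on k UNIV \<eta>) \<and>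
     compact (closure {x. \<eta> x \<noteq> 0}) \<and> closure {x. \<eta> x \<noteq> 0} \<subseteq> S"

definition L2 :: "(real^'d::finite) set \<Rightarrow> (real^'d \<Rightarrow> complex) set" where
  "L2 S = {f \<in> borel_measurable (lebesgue_on S).
             integrable (lebesgue_on S) (\<lambda>x. (norm (f x))\<^sup>2)}"

text \<open>A multi-index is represented by the list of the coordinates with respect to which one
  differentiates.\<close>

definition has_weak_deriv ::
  "(real^'d::finite) set \<Rightarrow> 'd list \<Rightarrow> (real^'d \<Rightarrow> complex) \<Rightarrow> (real^'d \<Rightarrow> complex) \<Rightarrow> bool" where
  "has_weak_deriv S js f g \<longleftrightarrow>
     (\<forall>\<eta>. test_fun S \<eta> \<longrightarrow>
        integral\<^sup>L (lebesgue_on S) (\<lambda>x. f x * pderivs js \<eta> x) =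
        (- 1) ^ length js * integral\<^sup>L (lebesgue_on S) (\<lambda>x. g x * \<eta> x))"

text \<open>The square integrable weak derivative is unique up to a null set; one representative is
  chosen.  The definition is only used for functions possessing such a derivative.\<close>

definition weak_deriv ::
  "(real^'d::finite) set \<Rightarrow> 'd list \<Rightarrow> (real^'d \<Rightarrow> complex) \<Rightarrow> real^'d \<Rightarrow> complex" where
  "weak_deriv S js f = (SOME g. g \<in> L2 S \<and> has_weak_deriv S js f g)"

definition Sobolev :: "nat \<Rightarrow> (real^'d::finite) set \<Rightarrow> (real^'d \<Rightarrow> complex) set" where
  "Sobolev k S = {f \<in> L2 S. \<forall>js. length js \<le> k \<longrightarrow> (\<exists>g \<in> L2 S. has_weak_deriv S js f g)}"

text \<open>\<open>Sobolev0 k S\<close> is the closure of the test functions on \<open>S\<close> in the Sobolev norm of order \<open>k\<close>.\<close>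

definition Sobolev0 :: "nat \<Rightarrow> (real^'d::finite) set \<Rightarrow> (real^'d \<Rightarrow> complex) set" where
  "Sobolev0 k S = {f \<in> Sobolev k S. \<forall>\<epsilon>>0. \<exists>\<eta>. test_fun S \<eta> \<and>
     (\<forall>js. length js \<le> k \<longrightarrow>
        integral\<^sup>L (lebesgue_on S) (\<lambda>x. (norm (weak_deriv S js f x - pderivs js \<eta> x))\<^sup>2) < \<epsilon>)}"


section \<open>Weak differential operators\<close>

definition cmp :: "(real^'d::finite \<Rightarrow> complex^'d) \<Rightarrow> 'd \<Rightarrow> real^'d \<Rightarrow> complex" where
  "cmp z i x = z x $ i"

definition wgrad :: "(real^'d::finite) set \<Rightarrow> (real^'d \<Rightarrow> complex) \<Rightarrow> real^'d \<Rightarrow> complex^'d" where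
  "wgrad S p x = (\<chi> j. weak_deriv S [j] p x)"

text \<open>Row \<open>i\<close>, column \<open>j\<close> holds the \<open>j\<close>-th derivative of the \<open>i\<close>-th component; the norm on
  \<open>complex^'d^'d\<close> is the Frobenius norm.\<close>

definition wjacobian ::
  "(real^'d::finite) set \<Rightarrow> (real^'d \<Rightarrow> complex^'d) \<Rightarrow> real^'d \<Rightarrow> complex^'d^'d" where
  "wjacobian S z x = (\<chi> i j. weak_deriv S [j] (cmp z i) x)"

definition wdiv :: "(real^'d::finite) set \<Rightarrow> (real^'d \<Rightarrow> complex^'d) \<Rightarrow> real^'d \<Rightarrow> complex" where
  "wdiv S z x = (\<Sum>j\<in>UNIV. weak_deriv S [j] (cmp z j) x)"

definition wlaplace ::
  "(real^'d::finite) set \<Rightarrow> (real^'d \<Rightarrow> complex^'d) \<Rightarrow> real^'d \<Rightarrow> complex^'d" where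
  "wlaplace S z x = (\<chi> i. \<Sum>j\<in>UNIV. weak_deriv S [j, j] (cmp z i) x)"

definition wcurl2 :: "(real^2) set \<Rightarrow> (real^2 \<Rightarrow> complex^2) \<Rightarrow> real^2 \<Rightarrow> complex" where
  "wcurl2 S z x = weak_deriv S [1] (cmp z 2) x - weak_deriv S [2] (cmp z 1) x"

definition wcurl3 :: "(real^3) set \<Rightarrow> (real^3 \<Rightarrow> complex^3) \<Rightarrow> real^3 \<Rightarrow> complex^3" where
  "wcurl3 S z x = vector
     [weak_deriv S [2] (cmp z 3) x - weak_deriv S [3] (cmp z 2) x,
      weak_deriv S [3] (cmp z 1) x - weak_deriv S [1] (cmp z 3) x,
      weak_deriv S [1] (cmp z 2) x - weak_deriv S [2] (cmp z 1) x]"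

end

theory Submission
  imports Defs
begin

text \<open>Put \<open>q = p - div z\<close> and \<open>w = curl z\<close>.  Because
  \<open>\<Delta> z = \<nabla> div z - curl curl z\<close>, the right hand side \<open>F = \<nabla> p - \<Delta> z\<close> equals \<open>\<nabla> q + curl w\<close>, and
  \<open>div w = 0\<close> if \<open>d = 3\<close>.  So the second order Stokes expression is a first order elliptic expression
  \<open>D u = \<Sum>\<^sub>j A\<^sub>j \<partial>\<^sub>j u\<close> in \<open>u = (q, w)\<close>.  Its matrices satisfy the Clifford relations
  \<open>\<langle>A\<^sub>j x, A\<^sub>k y\<rangle> + \<langle>A\<^sub>k x, A\<^sub>j y\<rangle> = 2 \<delta>\<^sub>j\<^sub>k \<langle>x, y\<rangle>\<close>, and the same operator applied to \<open>z\<close> gives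
  \<open>div z\<close> and \<open>curl z\<close>.  Write \<open>\<phi> = exp (\<tau> \<psi>)\<close> and \<open>W\<^sub>\<kappa> = \<phi> powr \<kappa> * exp (2 s \<phi>)\<close>.  Everything follows from
  the Carleman inequality
  \<open>s \<tau>\<^sup>2 \<integral> \<phi> W\<^sub>\<kappa> |u|\<^sup>2 \<le> C \<integral> W\<^sub>\<kappa> |D u|\<^sup>2\<close> for test functions.  With \<open>\<kappa> = 0\<close> and
  \<open>u = (q, w)\<close> it is the second estimate.  With \<open>\<kappa> = 1\<close> and \<open>z\<close> in place of \<open>u\<close> it bounds
  \<open>s\<^sup>2 \<tau>\<^sup>2 \<integral> \<phi>\<^sup>2 |z|\<^sup>2 exp (2 s \<phi>)\<close> by the integral of \<open>s \<phi> (|div z|\<^sup>2 + |curl z|\<^sup>2) exp (2 s \<phi>)\<close>; here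
  \<open>div z = ((div z + \<alpha> p) - \<alpha> q) / (1 + \<alpha>)\<close>, and \<open>q\<close> and \<open>curl z\<close> are controlled by the second
  estimate.  This is where \<open>\<alpha> \<noteq> - 1\<close> enters.

  The Carleman inequality rests on the Clifford relations.  The forms
  \<open>b\<^sub>k\<^sub>j(x, y) = \<langle>A\<^sub>k x, A\<^sub>j y\<rangle> - \<delta>\<^sub>k\<^sub>j \<langle>x, y\<rangle>\<close> (\<open>skew\<close> below) change sign when the
  indices or the arguments are exchanged, so
  \<open>b\<^sub>k\<^sub>j(\<partial>\<^sub>l u, \<partial>\<^sub>j u)\<close> is a null form: integrated against a coefficient, it loses its second derivatives
  and only derivatives of the coefficient survive (lemma \<open>null_form\<close>).  First, \<open>|D u|\<^sup>2\<close> and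
  \<open>|\<nabla> u|\<^sup>2\<close> differ by null forms, which gives the gradient (\<open>gradient_bound\<close>).  Second, with
  \<open>M = \<Sum>\<^sub>k \<partial>\<^sub>k\<psi> A\<^sub>k\<close> and \<open>\<lambda> = \<tau> (s \<phi> + \<kappa> / 2)\<close>, so that \<open>\<nabla> W\<^sub>\<kappa> = 2 \<lambda> W\<^sub>\<kappa> \<nabla> \<psi>\<close>, the choice
  \<open>P = M (\<partial>\<^sub>\<psi> u / |\<nabla>\<psi>|\<^sup>2 + \<lambda> u)\<close> in \<open>|D u|\<^sup>2 \<ge> 2 \<langle>P, D u - P\<rangle>\<close> leaves null forms and the term
  \<open>- 2 \<lambda> u \<cdot> \<partial>\<^sub>\<psi> u - 2 \<lambda>\<^sup>2 |\<nabla>\<psi>|\<^sup>2 |u|\<^sup>2\<close> (\<open>pointwise_lower\<close>).  After integration against \<open>W\<^sub>\<kappa>\<close> the terms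
  quadratic in \<open>\<lambda>\<close> cancel, and there remains \<open>\<nabla>\<psi> \<cdot> \<nabla>\<lambda> |u|\<^sup>2\<close>, which is \<open>s \<tau>\<^sup>2 \<phi> |\<nabla>\<psi>|\<^sup>2 |u|\<^sup>2\<close>
  (\<open>carleman_inequality_raw\<close>).  The errors are a multiple of \<open>|D u|\<^sup>2\<close> and
  terms of order \<open>s \<tau> \<phi> |u|\<^sup>2\<close>, which are absorbed for large \<open>\<tau>\<close> (\<open>carleman_estimate\<close>).

  For \<open>z\<close> and \<open>p\<close> in Sobolev spaces, test functions approximate all weak derivatives involved in \<open>L\<^sup>2\<close>,
  and the weights are bounded because \<open>\<psi>\<close> is, so the estimates survive with a constant four
  times larger (\<open>stokes_estimates_Sobolev0\<close>).  The weak derivative of order zero is only some function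
  with the right pairings; that it is the function itself needs the fundamental lemma of the calculus
  of variations and hence smooth bump functions.\<close>

section \<open>Partial derivatives along coordinate lines\<close>

text \<open>A relation between a function and the value of its partial derivative makes the one-dimensional calculus rules
  available for tuples and for products with a weight, with the derivative given by an explicit term.\<close>

definition has_pd :: "'d \<Rightarrow> (real^'d::finite \<Rightarrow> 'b::real_normed_vector) \<Rightarrow> 'b \<Rightarrow> real^'d \<Rightarrow> bool" where
  "has_pd j f D x \<longleftrightarrow> ((\<lambda>t. f (x + t *\<^sub>R axis j 1)) has_vector_derivative D) (at 0)"

text \<open>Translating along the line turns the definition at parameter \<open>0\<close> into differentiability at every
  parameter, which is the form the mean value theorem needs.\<close>

lemma has_pd_line:
  assumes "has_pd j f D (x + t *\<^sub>R axis j 1)"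
  shows "((\<lambda>t. f (x + t *\<^sub>R axis j 1)) has_vector_derivative D) (at t)"
proof -
  have 1: "((\<lambda>r. r - t) has_vector_derivative 1) (at t)"
    by (auto intro!: derivative_eq_intros)
  have "((\<lambda>r. f ((x + t *\<^sub>R axis j 1) + r *\<^sub>R axis j 1)) has_vector_derivative D) (at (t - t))"
    using assms by (simp add: has_pd_def)
  from vector_diff_chain_at[OF 1 this]
  show ?thesis by (simp add: o_def algebra_simps)
qed

lemma has_pd_eq: "has_pd j f D x \<Longrightarrow> D = D' \<Longrightarrow> has_pd j f D' x" by simp

lemma has_pd_const: "has_pd j (\<lambda>x. c) 0 x" by (simp add: has_pd_def)

lemma has_pd_bilinear:
  assumes "bounded_bilinear b" "has_pd j f f' x" "has_pd j g g' x"
  shows "has_pd j (\<lambda>x. b (f x) (g x)) (b (f x) g' + b f' (g x)) x"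
  using bounded_bilinear.has_vector_derivative[OF assms(1) assms(2,3)[unfolded has_pd_def]]
  by (simp add: has_pd_def)

lemma has_pd_mult:
  fixes f g :: "real^'d::finite \<Rightarrow> 'b::real_normed_algebra"
  shows "has_pd j f f' x \<Longrightarrow> has_pd j g g' x \<Longrightarrow> has_pd j (\<lambda>x. f x * g x) (f x * g' + f' * g x) x"
  using has_pd_bilinear[OF bounded_bilinear_mult] by blast

lemma has_pd_add: "has_pd j f f' x \<Longrightarrow> has_pd j g g' x \<Longrightarrow> has_pd j (\<lambda>x. f x + g x) (f' + g') x"
  unfolding has_pd_def by (rule has_vector_derivative_add)

lemma has_pd_diff: "has_pd j f f' x \<Longrightarrow> has_pd j g g' x \<Longrightarrow> has_pd j (\<lambda>x. f x - g x) (f' - g') x"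
  unfolding has_pd_def by (rule has_vector_derivative_diff)

lemma has_pd_Pair: "has_pd j f f' x \<Longrightarrow> has_pd j g g' x \<Longrightarrow> has_pd j (\<lambda>x. (f x, g x)) (f', g') x"
  unfolding has_pd_def by (rule has_vector_derivative_Pair)

lemma has_pd_sum: "(\<And>i. i \<in> I \<Longrightarrow> has_pd j (f i) (f' i) x) \<Longrightarrow> has_pd j (\<lambda>x. \<Sum>i\<in>I. f i x) (\<Sum>i\<in>I. f' i) x"
  by (induction I rule: infinite_finite_induct) (auto intro: has_pd_const has_pd_add)

lemma has_pd_linear: "bounded_linear L \<Longrightarrow> has_pd j f f' x \<Longrightarrow> has_pd j (\<lambda>x. L (f x)) (L f') x"
  unfolding has_pd_def by (rule bounded_linear.has_vector_derivative)

lemma has_pd_chain: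
  assumes "(F has_vector_derivative F') (at (f x))" "has_pd j f f' x"
  shows "has_pd j (\<lambda>x. F (f x)) (f' *\<^sub>R F') x"
  unfolding has_pd_def
  using vector_diff_chain_at[of "\<lambda>t. f (x + t *\<^sub>R axis j 1)" f' 0 F F'] assms
  by (simp add: has_pd_def o_def)

lemma has_pd_unique: "has_pd j f D x \<Longrightarrow> has_pd j f D' x \<Longrightarrow> D = D'"
  unfolding has_pd_def by (rule vector_derivative_unique_at)

lemma has_pd_pderiv_at:
  assumes "f differentiable (at x)" shows "has_pd j f (pderiv_at j f x) x"
proof -
  have 1: "(f has_derivative frechet_derivative f (at x)) (at (x + 0 *\<^sub>R axis j 1))"
    using assms frechet_derivative_works by auto
  have "((\<lambda>t. x + t *\<^sub>R axis j 1) has_derivative (\<lambda>t. t *\<^sub>R axis j 1)) (at 0)"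
    by (auto intro!: derivative_eq_intros)
  from has_derivative_compose[OF this 1]
  show ?thesis unfolding has_pd_def has_vector_derivative_def pderiv_at_def
    by (rule has_derivative_eq_rhs)
      (auto simp: fun_eq_iff linear_cmul[OF linear_frechet_derivative[OF assms]])
qed

lemma has_pd_cong_open:
  assumes "has_pd j f D x" "open S" "x \<in> S" "\<And>y. y \<in> S \<Longrightarrow> f y = g y"
  shows "has_pd j g D x"
proof -
  have "continuous_on UNIV (\<lambda>t::real. x + t *\<^sub>R axis j 1)" by (intro continuous_intros)
  then have o: "open ((\<lambda>t::real. x + t *\<^sub>R axis j 1) -` S)"
    using assms(2) continuous_on_open_vimage[of UNIV] by auto
  show ?thesis unfolding has_pd_def
    using assms o
    by (intro has_vector_derivative_transform_within_open[OF assms(1)[unfolded has_pd_def] o]) auto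
qed

lemma has_pd_off_support:
  assumes "closed K" "\<And>x. x \<notin> K \<Longrightarrow> f x = 0" "x \<notin> K" shows "has_pd j f 0 x"
  using has_pd_cong_open[OF has_pd_const[of j 0], of "- K" x f] assms by auto

text \<open>Two applications of the mean value theorem, one in each direction.  The left hand side is symmetric in the two
  directions, which is why mixed derivatives commute.\<close>

lemma second_diff_mvt:
  fixes f :: "real^'d::finite \<Rightarrow> real"
  assumes 1: "\<And>x. has_pd j f (fj x) x" and 2: "\<And>x. has_pd l fj (flj x) x" and h: "0 < h"
  shows "\<exists>y. dist y x \<le> 2 * h \<and>
    f (x + h *\<^sub>R axis j 1 + h *\<^sub>R axis l 1) - f (x + h *\<^sub>R axis j 1) - f (x + h *\<^sub>R axis l 1) + f x = h * h * flj y"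
proof -
  let ?e = "axis j 1 :: real^'d" and ?k = "axis l 1 :: real^'d"
  define g where "g t = f ((x + h *\<^sub>R ?k) + t *\<^sub>R ?e) - f (x + t *\<^sub>R ?e)" for t
  have "(g has_real_derivative (fj ((x + h *\<^sub>R ?k) + t *\<^sub>R ?e) - fj (x + t *\<^sub>R ?e))) (at t)" for t
    unfolding g_def has_real_derivative_iff_has_vector_derivative
    by (intro has_vector_derivative_diff has_pd_line 1)
  from MVT2[OF h this] obtain t where t: "0 < t" "t < h"
    and gt: "g h - g 0 = h * (fj ((x + h *\<^sub>R ?k) + t *\<^sub>R ?e) - fj (x + t *\<^sub>R ?e))" by force
  have "((\<lambda>r. fj ((x + t *\<^sub>R ?e) + r *\<^sub>R ?k)) has_real_derivative flj ((x + t *\<^sub>R ?e) + r *\<^sub>R ?k)) (at r)" for r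
    unfolding has_real_derivative_iff_has_vector_derivative
    by (intro has_pd_line 2)
  from MVT2[OF h this] obtain r where r: "0 < r" "r < h"
    and gr: "fj ((x + t *\<^sub>R ?e) + h *\<^sub>R ?k) - fj ((x + t *\<^sub>R ?e) + 0 *\<^sub>R ?k) = h * flj ((x + t *\<^sub>R ?e) + r *\<^sub>R ?k)"
    by force
  have "dist (x + t *\<^sub>R ?e + r *\<^sub>R ?k) x \<le> norm (t *\<^sub>R ?e) + norm (r *\<^sub>R ?k)"
    using norm_triangle_ineq[of "t *\<^sub>R ?e" "r *\<^sub>R ?k"] by (simp add: dist_norm algebra_simps)
  also have "\<dots> \<le> 2 * h" using t r by simp
  finally show ?thesis
    using gt gr by (intro exI[of _ "x + t *\<^sub>R ?e + r *\<^sub>R ?k"]) (simp add: g_def algebra_simps)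
qed

text \<open>If the mixed derivatives differed at \<open>x\<close>, continuity would keep them apart on a ball, but on each
  small square both of them attain the value of the same second difference quotient.\<close>

lemma pd_commute_real:
  fixes f :: "real^'d::finite \<Rightarrow> real"
  assumes "\<And>x. has_pd j f (fj x) x" "\<And>x. has_pd l f (fl x) x"
    "\<And>x. has_pd l fj (flj x) x" "\<And>x. has_pd j fl (fjl x) x"
    "continuous_on UNIV flj" "continuous_on UNIV fjl"
  shows "flj x = fjl x"
proof (rule ccontr)
  assume ne: "flj x \<noteq> fjl x"
  let ?e = "\<bar>flj x - fjl x\<bar> / 2"
  have e: "?e > 0" using ne by simp
  obtain d1 where d1: "d1 > 0" "\<And>y. dist y x < d1 \<Longrightarrow> dist (flj y) (flj x) < ?e"
    using assms(5) e unfolding continuous_on_iff by (metis UNIV_I)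
  obtain d2 where d2: "d2 > 0" "\<And>y. dist y x < d2 \<Longrightarrow> dist (fjl y) (fjl x) < ?e"
    using assms(6) e unfolding continuous_on_iff by (metis UNIV_I)
  define h where "h = min d1 d2 / 3"
  have h: "h > 0" "2 * h < d1" "2 * h < d2" using d1(1) d2(1) by (auto simp: h_def)
  obtain y where y: "dist y x \<le> 2 * h"
    "f (x + h *\<^sub>R axis j 1 + h *\<^sub>R axis l 1) - f (x + h *\<^sub>R axis j 1) - f (x + h *\<^sub>R axis l 1) + f x = h * h * flj y"
    using second_diff_mvt[OF assms(1,3) h(1)] by blast
  obtain y' where y': "dist y' x \<le> 2 * h"
    "f (x + h *\<^sub>R axis l 1 + h *\<^sub>R axis j 1) - f (x + h *\<^sub>R axis l 1) - f (x + h *\<^sub>R axis j 1) + f x = h * h * fjl y'"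
    using second_diff_mvt[OF assms(2,4) h(1)] by blast
  have "h * h * flj y = h * h * fjl y'" using y(2) y'(2) by (simp add: algebra_simps)
  then have "flj y = fjl y'" using h(1) by simp
  moreover have "dist (flj y) (flj x) < ?e" "dist (fjl y') (fjl x) < ?e"
    using y(1) y'(1) h d1(2) d2(2) by auto
  ultimately show False using ne unfolding dist_real_def by (smt (verit) field_sum_of_halves)
qed

lemma pd_commute:
  fixes f :: "real^'d::finite \<Rightarrow> complex"
  assumes "\<And>x. has_pd j f (fj x) x" "\<And>x. has_pd l f (fl x) x"
    "\<And>x. has_pd l fj (flj x) x" "\<And>x. has_pd j fl (fjl x) x"
    "continuous_on UNIV flj" "continuous_on UNIV fjl"
  shows "flj x = fjl x"
proof (rule complex_eqI)
  note L = has_pd_linear[OF bounded_linear_Re] has_pd_linear[OF bounded_linear_Im]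
  show "Re (flj x) = Re (fjl x)"
    by (rule pd_commute_real[of j "\<lambda>x. Re (f x)" "\<lambda>x. Re (fj x)" l "\<lambda>x. Re (fl x)"])
      (intro L assms(1-4) continuous_intros assms(5,6))+
  show "Im (flj x) = Im (fjl x)"
    by (rule pd_commute_real[of j "\<lambda>x. Im (f x)" "\<lambda>x. Im (fj x)" l "\<lambda>x. Im (fl x)"])
      (intro L assms(1-4) continuous_intros assms(5,6))+
qed

section \<open>Integration by parts\<close>

lemma integrable_compact_support:
  fixes f :: "real^'d::finite \<Rightarrow> 'b::{banach, second_countable_topology}"
  assumes "continuous_on UNIV f" "compact K" "\<And>x. x \<notin> K \<Longrightarrow> f x = 0"
  shows "integrable lborel f"
proof -
  have "integrable lborel (\<lambda>x. indicator K x *\<^sub>R f x)"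
    using assms by (intro borel_integrable_compact) (auto intro: continuous_on_subset)
  moreover have "(\<lambda>x. indicator K x *\<^sub>R f x) = f" using assms(3) by (auto simp: fun_eq_iff indicator_def)
  ultimately show ?thesis by simp
qed

lemma integral_shift:
  fixes f :: "real^'d::finite \<Rightarrow> real"
  assumes "f \<in> borel_measurable borel"
  shows "integral\<^sup>L lborel (\<lambda>x. f (x + a)) = integral\<^sup>L lborel f"
  using integral_distr[of "(+) a" lborel borel f] assms by (simp add: lborel_distr_plus add.commute)

lemma integrable_shift:
  fixes f :: "real^'d::finite \<Rightarrow> real"
  assumes "integrable lborel f"
  shows "integrable lborel (\<lambda>x. f (x + a))"
  using integrable_distr_eq[of "(+) a" lborel borel f] assms by (simp add: lborel_distr_plus add.commute)

text \<open>By translation invariance every difference quotient has integral zero.  The quotients converge to the derivative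
  pointwise, dominated by a multiple of the indicator of a ball.\<close>

lemma integral_pd_zero:
  fixes h h' :: "real^'d::finite \<Rightarrow> real"
  assumes pd: "\<And>x. has_pd j h (h' x) x" and c: "continuous_on UNIV h" "continuous_on UNIV h'"
    and K: "compact K" "\<And>x. x \<notin> K \<Longrightarrow> h x = 0"
  shows "integral\<^sup>L lborel h' = 0"
proof -
  let ?e = "axis j 1 :: real^'d"
  have h'0: "h' x = 0" if "x \<notin> K" for x
    using has_pd_unique[OF pd has_pd_off_support[OF compact_imp_closed[OF K(1)] K(2)]] that by blast
  have ih: "integrable lborel h" by (rule integrable_compact_support[OF c(1) K])
  obtain R where R: "\<And>x. x \<in> K \<Longrightarrow> norm x \<le> R"
    using compact_imp_bounded[OF K(1)] unfolding bounded_iff by blast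
  have "bounded (h' ` K)" using compact_continuous_image[OF continuous_on_subset[OF c(2)] K(1)] compact_imp_bounded by blast
  then obtain M where M: "\<And>x. x \<in> K \<Longrightarrow> norm (h' x) \<le> M" unfolding bounded_iff by blast
  have M': "\<bar>h' x\<bar> \<le> \<bar>M\<bar>" for x using M[of x] h'0[of x] by (cases "x \<in> K") auto
  define q where "q n x = (h (x + (1 / real (Suc n)) *\<^sub>R ?e) - h x) / (1 / real (Suc n))" for n x
  have lim: "(\<lambda>n. q n x) \<longlonglongrightarrow> h' x" for x
  proof -
    have "((\<lambda>t. h (x + t *\<^sub>R ?e)) has_real_derivative h' x) (at 0)"
      using pd[of x] unfolding has_pd_def has_real_derivative_iff_has_vector_derivative .
    then have "((\<lambda>t. (h (x + t *\<^sub>R ?e) - h x) / t) \<longlongrightarrow> h' x) (at 0)"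
      by (simp add: DERIV_def)
    moreover have "filterlim (\<lambda>n. 1 / real (Suc n)) (at 0) sequentially"
      unfolding filterlim_at using LIMSEQ_inverse_real_of_nat by (auto simp: inverse_eq_divide)
    ultimately show ?thesis unfolding q_def by (rule filterlim_compose)
  qed
  have bound: "\<bar>q n x\<bar> \<le> \<bar>M\<bar> * indicator (cball 0 (R + 1)) x" for n x
  proof (cases "x \<in> cball 0 (R + 1)")
    case True
    let ?d = "1 / real (Suc n)"
    have "\<And>t. ((\<lambda>t. h (x + t *\<^sub>R ?e)) has_real_derivative h' (x + t *\<^sub>R ?e)) (at t)"
      unfolding has_real_derivative_iff_has_vector_derivative by (rule has_pd_line[OF pd])
    from MVT2[OF _ this, of 0 ?d] obtain t where
      "h (x + ?d *\<^sub>R ?e) - h (x + 0 *\<^sub>R ?e) = (?d - 0) * h' (x + t *\<^sub>R ?e)" by force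
    then have "q n x = h' (x + t *\<^sub>R ?e)" by (simp add: q_def)
    then show ?thesis using M' True by simp
  next
    case False
    then have *: "norm x > R + 1" by simp
    have "norm (x + (1 / real (Suc n)) *\<^sub>R ?e) \<ge> norm x - norm ((1 / real (Suc n)) *\<^sub>R ?e)"
      by (rule norm_diff_ineq)
    moreover have "norm ((1 / real (Suc n)) *\<^sub>R ?e) \<le> 1" by simp
    ultimately have "norm (x + (1 / real (Suc n)) *\<^sub>R ?e) > R" using * by linarith
    then have "x + (1 / real (Suc n)) *\<^sub>R ?e \<notin> K" "x \<notin> K" using R * by force+
    then show ?thesis using K(2) by (simp add: q_def)
  qed
  have iq: "integrable lborel (q n)" for n
    unfolding q_def by (intro integrable_divide Bochner_Integration.integrable_diff integrable_shift ih)
  have "(\<lambda>n. integral\<^sup>L lborel (q n)) \<longlonglongrightarrow> integral\<^sup>L lborel h'"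
  proof (rule integral_dominated_convergence[where w = "\<lambda>x. \<bar>M\<bar> * indicator (cball 0 (R + 1)) x"])
    show "h' \<in> borel_measurable lborel" using c(2) by (simp add: borel_measurable_continuous_onI)
    show "integrable lborel (\<lambda>x::real^'d. \<bar>M\<bar> * indicator (cball 0 (R + 1)) x)"
      by (intro integrable_mult_right integrable_real_indicator) (use emeasure_lborel_cball_finite[of "0::real^'d" "R + 1"] in auto)
  qed (use lim bound iq in auto)
  moreover have "integral\<^sup>L lborel (q n) = 0" for n
    unfolding q_def using ih integrable_shift[OF ih] integral_shift[of h] c(1)
    by (simp add: borel_measurable_continuous_onI)
  ultimately show ?thesis by (simp add: LIMSEQ_const_iff)
qed

lemma continuous_on_extend_zero:
  fixes f :: "real^'d::finite \<Rightarrow> 'b::real_normed_vector"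
  assumes "open U" "closed K" "K \<subseteq> U" "continuous_on U f" "\<And>x. x \<notin> K \<Longrightarrow> f x = 0"
  shows "continuous_on UNIV f"
proof -
  have "continuous_on (- K) f"
    by (rule continuous_on_eq[OF continuous_on_const[of _ 0]]) (use assms(5) in auto)
  then have "continuous_on (U \<union> - K) f" using assms by (intro continuous_on_open_Un) auto
  moreover have "U \<union> - K = UNIV" using assms(3) by auto
  ultimately show ?thesis by simp
qed

text \<open>Only \<open>h\<close> lives on the whole space.  The factor \<open>f\<close> will be a weight, about which
  nothing is known outside \<open>U\<close>; the support of \<open>h\<close> makes the products differentiable
  everywhere.\<close>

lemma integration_by_parts:
  fixes f h :: "real^'d::finite \<Rightarrow> real"
  assumes U: "open U" "compact K" "K \<subseteq> U"
    and f: "\<And>x. x \<in> U \<Longrightarrow> has_pd j f (f' x) x" "continuous_on U f" "continuous_on U f'"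
    and h: "\<And>x. has_pd j h (h' x) x" "continuous_on UNIV h" "continuous_on UNIV h'"
    and K: "\<And>x. x \<notin> K \<Longrightarrow> h x = 0" "\<And>x. x \<notin> K \<Longrightarrow> h' x = 0"
  shows "integral\<^sup>L lborel (\<lambda>x. f x * h' x) = - integral\<^sup>L lborel (\<lambda>x. f' x * h x)"
proof -
  note cl = compact_imp_closed[OF U(2)]
  have cU: "continuous_on U h" "continuous_on U h'" using h continuous_on_subset by blast+
  have c: "continuous_on UNIV (\<lambda>x. f x * h x)" "continuous_on UNIV (\<lambda>x. f x * h' x)" "continuous_on UNIV (\<lambda>x. f' x * h x)"
    by (rule continuous_on_extend_zero[OF U(1) cl U(3)]; use f cU K in \<open>auto intro!: continuous_intros\<close>)+
  have "has_pd j (\<lambda>x. f x * h x) (f x * h' x + f' x * h x) x" for x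
  proof (cases "x \<in> K")
    case True then show ?thesis using f h U by (intro has_pd_mult) auto
  next
    case False
    then have "has_pd j (\<lambda>x. f x * h x) 0 x" using K by (intro has_pd_off_support[OF cl]) auto
    then show ?thesis using K False by simp
  qed
  then have "integral\<^sup>L lborel (\<lambda>x. f x * h' x + f' x * h x) = 0"
    using c K by (intro integral_pd_zero[OF _ c(1) _ U(2)]) (auto intro!: continuous_intros)
  moreover have "integrable lborel (\<lambda>x. f x * h' x)" "integrable lborel (\<lambda>x. f' x * h x)"
    using c K by (auto intro!: integrable_compact_support[OF _ U(2)])
  ultimately show ?thesis by simp
qed

section \<open>Clifford systems and null forms\<close>

text \<open>The operators \<open>A j\<close> are the symbols of a Dirac type operator \<open>D = \<Sum>\<^sub>j A\<^sub>j
  \<partial>\<^sub>j\<close>; for \<open>j = k\<close> the relation says that each of them is an isometry.\<close>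

locale clifford =
  fixes A :: "'d::finite \<Rightarrow> 'v::euclidean_space \<Rightarrow> 'v"
  assumes lin: "linear (A j)"
    and rel: "inner (A j x) (A k y) + inner (A k x) (A j y) = (if j = k then 2 * inner x y else 0)"
begin

definition skew :: "'d \<Rightarrow> 'd \<Rightarrow> 'v \<Rightarrow> 'v \<Rightarrow> real" where
  "skew k j x y = inner (A k x) (A j y) - (if k = j then inner x y else 0)"

lemma norm_A: "norm (A j x) = norm x"
proof -
  have "inner (A j x) (A j x) = inner x x" using rel[of j x j x] by simp
  then show ?thesis by (simp add: norm_eq_sqrt_inner)
qed

lemma skew_antisym_index: "skew k j x y = - skew j k x y"
  using rel[of k x j y] by (auto simp: skew_def)

lemma skew_antisym: "skew k j x y = - skew k j y x"
  using rel[of k x j y] by (auto simp: skew_def inner_commute)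

lemma skew_bound: "\<bar>skew k j x y\<bar> \<le> 2 * (norm x * norm y)"
proof -
  have "\<bar>inner (A k x) (A j y)\<bar> \<le> norm x * norm y"
    using Cauchy_Schwarz_ineq2[of "A k x" "A j y"] by (simp add: norm_A)
  moreover have "\<bar>inner x y\<bar> \<le> norm x * norm y" by (rule Cauchy_Schwarz_ineq2)
  ultimately show ?thesis unfolding skew_def by (auto split: if_splits)
qed

lemma skew_bilinear: "bounded_bilinear (skew k j)"
proof (rule bounded_bilinear.intro)
  show "\<exists>K. \<forall>x y. norm (skew k j x y) \<le> norm x * norm y * K"
    using skew_bound by (auto intro!: exI[of _ 2] simp: mult_ac)
qed (auto simp: skew_def linear_add[OF lin] linear_cmul[OF lin] algebra_simps inner_simps)

lemmas skew_add_left = bounded_bilinear.add_left[OF skew_bilinear]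
lemmas skew_scaleR_left = bounded_bilinear.scaleR_left[OF skew_bilinear]
lemmas skew_sum_left = bounded_bilinear.sum_left[OF skew_bilinear]
lemmas skew_zero_left = bounded_bilinear.zero_left[OF skew_bilinear]
lemmas skew_zero_right = bounded_bilinear.zero_right[OF skew_bilinear]

lemma inner_A: "inner (A k x) (A j y) = skew k j x y + (if k = j then inner x y else 0)"
  by (simp add: skew_def)

text \<open>A skew family paired with the symmetric family \<open>p k * p j\<close>.\<close>

lemma sum_antisym_zero:
  fixes p :: "'d \<Rightarrow> real"
  shows "(\<Sum>k\<in>UNIV. \<Sum>j\<in>UNIV. p k * p j * skew k j x y) = 0"
proof -
  let ?S = "\<Sum>k\<in>UNIV. \<Sum>j\<in>UNIV. p k * p j * skew k j x y"
  have "?S = (\<Sum>j\<in>UNIV. \<Sum>k\<in>UNIV. p k * p j * skew k j x y)" by (rule sum.swap)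
  also have "\<dots> = - ?S"
    by (subst skew_antisym_index) (simp add: sum_negf mult_ac)
  finally show ?thesis by simp
qed

lemma norm_D_sq:
  "(norm (\<Sum>j\<in>UNIV. A j (y j)))\<^sup>2 = (\<Sum>j\<in>UNIV. (norm (y j))\<^sup>2) + (\<Sum>k\<in>UNIV. \<Sum>j\<in>UNIV. skew k j (y k) (y j))"
proof -
  have "(norm (\<Sum>j\<in>UNIV. A j (y j)))\<^sup>2 = (\<Sum>k\<in>UNIV. \<Sum>j\<in>UNIV. inner (A k (y k)) (A j (y j)))"
    unfolding power2_norm_eq_inner inner_sum_left inner_sum_right by (rule sum.swap)
  also have "\<dots> = (\<Sum>k\<in>UNIV. \<Sum>j\<in>UNIV. skew k j (y k) (y j)) + (\<Sum>k\<in>UNIV. inner (y k) (y k))"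
    by (simp add: inner_A sum.distrib sum.delta)
  finally show ?thesis by (simp add: power2_norm_eq_inner)
qed

text \<open>The symbol of \<open>D\<close> at a covector \<open>p\<close> is \<open>|p|\<close> times an isometry: this is
  the ellipticity of \<open>D\<close>.\<close>

lemma norm_M_sq:
  fixes p :: "'d \<Rightarrow> real"
  shows "(norm (\<Sum>j\<in>UNIV. p j *\<^sub>R A j y))\<^sup>2 = (\<Sum>j\<in>UNIV. (p j)\<^sup>2) * (norm y)\<^sup>2"
proof -
  have 1: "(\<Sum>k\<in>UNIV. \<Sum>j\<in>UNIV. skew k j (p k *\<^sub>R y) (p j *\<^sub>R y)) = 0"
    using sum_antisym_zero[of p y y]
    by (simp add: bounded_bilinear.scaleR_right[OF skew_bilinear] skew_scaleR_left mult_ac)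
  have "(norm (\<Sum>j\<in>UNIV. p j *\<^sub>R A j y))\<^sup>2 = (norm (\<Sum>j\<in>UNIV. A j (p j *\<^sub>R y)))\<^sup>2"
    by (simp add: linear_cmul[OF lin])
  also have "\<dots> = (\<Sum>j\<in>UNIV. (norm (p j *\<^sub>R y))\<^sup>2)" unfolding norm_D_sq 1 by simp
  finally show ?thesis by (simp add: power_mult_distrib sum_distrib_right)
qed

text \<open>Here \<open>p\<close> stands for the gradient of \<open>\<psi>\<close>, \<open>y j\<close> the
  \<open>j\<close>-th derivative of \<open>u\<close>, and \<open>\<nu>\<close> the large parameter.  The
  inequality is \<open>|D u|\<^sup>2 \<ge> 2 \<langle>P, D u - P\<rangle>\<close> for a suitable \<open>P\<close>
  in the range of the symbol at \<open>p\<close>.  The terms quadratic in the derivatives along \<open>p\<close>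
  cancel, and the other quadratic terms are null forms.\<close>

lemma pointwise_lower:
  fixes p :: "'d \<Rightarrow> real" and y :: "'d \<Rightarrow> 'v"
  assumes S: "S = (\<Sum>j\<in>UNIV. (p j)\<^sup>2)" "S > 0"
  shows "(\<Sum>k\<in>UNIV. \<Sum>j\<in>UNIV. \<Sum>l\<in>UNIV. 2 * (p l * p k / S) * skew k j (y l) (y j))
      + (\<Sum>k\<in>UNIV. \<Sum>j\<in>UNIV. 2 * \<nu> * p k * skew k j u (y j))
      - (\<Sum>k\<in>UNIV. 2 * \<nu> * p k * inner u (y k)) - 2 * \<nu>\<^sup>2 * S * (norm u)\<^sup>2
    \<le> (norm (\<Sum>j\<in>UNIV. A j (y j)))\<^sup>2" (is "?L \<le> (norm ?D)\<^sup>2")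
proof -
  \<comment> \<open>\<open>X\<close> is the derivative of \<open>u\<close> along \<open>p\<close>.  The factor \<open>1 / S\<close> in \<open>v\<close> cancels the terms \<open>|X|\<^sup>2\<close>, the part \<open>\<nu> u\<close> produces the terms with \<open>\<nu>\<close>.\<close>
  define X where "X = (\<Sum>l\<in>UNIV. p l *\<^sub>R y l)"
  define v where "v = (1 / S) *\<^sub>R X + \<nu> *\<^sub>R u"
  define P where "P = (\<Sum>j\<in>UNIV. p j *\<^sub>R A j v)"
  have PP: "inner P P = S * inner v v"
    using norm_M_sq[of p v] S by (simp add: P_def power2_norm_eq_inner)
  have "inner P ?D = (\<Sum>k\<in>UNIV. \<Sum>j\<in>UNIV. p k * inner (A k v) (A j (y j)))"
    unfolding P_def inner_sum_left inner_sum_right inner_scaleR_left by (rule sum.swap)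
  also have "\<dots> = (\<Sum>k\<in>UNIV. \<Sum>j\<in>UNIV. p k * skew k j v (y j)) + (\<Sum>k\<in>UNIV. p k * inner v (y k))"
    by (simp add: inner_A algebra_simps sum.distrib if_distrib[of "\<lambda>z. _ * z"] sum.delta cong: if_cong)
  also have "(\<Sum>k\<in>UNIV. p k * inner v (y k)) = inner v X" by (simp add: X_def inner_sum_right)
  finally have PD: "inner P ?D = (\<Sum>k\<in>UNIV. \<Sum>j\<in>UNIV. p k * skew k j v (y j)) + inner v X" .
  have bv: "skew k j v (y j) = (\<Sum>l\<in>UNIV. (p l / S) * skew k j (y l) (y j)) + \<nu> * skew k j u (y j)" for k j
    by (simp add: v_def X_def skew_add_left skew_scaleR_left skew_sum_left sum_distrib_left sum_divide_distrib)
  have uX: "(\<Sum>k\<in>UNIV. 2 * \<nu> * p k * inner u (y k)) = 2 * \<nu> * inner u X"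
    by (simp add: X_def inner_sum_right sum_distrib_left mult_ac)
  have 1: "(\<Sum>k\<in>UNIV. \<Sum>j\<in>UNIV. \<Sum>l\<in>UNIV. 2 * (p l * p k / S) * skew k j (y l) (y j))
      + (\<Sum>k\<in>UNIV. \<Sum>j\<in>UNIV. 2 * \<nu> * p k * skew k j u (y j)) = 2 * (\<Sum>k\<in>UNIV. \<Sum>j\<in>UNIV. p k * skew k j v (y j))"
    unfolding bv sum_distrib_left sum.distrib[symmetric]
    by (intro sum.cong refl) (simp add: sum_distrib_left algebra_simps)
  have Sv: "S *\<^sub>R v = X + (\<nu> * S) *\<^sub>R u" using S(2) by (simp add: v_def algebra_simps)
  have "2 * inner v X - 2 * inner P P = 2 * inner v (X - S *\<^sub>R v)" by (simp add: PP inner_diff_right)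
  also have "X - S *\<^sub>R v = - ((\<nu> * S) *\<^sub>R u)" by (simp add: Sv)
  also have "2 * inner v (- ((\<nu> * S) *\<^sub>R u)) = - 2 * \<nu> * inner (S *\<^sub>R v) u" by simp
  also have "\<dots> = - 2 * \<nu> * inner u X - 2 * \<nu>\<^sup>2 * S * (norm u)\<^sup>2"
    unfolding Sv power2_norm_eq_inner by (simp add: inner_add_left power2_eq_square algebra_simps inner_commute)
  finally have 2: "2 * inner v X - 2 * inner P P = - 2 * \<nu> * inner u X - 2 * \<nu>\<^sup>2 * S * (norm u)\<^sup>2" .
  have "?L = 2 * inner P ?D - 2 * inner P P" using 1 2 PD uX by simp
  also have "\<dots> \<le> inner ?D ?D"
    using inner_ge_zero[of "?D - P"] inner_ge_zero[of P]
    unfolding inner_diff_left inner_diff_right inner_commute[of ?D P] by linarith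
  finally show ?thesis by (simp add: power2_norm_eq_inner)
qed

end

text \<open>A twice continuously differentiable function with support in a compact subset of \<open>U\<close>, carried
  together with its first and second derivatives, so that tuples of derivatives of test functions can be inserted
  directly.\<close>

locale clifford_jet = clifford A for A :: "'d::finite \<Rightarrow> 'v::euclidean_space \<Rightarrow> 'v" +
  fixes U K :: "(real^'d) set" and u :: "real^'d \<Rightarrow> 'v"
    and u1 :: "'d \<Rightarrow> real^'d \<Rightarrow> 'v" and u2 :: "'d \<Rightarrow> 'd \<Rightarrow> real^'d \<Rightarrow> 'v"
  assumes U: "open U" and K: "compact K" "K \<subseteq> U"
    and pd1: "has_pd j u (u1 j x) x" and pd2: "has_pd l (u1 j) (u2 l j x) x"
    and sym: "u2 l j x = u2 j l x"
    and cont: "continuous_on UNIV u" "continuous_on UNIV (u1 j)" "continuous_on UNIV (u2 l j)"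
    and zero: "x \<notin> K \<Longrightarrow> u x = 0" "x \<notin> K \<Longrightarrow> u1 j x = 0" "x \<notin> K \<Longrightarrow> u2 l j x = 0"
begin

lemma contU: "continuous_on U u" "continuous_on U (u1 j)" "continuous_on U (u2 l j)"
  by (rule continuous_on_subset[OF _ subset_UNIV]; rule cont)+

lemmas cont_skew = bounded_bilinear.continuous_on[OF skew_bilinear]

lemma integrable_on_support:
  fixes f :: "real^'d \<Rightarrow> real"
  assumes "continuous_on U f" "\<And>x. x \<notin> K \<Longrightarrow> f x = 0"
  shows "integrable lborel f"
  by (intro integrable_compact_support[OF _ K(1)] assms(2)
      continuous_on_extend_zero[OF U compact_imp_closed[OF K(1)] K(2)] assms(1))

definition Du :: "real^'d \<Rightarrow> 'v" where "Du x = (\<Sum>j\<in>UNIV. A j (u1 j x))"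

lemma contA: "continuous_on S f \<Longrightarrow> continuous_on S (\<lambda>x. A j (f x))"
  by (rule bounded_linear.continuous_on[OF linear_conv_bounded_linear[THEN iffD1, OF lin]])

lemma contDu: "continuous_on U Du"
  unfolding Du_def by (intro continuous_intros contA contU)

lemma Du_zero: "x \<notin> K \<Longrightarrow> Du x = 0"
  by (simp add: Du_def zero linear_0[OF lin])

text \<open>Integrate by parts once in direction \<open>l\<close> on the first factor and once in direction \<open>j\<close>
  on the second.  The two second derivative terms are \<open>skew k j (u, \<partial>\<^sub>l\<partial>\<^sub>j
  u)\<close> and \<open>skew k j (\<partial>\<^sub>j\<partial>\<^sub>l u, u)\<close>, which cancel by skewness.\<close>

lemma null_form:
  assumes f: "\<And>x. x \<in> U \<Longrightarrow> has_pd l f (fl x) x" "\<And>x. x \<in> U \<Longrightarrow> has_pd j f (fj x) x"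
    and c: "continuous_on U f" "continuous_on U fl" "continuous_on U fj"
  shows "integral\<^sup>L lborel (\<lambda>x. 2 * f x * skew k j (u1 l x) (u1 j x)) =
    integral\<^sup>L lborel (\<lambda>x. - (fl x * skew k j (u x) (u1 j x) + fj x * skew k j (u1 l x) (u x)))"
proof -
  note [simp] = zero skew_zero_left skew_zero_right
  have 1: "integral\<^sup>L lborel (\<lambda>x. f x * (skew k j (u x) (u2 l j x) + skew k j (u1 l x) (u1 j x))) =
      - integral\<^sup>L lborel (\<lambda>x. fl x * skew k j (u x) (u1 j x))"
    by (rule integration_by_parts[OF U K f(1) c(1,2)])
      (auto intro!: has_pd_bilinear[OF skew_bilinear] pd1 pd2 continuous_intros cont_skew cont)
  have 2: "integral\<^sup>L lborel (\<lambda>x. f x * (skew k j (u1 l x) (u1 j x) + skew k j (u2 j l x) (u x))) =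
      - integral\<^sup>L lborel (\<lambda>x. fj x * skew k j (u1 l x) (u x))"
    by (rule integration_by_parts[OF U K f(2) c(1,3)])
      (auto intro!: has_pd_bilinear[OF skew_bilinear] pd1 pd2 continuous_intros cont_skew cont)
  have i: "integrable lborel (\<lambda>x. f x * (skew k j (u x) (u2 l j x) + skew k j (u1 l x) (u1 j x)))"
     "integrable lborel (\<lambda>x. f x * (skew k j (u1 l x) (u1 j x) + skew k j (u2 j l x) (u x)))"
     "integrable lborel (\<lambda>x. fl x * skew k j (u x) (u1 j x))" "integrable lborel (\<lambda>x. fj x * skew k j (u1 l x) (u x))"
    by (rule integrable_on_support; auto intro!: continuous_intros cont_skew contU c)+
  have "2 * f x * skew k j (u1 l x) (u1 j x) =
     f x * (skew k j (u x) (u2 l j x) + skew k j (u1 l x) (u1 j x)) + f x * (skew k j (u1 l x) (u1 j x) + skew k j (u2 j l x) (u x))" for x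
    using skew_antisym[of k j "u x" "u2 l j x"] sym[of l j x] by (simp add: algebra_simps)
  then have "integral\<^sup>L lborel (\<lambda>x. 2 * f x * skew k j (u1 l x) (u1 j x)) =
     integral\<^sup>L lborel (\<lambda>x. f x * (skew k j (u x) (u2 l j x) + skew k j (u1 l x) (u1 j x)))
     + integral\<^sup>L lborel (\<lambda>x. f x * (skew k j (u1 l x) (u1 j x) + skew k j (u2 j l x) (u x)))"
    using i by simp
  then show ?thesis unfolding 1 2 using i by simp
qed

text \<open>\<open>|D u|\<^sup>2\<close> and \<open>|\<nabla> u|\<^sup>2\<close> differ by null forms, so their weighted
  integrals differ by terms containing one derivative of the weight, which Young's inequality absorbs at the price
  of \<open>m\<^sup>2 |u|\<^sup>2\<close>.\<close>

lemma gradient_bound: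
  fixes W m :: "real^'d \<Rightarrow> real"
  assumes W: "\<And>j x. x \<in> U \<Longrightarrow> has_pd j W (W1 j x) x" "continuous_on U W" "\<And>j. continuous_on U (W1 j)"
    and pos: "\<And>x. x \<in> U \<Longrightarrow> W x \<ge> 0" and m: "continuous_on U m"
    and le: "\<And>j x. x \<in> U \<Longrightarrow> \<bar>W1 j x\<bar> \<le> m x * W x"
  shows "integral\<^sup>L lborel (\<lambda>x. W x * (\<Sum>j\<in>UNIV. (norm (u1 j x))\<^sup>2)) \<le>
    2 * integral\<^sup>L lborel (\<lambda>x. W x * (norm (Du x))\<^sup>2)
    + 4 * (real CARD('d))^3 * integral\<^sup>L lborel (\<lambda>x. (m x)\<^sup>2 * W x * (norm (u x))\<^sup>2)"
proof -
  note [simp] = zero skew_zero_left skew_zero_right Du_zero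
  note ci = continuous_intros cont_skew contU contDu W m
  let ?n = "real CARD('d)"
  let ?G = "\<lambda>x. W x * (\<Sum>j\<in>UNIV. (norm (u1 j x))\<^sup>2)"
  let ?D = "\<lambda>x. W x * (norm (Du x))\<^sup>2"
  let ?M = "\<lambda>x. (m x)\<^sup>2 * W x * (norm (u x))\<^sup>2"
  let ?N = "\<lambda>k j x. 2 * W x * skew k j (u1 k x) (u1 j x)"
  let ?N' = "\<lambda>k j x. - (W1 k x * skew k j (u x) (u1 j x) + W1 j x * skew k j (u1 k x) (u x))"
  have iG: "integrable lborel ?G" and iD: "integrable lborel ?D" and iM: "integrable lborel ?M"
    by (rule integrable_on_support; auto intro!: ci)+
  have iN: "integrable lborel (?N k j)" and iN': "integrable lborel (?N' k j)" for k j
    by (rule integrable_on_support; auto intro!: ci)+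
  have eq: "integral\<^sup>L lborel (?N k j) = integral\<^sup>L lborel (?N' k j)" for k j
    by (rule null_form) (use W in auto)
  have D: "2 * ?D x = 2 * ?G x + (\<Sum>k\<in>UNIV. \<Sum>j\<in>UNIV. ?N k j x)" for x
    by (simp add: Du_def norm_D_sq algebra_simps sum_distrib_left)
  have "2 * integral\<^sup>L lborel ?D = integral\<^sup>L lborel (\<lambda>x. 2 * ?G x + (\<Sum>k\<in>UNIV. \<Sum>j\<in>UNIV. ?N k j x))"
    unfolding D[symmetric] by simp
  also have "\<dots> = 2 * integral\<^sup>L lborel ?G + (\<Sum>k\<in>UNIV. \<Sum>j\<in>UNIV. integral\<^sup>L lborel (?N k j))"
    using iG iN by (subst Bochner_Integration.integral_add) (auto simp del: sum_negf intro!: Bochner_Integration.integrable_sum)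
  finally have 1: "2 * integral\<^sup>L lborel ?D = 2 * integral\<^sup>L lborel ?G + (\<Sum>k\<in>UNIV. \<Sum>j\<in>UNIV. integral\<^sup>L lborel (?N k j))" .
  have pt: "(\<Sum>k\<in>UNIV. \<Sum>j\<in>UNIV. - ?N' k j x) \<le> ?G x + 4 * ?n^3 * ?M x" for x
  proof (cases "x \<in> K")
    case True
    then have x: "x \<in> U" using K by auto
    let ?a = "norm (u x)" and ?y = "\<lambda>j. norm (u1 j x)"
    have mW: "0 \<le> m x * W x" using le[OF x, of undefined] by linarith
    have 1: "- ?N' k j x \<le> m x * W x * (2 * (?a * ?y j)) + m x * W x * (2 * (?y k * ?a))" for k j
    proof -
      have "W1 k x * skew k j (u x) (u1 j x) \<le> m x * W x * (2 * (?a * ?y j))"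
        using mult_mono[OF le[OF x, of k] skew_bound[of k j "u x" "u1 j x"] mW abs_ge_zero]
        by (simp add: abs_mult[symmetric])
      moreover have "W1 j x * skew k j (u1 k x) (u x) \<le> m x * W x * (2 * (?y k * ?a))"
        using mult_mono[OF le[OF x, of j] skew_bound[of k j "u1 k x" "u x"] mW abs_ge_zero]
        by (simp add: abs_mult[symmetric])
      ultimately show ?thesis by simp
    qed
    have "(\<Sum>k\<in>UNIV. \<Sum>j\<in>UNIV. - ?N' k j x) \<le>
        (\<Sum>k\<in>(UNIV::'d set). \<Sum>j\<in>(UNIV::'d set). m x * W x * (2 * (?a * ?y j)) + m x * W x * (2 * (?y k * ?a)))"
      by (intro sum_mono 1)
    also have "\<dots> = (\<Sum>j\<in>(UNIV::'d set). W x * (4 * ?n * m x * ?a * ?y j))"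
      by (simp add: sum.distrib sum_distrib_left sum_distrib_right algebra_simps)
    also have "\<dots> \<le> (\<Sum>j\<in>(UNIV::'d set). W x * ((?y j)\<^sup>2 + (2 * ?n * m x * ?a)\<^sup>2))"
    proof (intro sum_mono mult_left_mono pos[OF x])
      fix j
      show "4 * ?n * m x * ?a * ?y j \<le> (?y j)\<^sup>2 + (2 * ?n * m x * ?a)\<^sup>2"
        using zero_le_power2[of "?y j - 2 * ?n * m x * ?a"] by (simp add: power2_eq_square algebra_simps)
    qed
    also have "\<dots> = ?G x + 4 * ?n^3 * ?M x"
      by (simp add: sum.distrib sum_distrib_left algebra_simps power_mult_distrib power2_eq_square power3_eq_cube)
    finally show ?thesis .
  qed auto
  have "2 * integral\<^sup>L lborel ?G = 2 * integral\<^sup>L lborel ?D - (\<Sum>k\<in>UNIV. \<Sum>j\<in>UNIV. integral\<^sup>L lborel (?N' k j))"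
    using 1 unfolding eq by simp
  also have "\<dots> = 2 * integral\<^sup>L lborel ?D + integral\<^sup>L lborel (\<lambda>x. \<Sum>k\<in>UNIV. \<Sum>j\<in>UNIV. - ?N' k j x)"
    using iN' by (simp add: sum_negf del: minus_add_distrib)
  also have "\<dots> \<le> 2 * integral\<^sup>L lborel ?D + integral\<^sup>L lborel (\<lambda>x. ?G x + 4 * ?n^3 * ?M x)"
    using iG iM iN' pt by (intro add_left_mono integral_mono)
       (auto intro!: Bochner_Integration.integrable_sum simp del: minus_add_distrib)
  also have "\<dots> = 2 * integral\<^sup>L lborel ?D + (integral\<^sup>L lborel ?G + 4 * ?n^3 * integral\<^sup>L lborel ?M)"
    using iG iM by simp
  finally show ?thesis by simp
qed

end

section \<open>The Carleman inequality for a general weight\<close>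

text \<open>The \<open>i\<close>-th derivative of \<open>p\<^sub>l p\<^sub>k / |p|\<^sup>2\<close>, an entry of the
  orthogonal projection onto the direction of \<open>p\<close>, where \<open>p' i k\<close> is the
  \<open>i\<close>-th derivative of \<open>p k\<close>.  These entries are the coefficients of the null forms
  below; the large parameters do not occur in them.\<close>

definition proj_deriv ::
  "('d::finite \<Rightarrow> real^'d \<Rightarrow> real) \<Rightarrow> ('d \<Rightarrow> 'd \<Rightarrow> real^'d \<Rightarrow> real) \<Rightarrow> 'd \<Rightarrow> 'd \<Rightarrow> 'd \<Rightarrow> real^'d \<Rightarrow> real" where
  "proj_deriv p p' i l k x = (p' i l x * p k x + p l x * p' i k x) / (\<Sum>m\<in>UNIV. (p m x)\<^sup>2)
     - p l x * p k x * (\<Sum>m\<in>UNIV. 2 * p m x * p' i m x) / (\<Sum>m\<in>UNIV. (p m x)\<^sup>2)\<^sup>2"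

lemma has_pd_square_sum:
  assumes "\<And>k. has_pd i (p k) (p' i k x) x"
  shows "has_pd i (\<lambda>x. \<Sum>m\<in>UNIV. (p m x :: real)\<^sup>2) (\<Sum>m\<in>UNIV. 2 * p m x * p' i m x) x"
  unfolding power2_eq_square
  by (rule has_pd_eq[OF has_pd_sum[OF has_pd_mult[OF assms assms]]]) (simp add: mult_ac)

lemma has_pd_proj:
  assumes "\<And>k. has_pd i (p k) (p' i k x) x" "(\<Sum>m\<in>UNIV. (p m x)\<^sup>2) \<noteq> 0"
  shows "has_pd i (\<lambda>x. p l x * p k x / (\<Sum>m\<in>UNIV. (p m x :: real)\<^sup>2)) (proj_deriv p p' i l k x) x"
proof -
  have "(inverse has_vector_derivative (- (1 / (\<Sum>m\<in>UNIV. (p m x)\<^sup>2)\<^sup>2))) (at (\<Sum>m\<in>UNIV. (p m x)\<^sup>2))"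
    unfolding has_real_derivative_iff_has_vector_derivative[symmetric]
    using assms(2) by (auto intro!: derivative_eq_intros simp: power2_eq_square divide_inverse)
  from has_pd_chain[OF this has_pd_square_sum[where p=p and p'=p', OF assms(1)]]
  have "has_pd i (\<lambda>x. p l x * p k x * inverse (\<Sum>m\<in>UNIV. (p m x :: real)\<^sup>2))
    (p l x * p k x * ((\<Sum>m\<in>UNIV. 2 * p m x * p' i m x) *\<^sub>R (- (1 / (\<Sum>m\<in>UNIV. (p m x)\<^sup>2)\<^sup>2)))
      + (p l x * p' i k x + p' i l x * p k x) * inverse (\<Sum>m\<in>UNIV. (p m x)\<^sup>2)) x"
    by (intro has_pd_mult assms(1))
  then show ?thesis by (simp add: proj_deriv_def divide_inverse algebra_simps)
qed

context clifford_jet begin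

text \<open>The weight satisfies \<open>\<nabla> W = 2 \<lambda> W p\<close> and \<open>\<nabla> \<lambda> = \<mu>
  p\<close>, with \<open>\<lambda>\<close> written \<open>lam\<close> and \<open>\<mu>\<close> written
  \<open>mu\<close>.  Multiply \<open>pointwise_lower\<close> by \<open>W\<close> and integrate.  When the null
  forms are integrated by parts, the derivatives that fall on \<open>W\<close> cancel the term \<open>2 \<lambda>
  W \<Sum> p\<^sub>k b\<^sub>k\<^sub>j(u, \<partial>\<^sub>j u)\<close> with the skew forms \<open>b =
  skew\<close>; those that fall on the projection give the error on the right.  The remaining term \<open>- 2
  \<lambda> W u \<cdot> \<partial>\<^sub>p u\<close> is the divergence term that yields the positive left hand
  side.\<close>

lemma carleman_inequality_raw:
  fixes W lam mu :: "real^'d \<Rightarrow> real" and p :: "'d \<Rightarrow> real^'d \<Rightarrow> real" and p' :: "'d \<Rightarrow> 'd \<Rightarrow> real^'d \<Rightarrow> real"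
  defines "S \<equiv> \<lambda>x. \<Sum>m\<in>UNIV. (p m x)\<^sup>2"
  assumes p: "\<And>i k x. x \<in> U \<Longrightarrow> has_pd i (p k) (p' i k x) x"
    and W: "\<And>i x. x \<in> U \<Longrightarrow> has_pd i W (2 * lam x * p i x * W x) x"
    and lam: "\<And>i x. x \<in> U \<Longrightarrow> has_pd i lam (mu x * p i x) x"
    and c: "\<And>k. continuous_on U (p k)" "\<And>i k. continuous_on U (p' i k)" "continuous_on U W"
      "continuous_on U lam" "continuous_on U mu"
    and pos: "\<And>x. x \<in> U \<Longrightarrow> W x \<ge> 0" and Spos: "\<And>x. x \<in> U \<Longrightarrow> S x > 0"
    and R: "\<And>i l k x. x \<in> U \<Longrightarrow> \<bar>proj_deriv p p' i l k x\<bar> \<le> R"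
  shows "integral\<^sup>L lborel (\<lambda>x. W x * (norm (u x))\<^sup>2 * (mu x * S x + lam x * (\<Sum>k\<in>UNIV. p' k k x)))
    \<le> integral\<^sup>L lborel (\<lambda>x. W x * (norm (Du x))\<^sup>2)
      + 4 * R * (real CARD('d))\<^sup>2 * integral\<^sup>L lborel (\<lambda>x. W x * (norm (u x) * (\<Sum>j\<in>UNIV. norm (u1 j x))))"
proof -
  note [simp] = zero skew_zero_left skew_zero_right Du_zero
  define a where "a l k x = p l x * p k x / S x" for l k x
  define a' where "a' i l k x = proj_deriv p p' i l k x" for i l k x
  have S0: "S x \<noteq> 0" if "x \<in> U" for x using Spos[OF that] by simp
  have cS: "continuous_on U S" unfolding S_def by (intro continuous_intros c)
  have ca: "continuous_on U (a l k)" for l k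
    unfolding a_def using S0 by (intro continuous_intros cS c) auto
  have ca': "continuous_on U (a' i l k)" for i l k
    unfolding a'_def proj_deriv_def using S0[unfolded S_def] by (intro continuous_intros c) auto
  note ci = continuous_intros cont_skew contU contDu c cS ca ca'
  have pa: "has_pd i (a l k) (a' i l k x) x" if "x \<in> U" for i l k x
    using has_pd_proj[of i p p' x, OF p[OF that]] S0[OF that]
    by (simp add: a_def[abs_def] a'_def S_def)
  let ?n = "real CARD('d)"
  \<comment> \<open>\<open>N1\<close>, \<open>N2\<close>, \<open>N3\<close>, \<open>N4\<close> are the terms of the pointwise bound times \<open>W\<close>, a prime marks the result of an integration by parts, and \<open>E\<close> is what the derivatives of the projection contribute.\<close>
  define N1 where "N1 k j l x = 2 * (W x * a l k x) * skew k j (u1 l x) (u1 j x)" for k j l x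
  define Wa where "Wa i l k x = W x * a' i l k x + 2 * lam x * p i x * W x * a l k x" for i l k x
  define N1' where "N1' k j l x = - (Wa l l k x * skew k j (u x) (u1 j x) + Wa j l k x * skew k j (u1 l x) (u x))" for k j l x
  define N2 where "N2 x = (\<Sum>k\<in>UNIV. \<Sum>j\<in>UNIV. 2 * lam x * p k x * W x * skew k j (u x) (u1 j x))" for x
  define N3 where "N3 k x = lam x * p k x * W x * (2 * inner (u x) (u1 k x))" for k x
  define N3' where "N3' k x = W x * (mu x * (p k x)\<^sup>2 + 2 * (lam x)\<^sup>2 * (p k x)\<^sup>2 + lam x * p' k k x) * (norm (u x))\<^sup>2" for k x
  define N4 where "N4 x = 2 * (lam x)\<^sup>2 * S x * W x * (norm (u x))\<^sup>2" for x
  define E where "E k j l x = W x * (a' l l k x * skew k j (u x) (u1 j x) + a' j l k x * skew k j (u1 l x) (u x))" for k j l x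
  let ?D = "\<lambda>x. W x * (norm (Du x))\<^sup>2"
  let ?L = "\<lambda>x. W x * (norm (u x))\<^sup>2 * (mu x * S x + lam x * (\<Sum>k\<in>UNIV. p' k k x))"
  let ?G = "\<lambda>x. W x * (norm (u x) * (\<Sum>j\<in>UNIV. norm (u1 j x)))"
  have i: "integrable lborel (N1 k j l)" "integrable lborel (N1' k j l)" "integrable lborel N2"
    "integrable lborel (N3 k)" "integrable lborel (N3' k)" "integrable lborel N4" "integrable lborel (E k j l)"
    for k j l
    unfolding N1_def N1'_def N2_def N3_def N3'_def N4_def E_def Wa_def
    by (rule integrable_on_support; auto intro!: ci)+
  have i2: "integrable lborel ?D" "integrable lborel ?L" "integrable lborel ?G"
    by (rule integrable_on_support; auto intro!: ci)+
  have e1: "integral\<^sup>L lborel (N1 k j l) = integral\<^sup>L lborel (N1' k j l)" for k j l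
    unfolding N1_def N1'_def
  proof (rule null_form)
    have *: "has_pd i (\<lambda>x. W x * a l k x) (Wa i l k x) x" if "x \<in> U" for x i
      using has_pd_mult[OF W pa, OF that that] by (simp add: Wa_def)
    show "has_pd l (\<lambda>x. W x * a l k x) (Wa l l k x) x" if "x \<in> U" for x by (rule *[OF that])
    show "has_pd j (\<lambda>x. W x * a l k x) (Wa j l k x) x" if "x \<in> U" for x by (rule *[OF that])
  qed (auto simp: Wa_def[abs_def] intro!: ci)
  have e3: "integral\<^sup>L lborel (N3 k) = - integral\<^sup>L lborel (N3' k)" for k
  proof -
    have "integral\<^sup>L lborel (\<lambda>x. (lam x * p k x * W x) * (2 * inner (u x) (u1 k x)))
      = - integral\<^sup>L lborel (\<lambda>x. (W x * (mu x * (p k x)\<^sup>2 + 2 * (lam x)\<^sup>2 * (p k x)\<^sup>2 + lam x * p' k k x)) * (norm (u x))\<^sup>2)"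
    proof (rule integration_by_parts[OF U K, where j = k])
      show "has_pd k (\<lambda>x. lam x * p k x * W x) (W x * (mu x * (p k x)\<^sup>2 + 2 * (lam x)\<^sup>2 * (p k x)\<^sup>2 + lam x * p' k k x)) x"
        if "x \<in> U" for x
        by (rule has_pd_eq[OF has_pd_mult[OF has_pd_mult[OF lam p] W], OF that that that])
          (simp add: power2_eq_square algebra_simps)
      show "has_pd k (\<lambda>x. (norm (u x))\<^sup>2) (2 * inner (u x) (u1 k x)) x" for x
        unfolding power2_norm_eq_inner
        by (rule has_pd_eq[OF has_pd_bilinear[OF bounded_bilinear_inner pd1 pd1]]) (simp add: inner_commute)
    qed (auto intro!: continuous_intros c cont)
    then show ?thesis by (simp add: N3_def[abs_def] N3'_def[abs_def])
  qed
  have low: "(\<Sum>k\<in>UNIV. \<Sum>j\<in>UNIV. \<Sum>l\<in>UNIV. N1 k j l x) + N2 x - (\<Sum>k\<in>UNIV. N3 k x) - N4 x \<le> ?D x" for x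
  proof (cases "x \<in> U")
    case True
    have "W x * ((\<Sum>k\<in>UNIV. \<Sum>j\<in>UNIV. \<Sum>l\<in>UNIV. 2 * (p l x * p k x / S x) * skew k j (u1 l x) (u1 j x))
      + (\<Sum>k\<in>UNIV. \<Sum>j\<in>UNIV. 2 * lam x * p k x * skew k j (u x) (u1 j x))
      - (\<Sum>k\<in>UNIV. 2 * lam x * p k x * inner (u x) (u1 k x)) - 2 * (lam x)\<^sup>2 * S x * (norm (u x))\<^sup>2)
      \<le> W x * (norm (Du x))\<^sup>2"
      unfolding Du_def by (intro mult_left_mono pointwise_lower pos[OF True] Spos[OF True]) (simp add: S_def)
    then show ?thesis
      by (simp add: N1_def N2_def N3_def N4_def a_def sum_distrib_left distrib_left right_diff_distrib mult_ac)
  next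
    case False
    then have "x \<notin> K" using K by auto
    then show ?thesis by (simp add: N1_def N2_def N3_def N4_def)
  qed
  have alg: "(\<Sum>k\<in>UNIV. \<Sum>j\<in>UNIV. \<Sum>l\<in>UNIV. N1' k j l x) + N2 x + (\<Sum>k\<in>UNIV. N3' k x) - N4 x
     = ?L x - (\<Sum>k\<in>UNIV. \<Sum>j\<in>UNIV. \<Sum>l\<in>UNIV. E k j l x)" for x
  proof (cases "x \<in> U")
    case True
    have N3: "(\<Sum>k\<in>UNIV. N3' k x) - N4 x = ?L x"
      by (simp add: N3'_def N4_def S_def sum.distrib sum_distrib_left sum_distrib_right algebra_simps)
    have pa: "(\<Sum>l\<in>UNIV. p l x * a l k x) = p k x" for k
      using S0[OF True]
      by (simp add: a_def power2_eq_square[symmetric] sum_divide_distrib[symmetric] sum_distrib_right[symmetric]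
          S_def mult.assoc[symmetric])
    \<comment> \<open>Only the derivatives of \<open>W\<close> are left on the left hand side.  The projection reproduces \<open>p\<close>, which cancels \<open>N2\<close>; the second sum is skew against symmetric.\<close>
    have "(\<Sum>l\<in>UNIV. N1' k j l x + E k j l x) =
        - (2 * lam x * W x * (\<Sum>l\<in>UNIV. p l x * a l k x) * skew k j (u x) (u1 j x))
        - (\<Sum>l\<in>UNIV. 2 * lam x * W x / S x * p l x * (p k x * p j x * skew k j (u1 l x) (u x)))" for k j
      unfolding sum_distrib_left sum_distrib_right sum_negf[symmetric] sum_subtractf[symmetric]
      by (intro sum.cong refl) (simp add: N1'_def E_def Wa_def a_def algebra_simps)
    then have "(\<Sum>k\<in>UNIV. \<Sum>j\<in>UNIV. \<Sum>l\<in>UNIV. N1' k j l x + E k j l x) + N2 x =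
      - (\<Sum>k\<in>UNIV. \<Sum>j\<in>UNIV. \<Sum>l\<in>UNIV. 2 * lam x * W x / S x * p l x * (p k x * p j x * skew k j (u1 l x) (u x)))"
      by (simp add: pa N2_def sum_subtractf sum_negf mult_ac)
    also have "(\<Sum>k\<in>UNIV. \<Sum>j\<in>UNIV. \<Sum>l\<in>UNIV. 2 * lam x * W x / S x * p l x * (p k x * p j x * skew k j (u1 l x) (u x)))
      = (\<Sum>l\<in>UNIV. \<Sum>k\<in>UNIV. \<Sum>j\<in>UNIV. 2 * lam x * W x / S x * p l x * (p k x * p j x * skew k j (u1 l x) (u x)))"
      by (subst (3) sum.swap) (subst (2) sum.swap, rule refl)
    also have "\<dots> = 0" unfolding sum_distrib_left[symmetric] sum_antisym_zero by simp
    finally show ?thesis using N3 by (simp add: sum.distrib)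
  next
    case False
    then have "x \<notin> K" using K by auto
    then show ?thesis by (simp add: N1'_def N2_def N3'_def N4_def E_def)
  qed
  have err: "(\<Sum>k\<in>UNIV. \<Sum>j\<in>UNIV. \<Sum>l\<in>UNIV. E k j l x) \<le> 4 * R * ?n\<^sup>2 * ?G x" for x
  proof (cases "x \<in> U")
    case True
    let ?a = "norm (u x)" and ?y = "\<lambda>j. norm (u1 j x)"
    have R0: "0 \<le> R" using R[OF True, of undefined undefined undefined] by linarith
    have "E k j l x \<le> W x * (R * (2 * (?a * ?y j)) + R * (2 * (?y l * ?a)))" for k j l
      unfolding E_def
    proof (intro mult_left_mono add_mono pos[OF True])
      show "a' l l k x * skew k j (u x) (u1 j x) \<le> R * (2 * (?a * ?y j))"
        using mult_mono[OF R[OF True, of l l k] skew_bound[of k j "u x" "u1 j x"] R0 abs_ge_zero]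
        by (simp add: abs_mult[symmetric] a'_def)
      show "a' j l k x * skew k j (u1 l x) (u x) \<le> R * (2 * (?y l * ?a))"
        using mult_mono[OF R[OF True, of j l k] skew_bound[of k j "u1 l x" "u x"] R0 abs_ge_zero]
        by (simp add: abs_mult[symmetric] a'_def)
    qed
    then have "(\<Sum>k\<in>UNIV. \<Sum>j\<in>UNIV. \<Sum>l\<in>UNIV. E k j l x) \<le>
      (\<Sum>k\<in>(UNIV::'d set). \<Sum>j\<in>(UNIV::'d set). \<Sum>l\<in>(UNIV::'d set). W x * (R * (2 * (?a * ?y j)) + R * (2 * (?y l * ?a))))"
      by (intro sum_mono)
    also have "\<dots> = 4 * R * ?n\<^sup>2 * ?G x"
      by (simp add: sum.distrib sum_distrib_left[symmetric] sum_distrib_right[symmetric] power2_eq_square)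
    finally show ?thesis .
  next
    case False
    then have "x \<notin> K" using K by auto
    then show ?thesis by (simp add: E_def)
  qed
  let ?I = "integral\<^sup>L lborel"
  have "?I ?L - 4 * R * ?n\<^sup>2 * ?I ?G = ?I (\<lambda>x. ?L x - 4 * R * ?n\<^sup>2 * ?G x)"
    using i2 by simp
  also have "\<dots> \<le> ?I (\<lambda>x. (\<Sum>k\<in>UNIV. \<Sum>j\<in>UNIV. \<Sum>l\<in>UNIV. N1' k j l x) + N2 x + (\<Sum>k\<in>UNIV. N3' k x) - N4 x)"
    unfolding alg using err i2 i by (intro integral_mono) (auto intro!: Bochner_Integration.integrable_sum)
  also have "\<dots> = ?I (\<lambda>x. (\<Sum>k\<in>UNIV. \<Sum>j\<in>UNIV. \<Sum>l\<in>UNIV. N1 k j l x) + N2 x - (\<Sum>k\<in>UNIV. N3 k x) - N4 x)"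
    using i by (simp add: e1 e3 sum_negf)
  also have "\<dots> \<le> ?I ?D"
    using low i2 i by (intro integral_mono) (auto intro!: Bochner_Integration.integrable_sum)
  finally show ?thesis by simp
qed

end

section \<open>Exponential weights\<close>

text \<open>This is \<open>\<phi>\<close> to the power \<open>\<kappa>\<close> times \<open>exp (2 s \<phi>)\<close>, with
  \<open>\<phi> = exp (\<tau> \<psi>)\<close>.  The exponent \<open>0\<close> occurs in the estimate for pressure
  and curl, \<open>1\<close> in the one for the velocity, and \<open>- 1\<close> in the auxiliary gradient bound.\<close>

definition carleman_weight :: "(real^'d::finite \<Rightarrow> real) \<Rightarrow> real \<Rightarrow> real \<Rightarrow> real \<Rightarrow> real^'d \<Rightarrow> real" where
  "carleman_weight \<psi> s \<tau> \<kappa> x = exp (2 * s * exp (\<tau> * \<psi> x) + \<kappa> * \<tau> * \<psi> x)"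

lemma carleman_weight_pos: "carleman_weight \<psi> s \<tau> \<kappa> x > 0" by (simp add: carleman_weight_def)

lemma carleman_weight_shift: "carleman_weight \<psi> s \<tau> \<kappa> x = exp (\<tau> * \<psi> x) * carleman_weight \<psi> s \<tau> (\<kappa> - 1) x"
  by (simp add: carleman_weight_def mult_exp_exp algebra_simps)

lemma has_pd_exp:
  assumes "has_pd i f f' x" shows "has_pd i (\<lambda>x. exp (f x) :: real) (f' * exp (f x)) x"
proof -
  have "(exp has_vector_derivative exp (f x)) (at (f x))"
    unfolding has_real_derivative_iff_has_vector_derivative[symmetric] by (rule DERIV_exp)
  from has_pd_chain[OF this assms] show ?thesis by simp
qed

lemma has_pd_cmult:
  fixes f :: "real^'d::finite \<Rightarrow> real"
  shows "has_pd i f f' x \<Longrightarrow> has_pd i (\<lambda>x. c * f x) (c * f') x"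
  by (rule has_pd_linear[OF bounded_linear_mult_right])

text \<open>The factor \<open>\<tau> (s \<phi> + \<kappa> / 2)\<close> is the \<open>\<lambda>\<close> of the general
  inequality.\<close>

lemma has_pd_carleman_weight:
  assumes "has_pd i \<psi> D x"
  shows "has_pd i (carleman_weight \<psi> s \<tau> \<kappa>) (2 * (\<tau> * (s * exp (\<tau> * \<psi> x) + \<kappa> / 2)) * D * carleman_weight \<psi> s \<tau> \<kappa> x) x"
  unfolding carleman_weight_def[abs_def]
  by (rule has_pd_eq[OF has_pd_exp[OF has_pd_add[OF has_pd_cmult[OF has_pd_exp[OF has_pd_cmult[OF assms]]] has_pd_cmult[OF assms]]]])
    (simp add: algebra_simps)

text \<open>The function \<open>\<psi>\<close> together with its first derivatives \<open>p\<close> and second derivatives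
  \<open>p'\<close>.  Note that \<open>c\<close> bounds the square of the length of the gradient.\<close>

locale weight_function =
  fixes U :: "(real^'d::finite) set" and \<psi> :: "real^'d \<Rightarrow> real"
    and p :: "'d \<Rightarrow> real^'d \<Rightarrow> real" and p' :: "'d \<Rightarrow> 'd \<Rightarrow> real^'d \<Rightarrow> real" and B c :: real
  assumes psi1: "x \<in> U \<Longrightarrow> has_pd i \<psi> (p i x) x"
    and psi2: "x \<in> U \<Longrightarrow> has_pd i (p k) (p' i k x) x"
    and cont_psi: "continuous_on U \<psi>" "continuous_on U (p i)" "continuous_on U (p' i k)"
    and pos: "x \<in> U \<Longrightarrow> 0 < \<psi> x"
    and bd: "x \<in> U \<Longrightarrow> \<bar>p i x\<bar> \<le> B" "x \<in> U \<Longrightarrow> \<bar>p' i k x\<bar> \<le> B" and B: "0 \<le> B"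
    and nondeg: "0 < c" "x \<in> U \<Longrightarrow> c \<le> (\<Sum>m\<in>UNIV. (p m x)\<^sup>2)"
begin

lemma cont_carleman_weight: "continuous_on U (carleman_weight \<psi> s \<tau> \<kappa>)"
  unfolding carleman_weight_def by (intro continuous_intros cont_psi)

lemma phi_ge_1: "x \<in> U \<Longrightarrow> 0 \<le> \<tau> \<Longrightarrow> 1 \<le> exp (\<tau> * \<psi> x)"
  using pos[of x] by simp

lemma proj_deriv_bound:
  assumes "x \<in> U"
  shows "\<bar>proj_deriv p p' i l k x\<bar> \<le> 2 * B\<^sup>2 / c + 2 * real CARD('d) * B^4 / c\<^sup>2"
proof -
  let ?S = "\<Sum>m\<in>UNIV. (p m x)\<^sup>2"
  note b = bd[OF assms]
  have S: "c \<le> ?S" by (rule nondeg(2)[OF assms])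
  have pp: "\<bar>p' i l x * p k x + p l x * p' i k x\<bar> \<le> 2 * B\<^sup>2"
    using mult_mono[OF b(2)[of i l] b(1)[of k] B abs_ge_zero] mult_mono[OF b(1)[of l] b(2)[of i k] B abs_ge_zero]
    unfolding abs_mult[symmetric] power2_eq_square by linarith
  have 1: "\<bar>(p' i l x * p k x + p l x * p' i k x) / ?S\<bar> \<le> 2 * B\<^sup>2 / c"
    unfolding abs_divide using pp S nondeg(1) by (intro frac_le) auto
  have "\<bar>\<Sum>m\<in>UNIV. 2 * p m x * p' i m x\<bar> \<le> (\<Sum>m\<in>(UNIV::'d set). 2 * (B * B))"
  proof (rule order_trans[OF sum_abs], rule sum_mono)
    fix m show "\<bar>2 * p m x * p' i m x\<bar> \<le> 2 * (B * B)"
      using mult_mono[OF b(1)[of m] b(2)[of i m] B abs_ge_zero] by (simp add: abs_mult)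
  qed
  then have s: "\<bar>\<Sum>m\<in>UNIV. 2 * p m x * p' i m x\<bar> \<le> 2 * real CARD('d) * B\<^sup>2" by (simp add: power2_eq_square mult_ac)
  have "\<bar>p l x * p k x\<bar> \<le> B * B"
    unfolding abs_mult by (rule mult_mono[OF b(1) b(1) B abs_ge_zero])
  from mult_mono[OF this s] have "\<bar>p l x * p k x * (\<Sum>m\<in>UNIV. 2 * p m x * p' i m x)\<bar> \<le> 2 * real CARD('d) * B^4"
    by (simp add: abs_mult power2_eq_square power4_eq_xxxx mult_ac)
  then have 2: "\<bar>p l x * p k x * (\<Sum>m\<in>UNIV. 2 * p m x * p' i m x) / ?S\<^sup>2\<bar> \<le> 2 * real CARD('d) * B^4 / c\<^sup>2"
    unfolding abs_divide using S nondeg(1) by (intro frac_le) (auto intro!: power_mono)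
  show ?thesis unfolding proj_deriv_def using 1 2 by linarith
qed

end

locale carleman = clifford_jet A U K u u1 u2 + weight_function U \<psi> p p' B c
  for A :: "'d::finite \<Rightarrow> 'v::euclidean_space \<Rightarrow> 'v" and U K u u1 u2 \<psi> p p' B c
begin

text \<open>By \<open>|\<kappa>| \<le> 1 \<le> s \<phi>\<close> the logarithmic derivative of the weight is at most \<open>3
  s \<tau> \<phi> B\<close>, which is the \<open>m\<close> of \<open>gradient_bound\<close>.\<close>

lemma weighted_gradient_bound:
  assumes "1 \<le> s" "1 \<le> \<tau>" "\<bar>\<kappa>\<bar> \<le> 1"
  shows "integral\<^sup>L lborel (\<lambda>x. carleman_weight \<psi> s \<tau> \<kappa> x * (\<Sum>j\<in>UNIV. (norm (u1 j x))\<^sup>2)) \<le>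
    2 * integral\<^sup>L lborel (\<lambda>x. carleman_weight \<psi> s \<tau> \<kappa> x * (norm (Du x))\<^sup>2)
    + 36 * (real CARD('d))^3 * B\<^sup>2 * (s\<^sup>2 * \<tau>\<^sup>2)
      * integral\<^sup>L lborel (\<lambda>x. (exp (\<tau> * \<psi> x))\<^sup>2 * carleman_weight \<psi> s \<tau> \<kappa> x * (norm (u x))\<^sup>2)"
proof -
  let ?m = "\<lambda>x. 3 * s * \<tau> * exp (\<tau> * \<psi> x) * B"
  have le: "\<bar>2 * (\<tau> * (s * exp (\<tau> * \<psi> x) + \<kappa> / 2)) * p j x * carleman_weight \<psi> s \<tau> \<kappa> x\<bar> \<le> ?m x * carleman_weight \<psi> s \<tau> \<kappa> x"
    if x: "x \<in> U" for x j
  proof -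
    have "1 * 1 \<le> s * exp (\<tau> * \<psi> x)" using assms phi_ge_1[OF x, of \<tau>] by (intro mult_mono) auto
    then have "\<bar>s * exp (\<tau> * \<psi> x) + \<kappa> / 2\<bar> \<le> 3 / 2 * (s * exp (\<tau> * \<psi> x))" using assms(3) by linarith
    from mult_left_mono[OF this, of "2 * \<tau>"]
    have "\<bar>2 * (\<tau> * (s * exp (\<tau> * \<psi> x) + \<kappa> / 2))\<bar> \<le> 3 * s * \<tau> * exp (\<tau> * \<psi> x)"
      using assms(2) unfolding abs_mult by simp
    from mult_mono[OF this bd(1)[OF x, of j]]
    have "\<bar>2 * (\<tau> * (s * exp (\<tau> * \<psi> x) + \<kappa> / 2)) * p j x\<bar> \<le> ?m x"
      using assms B by (simp add: abs_mult)
    then show ?thesis using carleman_weight_pos[of \<psi> s \<tau> \<kappa> x]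
      unfolding abs_mult[of _ "carleman_weight \<psi> s \<tau> \<kappa> x"] by (simp only: abs_of_pos mult_right_mono less_imp_le)
  qed
  have "integral\<^sup>L lborel (\<lambda>x. carleman_weight \<psi> s \<tau> \<kappa> x * (\<Sum>j\<in>UNIV. (norm (u1 j x))\<^sup>2)) \<le>
    2 * integral\<^sup>L lborel (\<lambda>x. carleman_weight \<psi> s \<tau> \<kappa> x * (norm (Du x))\<^sup>2)
    + 4 * (real CARD('d))^3 * integral\<^sup>L lborel (\<lambda>x. (?m x)\<^sup>2 * carleman_weight \<psi> s \<tau> \<kappa> x * (norm (u x))\<^sup>2)"
    by (rule gradient_bound[OF has_pd_carleman_weight[OF psi1] cont_carleman_weight _ _ _ le])
      (auto intro!: continuous_intros cont_psi cont_carleman_weight less_imp_le[OF carleman_weight_pos])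
  also have "(\<lambda>x. (?m x)\<^sup>2 * carleman_weight \<psi> s \<tau> \<kappa> x * (norm (u x))\<^sup>2) =
    (\<lambda>x. (9 * B\<^sup>2 * (s\<^sup>2 * \<tau>\<^sup>2)) * ((exp (\<tau> * \<psi> x))\<^sup>2 * carleman_weight \<psi> s \<tau> \<kappa> x * (norm (u x))\<^sup>2))"
    by (simp add: fun_eq_iff power_mult_distrib mult_ac)
  finally show ?thesis by (simp add: mult_ac)
qed

text \<open>The general inequality gives \<open>c s \<tau>\<^sup>2 \<integral> \<phi> W |u|\<^sup>2\<close> on the left, up
  to a term of order \<open>s \<tau> \<phi> |u|\<^sup>2\<close> from the Laplacian of \<open>\<psi>\<close>, and
  the error \<open>\<integral> W |u| |\<nabla> u|\<close> on the right.  The error is split into \<open>s \<tau>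
  \<phi> |u|\<^sup>2\<close> and \<open>|\<nabla> u|\<^sup>2 / (s \<tau> \<phi>)\<close>; the latter is bounded by
  the gradient estimate for the exponent \<open>\<kappa> - 1\<close>.  What remains has one power of
  \<open>\<tau>\<close> less than the left hand side: \<open>M\<close> collects its coefficients, and
  \<open>\<tau> \<ge> 2 M / c\<close> absorbs it.\<close>

lemma carleman_estimate:
  fixes s \<tau> \<kappa> R M :: real
  defines "R \<equiv> 2 * B\<^sup>2 / c + 2 * real CARD('d) * B^4 / c\<^sup>2"
    and "M \<equiv> 4 * R * (real CARD('d))\<^sup>2 * (real CARD('d) + 36 * (real CARD('d))^3 * B\<^sup>2) + 3 / 2 * real CARD('d) * B"
  assumes s: "1 \<le> s" and t: "1 \<le> \<tau>" "2 * M \<le> c * \<tau>" and k: "0 \<le> \<kappa>" "\<kappa> \<le> 1"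
  shows "s * \<tau>\<^sup>2 * integral\<^sup>L lborel (\<lambda>x. exp (\<tau> * \<psi> x) * carleman_weight \<psi> s \<tau> \<kappa> x * (norm (u x))\<^sup>2)
    \<le> 2 * (1 + 8 * R * (real CARD('d))\<^sup>2) / c * integral\<^sup>L lborel (\<lambda>x. carleman_weight \<psi> s \<tau> \<kappa> x * (norm (Du x))\<^sup>2)"
proof -
  note [simp] = zero Du_zero
  note ci = continuous_intros contU contDu cont_carleman_weight cont_psi
  let ?I = "integral\<^sup>L lborel" and ?n = "real CARD('d)"
  let ?f = "\<lambda>x. exp (\<tau> * \<psi> x)" and ?W = "carleman_weight \<psi> s \<tau> \<kappa>" and ?V = "carleman_weight \<psi> s \<tau> (\<kappa> - 1)"
  let ?lam = "\<lambda>x. \<tau> * (s * ?f x + \<kappa> / 2)" and ?mu = "\<lambda>x. s * \<tau>\<^sup>2 * ?f x"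
  let ?S = "\<lambda>x. \<Sum>m\<in>UNIV. (p m x)\<^sup>2"
  let ?J = "\<lambda>x. ?f x * ?W x * (norm (u x))\<^sup>2" and ?E = "\<lambda>x. ?W x * (norm (Du x))\<^sup>2"
  let ?G = "\<lambda>x. ?V x * (\<Sum>j\<in>UNIV. (norm (u1 j x))\<^sup>2)" and ?F = "\<lambda>x. ?V x * (norm (Du x))\<^sup>2"
  let ?H = "\<lambda>x. ?W x * (norm (u x) * (\<Sum>j\<in>UNIV. norm (u1 j x)))"
  let ?L = "\<lambda>x. ?W x * (norm (u x))\<^sup>2 * (?mu x * ?S x + ?lam x * (\<Sum>k\<in>UNIV. p' k k x))"
  have i: "integrable lborel ?J" "integrable lborel ?E" "integrable lborel ?G" "integrable lborel ?H"
    "integrable lborel ?L" "integrable lborel ?F"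
    by (rule integrable_on_support; auto intro!: ci)+
  have st: "1 \<le> s * \<tau>" using s t mult_mono[of 1 s 1 \<tau>] by simp
  have R0: "0 \<le> R" using B nondeg(1) by (simp add: R_def)
  have J0: "0 \<le> ?I ?J" by (intro integral_nonneg_AE AE_I2) (simp add: less_imp_le[OF carleman_weight_pos])
  have E0: "0 \<le> ?I ?E" by (intro integral_nonneg_AE AE_I2) (simp add: less_imp_le[OF carleman_weight_pos])
  have "?I ?L \<le> ?I ?E + 4 * R * ?n\<^sup>2 * ?I ?H"
  proof (rule carleman_inequality_raw[where W = ?W and lam = ?lam and mu = ?mu and p = p and p' = p' and R = R])
    show "has_pd i (\<lambda>x. \<tau> * (s * ?f x + \<kappa> / 2)) (s * \<tau>\<^sup>2 * ?f x * p i x) x" if "x \<in> U" for i x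
      by (rule has_pd_eq[OF has_pd_cmult[OF has_pd_add[OF has_pd_cmult[OF has_pd_exp[OF has_pd_cmult[OF psi1[OF that]]]] has_pd_const]]])
        (simp add: power2_eq_square)
    show "0 < ?S x" if "x \<in> U" for x using nondeg(1) nondeg(2)[OF that] by linarith
    show "\<bar>proj_deriv p p' i l k x\<bar> \<le> R" if "x \<in> U" for i l k x
      unfolding R_def by (rule proj_deriv_bound[OF that])
  qed (auto intro!: ci psi2 has_pd_carleman_weight psi1 less_imp_le[OF carleman_weight_pos])
  moreover have "(c * (s * \<tau>\<^sup>2) - 3 / 2 * ?n * B * (s * \<tau>)) * ?I ?J \<le> ?I ?L"
  proof -
    have "(c * (s * \<tau>\<^sup>2) - 3 / 2 * ?n * B * (s * \<tau>)) * ?J x \<le> ?L x" for x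
    proof (cases "x \<in> U")
      case True
      have f1: "1 \<le> ?f x" using phi_ge_1[OF True] t by simp
      have sf: "1 * 1 \<le> s * ?f x" using s f1 by (intro mult_mono) auto
      have l: "0 \<le> ?lam x" "?lam x \<le> \<tau> * (3 / 2 * (s * ?f x))"
        using t k sf by (auto intro!: mult_left_mono)
      have "\<bar>\<Sum>k\<in>UNIV. p' k k x\<bar> \<le> (\<Sum>k\<in>(UNIV::'d set). B)"
        by (rule order_trans[OF sum_abs], rule sum_mono, rule bd(2)[OF True])
      then have lap: "\<bar>\<Sum>k\<in>UNIV. p' k k x\<bar> \<le> ?n * B" by simp
      have "\<bar>?lam x * (\<Sum>k\<in>UNIV. p' k k x)\<bar> \<le> (\<tau> * (3 / 2 * (s * ?f x))) * (?n * B)"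
        unfolding abs_mult[of "?lam x"] abs_of_nonneg[OF l(1)]
        using order_trans[OF l] by (intro mult_mono lap l(2)) auto
      moreover have "?mu x * c \<le> ?mu x * ?S x" using s nondeg(2)[OF True] by (intro mult_left_mono) auto
      ultimately have "?mu x * c - (\<tau> * (3 / 2 * (s * ?f x))) * (?n * B) \<le> ?mu x * ?S x + ?lam x * (\<Sum>k\<in>UNIV. p' k k x)"
        by linarith
      from mult_left_mono[OF this, of "?W x * (norm (u x))\<^sup>2"] show ?thesis
        using carleman_weight_pos[of \<psi> s \<tau> \<kappa> x] by (simp add: algebra_simps)
    next
      case False
      then have "x \<notin> K" using K by auto
      then show ?thesis by simp
    qed
    then have "?I (\<lambda>x. (c * (s * \<tau>\<^sup>2) - 3 / 2 * ?n * B * (s * \<tau>)) * ?J x) \<le> ?I ?L"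
      using i by (intro integral_mono) auto
    then show ?thesis by simp
  qed
  moreover have "?I ?H \<le> ?n * (s * \<tau>) * ?I ?J + ?I ?G / (s * \<tau>)"
  proof -
    have "?H x \<le> ?n * (s * \<tau>) * ?J x + ?G x / (s * \<tau>)" for x
    proof -
      have "?W x * (norm (u x) * norm (u1 j x)) \<le> (s * \<tau>) * ?J x + ?V x * (norm (u1 j x))\<^sup>2 / (s * \<tau>)" for j
      proof -
        \<comment> \<open>\<open>a\<close> balances Young's inequality so that both parts are of the size that can be absorbed.\<close>
        define a where "a = s * \<tau> * ?f x"
        have a: "a > 0" using st by (simp add: a_def)
        have "0 \<le> (a * norm (u x) - norm (u1 j x))\<^sup>2 + a * (norm (u x) * norm (u1 j x))" using a by simp
        then have "a * (norm (u x) * norm (u1 j x)) \<le> a * (a * (norm (u x))\<^sup>2 + (norm (u1 j x))\<^sup>2 / a)"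
          using a by (simp add: power2_eq_square algebra_simps)
        then have "norm (u x) * norm (u1 j x) \<le> a * (norm (u x))\<^sup>2 + (norm (u1 j x))\<^sup>2 / a"
          using a by (metis mult_le_cancel_left_pos)
        from mult_left_mono[OF this less_imp_le[OF carleman_weight_pos[of \<psi> s \<tau> \<kappa> x]]]
        have "?W x * (norm (u x) * norm (u1 j x)) \<le> ?W x * (a * (norm (u x))\<^sup>2) + ?W x * (norm (u1 j x))\<^sup>2 / a"
          by (simp add: distrib_left)
        also have "?W x * (norm (u1 j x))\<^sup>2 / a = ?V x * (norm (u1 j x))\<^sup>2 / (s * \<tau>)"
          unfolding carleman_weight_shift[of \<psi> s \<tau> \<kappa> x] by (simp add: a_def)
        finally show ?thesis by (simp add: a_def mult_ac)
      qed
      then have "(\<Sum>j\<in>UNIV. ?W x * (norm (u x) * norm (u1 j x))) \<le> (\<Sum>j\<in>(UNIV::'d set). (s * \<tau>) * ?J x + ?V x * (norm (u1 j x))\<^sup>2 / (s * \<tau>))"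
        by (intro sum_mono)
      then show ?thesis by (simp add: sum.distrib sum_distrib_left sum_divide_distrib mult_ac)
    qed
    then have "?I ?H \<le> ?I (\<lambda>x. ?n * (s * \<tau>) * ?J x + ?G x / (s * \<tau>))"
      using i by (intro integral_mono) auto
    also have "\<dots> = ?n * (s * \<tau>) * ?I ?J + ?I ?G / (s * \<tau>)" using i by simp
    finally show ?thesis .
  qed
  moreover have "?I ?G \<le> 2 * ?I ?E + 36 * ?n^3 * B\<^sup>2 * (s\<^sup>2 * \<tau>\<^sup>2) * ?I ?J"
  proof -
    have "?I ?G \<le> 2 * ?I ?F + 36 * ?n^3 * B\<^sup>2 * (s\<^sup>2 * \<tau>\<^sup>2) * ?I (\<lambda>x. (?f x)\<^sup>2 * ?V x * (norm (u x))\<^sup>2)"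
      using s t k by (intro weighted_gradient_bound) auto
    also have "(\<lambda>x. (?f x)\<^sup>2 * ?V x * (norm (u x))\<^sup>2) = ?J"
      by (simp add: carleman_weight_shift[of \<psi> s \<tau> \<kappa>] power2_eq_square mult_ac)
    also have "?I ?F \<le> ?I ?E"
    proof (intro integral_mono i)
      show "?F x \<le> ?E x" for x
      proof (cases "x \<in> U")
        case True
        then show ?thesis using phi_ge_1[OF True, of \<tau>] t carleman_weight_pos[of \<psi> s \<tau> "\<kappa> - 1" x]
          unfolding carleman_weight_shift[of \<psi> s \<tau> \<kappa>] by (intro mult_right_mono) auto
      next
        case False
        then have "x \<notin> K" using K by auto
        then show ?thesis by simp
      qed
    qed
    finally show ?thesis by simp
  qed
  ultimately have main: "(c * (s * \<tau>\<^sup>2) - 3 / 2 * ?n * B * (s * \<tau>)) * ?I ?J \<le>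
     ?I ?E + 4 * R * ?n\<^sup>2 * (?n * (s * \<tau>) * ?I ?J + (2 * ?I ?E + 36 * ?n^3 * B\<^sup>2 * (s\<^sup>2 * \<tau>\<^sup>2) * ?I ?J) / (s * \<tau>))"
    (is "?l \<le> _ + ?r * (_ + ?q / _)")
  proof -
    assume a: "?I ?L \<le> ?I ?E + 4 * R * ?n\<^sup>2 * ?I ?H" "?l \<le> ?I ?L"
      "?I ?H \<le> ?n * (s * \<tau>) * ?I ?J + ?I ?G / (s * \<tau>)" "?I ?G \<le> ?q"
    have "?I ?H \<le> ?n * (s * \<tau>) * ?I ?J + ?q / (s * \<tau>)"
      using a(3) divide_right_mono[OF a(4), of "s * \<tau>"] st by linarith
    from mult_left_mono[OF this, of ?r] show ?thesis using a(1,2) R0 by simp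
  qed
  have q: "(2 * ?I ?E + 36 * ?n^3 * B\<^sup>2 * (s\<^sup>2 * \<tau>\<^sup>2) * ?I ?J) / (s * \<tau>) \<le> 2 * ?I ?E + 36 * ?n^3 * B\<^sup>2 * (s * \<tau>) * ?I ?J"
  proof -
    have "2 * ?I ?E \<le> 2 * ?I ?E * (s * \<tau>)" using mult_left_mono[OF st, of "2 * ?I ?E"] E0 by simp
    then show ?thesis using st by (simp add: divide_le_eq power2_eq_square algebra_simps)
  qed
  have "(c * (s * \<tau>\<^sup>2) - 3 / 2 * ?n * B * (s * \<tau>)) * ?I ?J \<le>
     ?I ?E + 4 * R * ?n\<^sup>2 * (?n * (s * \<tau>) * ?I ?J + (2 * ?I ?E + 36 * ?n^3 * B\<^sup>2 * (s * \<tau>) * ?I ?J))"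
    using main mult_left_mono[OF q, of "4 * R * ?n\<^sup>2"] R0 by (simp add: distrib_left)
  then have "c * (s * \<tau>\<^sup>2) * ?I ?J \<le> (1 + 8 * R * ?n\<^sup>2) * ?I ?E + M * (s * \<tau>) * ?I ?J"
    by (simp add: M_def algebra_simps)
  moreover have "M * ((s * \<tau>) * ?I ?J) \<le> (c * \<tau> / 2) * ((s * \<tau>) * ?I ?J)"
    using t(2) st J0 by (intro mult_right_mono) auto
  ultimately have "c * (s * \<tau>\<^sup>2 * ?I ?J) \<le> 2 * (1 + 8 * R * ?n\<^sup>2) * ?I ?E"
    by (simp add: power2_eq_square algebra_simps)
  then show ?thesis using nondeg(1) by (simp add: field_simps)
qed

end

section \<open>Combining the estimates for velocity and pressure\<close>

text \<open>\<open>(1 + \<alpha>) d\<close> is the difference of the quantity in the first term and \<open>\<alpha>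
  q\<close>; for \<open>d = div z\<close> and \<open>q + d = p\<close> the former is \<open>div z + \<alpha>
  p\<close>.\<close>

lemma norm_split:
  fixes d q :: complex and \<alpha> :: real
  assumes "\<alpha> \<noteq> - 1"
  shows "(norm d)\<^sup>2 \<le> 2 / (1 + \<alpha>)\<^sup>2 * (norm (d + of_real \<alpha> * (q + d)))\<^sup>2 + 2 * \<alpha>\<^sup>2 / (1 + \<alpha>)\<^sup>2 * (norm q)\<^sup>2"
proof -
  let ?e = "d + of_real \<alpha> * (q + d)"
  have a: "(1 + \<alpha>)\<^sup>2 > 0" using assms by simp
  have "of_real (1 + \<alpha>) * d = ?e - of_real \<alpha> * q" by (simp add: algebra_simps)
  then have "norm (of_real (1 + \<alpha>) * d) \<le> norm ?e + norm (of_real \<alpha> * q)"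
    by (metis norm_triangle_ineq4)
  then have "(norm (of_real (1 + \<alpha>) * d))\<^sup>2 \<le> (norm ?e + norm (of_real \<alpha> * q))\<^sup>2"
    by (intro power_mono) auto
  also have "\<dots> \<le> 2 * (norm ?e)\<^sup>2 + 2 * (norm (of_real \<alpha> * q))\<^sup>2"
    using zero_le_power2[of "norm ?e - norm (of_real \<alpha> * q)"] by (simp add: power2_eq_square algebra_simps)
  finally have "(1 + \<alpha>)\<^sup>2 * (norm d)\<^sup>2 \<le> 2 * (norm ?e)\<^sup>2 + 2 * (\<alpha>\<^sup>2 * (norm q)\<^sup>2)"
    by (simp only: norm_mult norm_of_real power_mult_distrib power2_abs)
  then have "(norm d)\<^sup>2 \<le> (2 * (norm ?e)\<^sup>2 + 2 * (\<alpha>\<^sup>2 * (norm q)\<^sup>2)) / (1 + \<alpha>)\<^sup>2"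
    using a by (simp add: pos_le_divide_eq mult.commute)
  then show ?thesis by (simp add: add_divide_distrib)
qed

text \<open>For the Stokes system \<open>u\<close> is \<open>(q, w)\<close> with \<open>q = p - div z\<close> and \<open>w =
  curl z\<close>, and \<open>v\<close> is \<open>z\<close>.  The same \<open>dv = div z\<close> and \<open>cu =
  |curl z|\<^sup>2\<close> enter the size of \<open>D v\<close>, and \<open>cu\<close> also the size of
  \<open>u\<close>; this coupling joins the two estimates.\<close>

locale stokes_pair =
  u: carleman A U K u u1 u2 \<psi> p p' B c + v: carleman A U K v v1 v2 \<psi> p p' B c
  for A :: "'d::finite \<Rightarrow> 'v::euclidean_space \<Rightarrow> 'v" and U K u u1 u2 v v1 v2 \<psi> p p' B c +
  fixes dv q :: "real^'d \<Rightarrow> complex" and cu :: "real^'d \<Rightarrow> real"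
  assumes cont: "continuous_on UNIV dv" "continuous_on UNIV q" "continuous_on UNIV cu"
    and zero: "x \<notin> K \<Longrightarrow> dv x = 0" "x \<notin> K \<Longrightarrow> q x = 0" "x \<notin> K \<Longrightarrow> cu x = 0"
    and cu: "0 \<le> cu x"
    and nu: "(norm (u x))\<^sup>2 = (norm (q x))\<^sup>2 + cu x"
    and nv: "(norm (v.Du x))\<^sup>2 = (norm (dv x))\<^sup>2 + cu x"
text \<open>Explicit constants in terms of the dimension \<open>n\<close>, the bound \<open>B\<close> on the derivatives of
  \<open>\<psi>\<close> and the lower bound \<open>c\<close> for \<open>|\<nabla>\<psi>|\<^sup>2\<close>.  None of
  them involves \<open>s\<close> or \<open>\<tau>\<close>, which is what the order of the quantifiers demands.\<close>

definition carleman_threshold :: "nat \<Rightarrow> real \<Rightarrow> real \<Rightarrow> real" where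
  "carleman_threshold n B c = 4 * (2 * B\<^sup>2 / c + 2 * real n * B^4 / c\<^sup>2) * (real n)\<^sup>2 * (real n + 36 * (real n)^3 * B\<^sup>2) + 3 / 2 * real n * B"

definition carleman_const :: "nat \<Rightarrow> real \<Rightarrow> real \<Rightarrow> real" where
  "carleman_const n B c = 2 * (1 + 8 * (2 * B\<^sup>2 / c + 2 * real n * B^4 / c\<^sup>2) * (real n)\<^sup>2) / c"

definition stokes_const :: "nat \<Rightarrow> real \<Rightarrow> real \<Rightarrow> real \<Rightarrow> real" where
  "stokes_const n B c \<alpha> = (2 + (1 + 36 * (real n)^3 * B\<^sup>2) * carleman_const n B c)
     * (2 / (1 + \<alpha>)\<^sup>2 + (1 + 2 * \<alpha>\<^sup>2 / (1 + \<alpha>)\<^sup>2) * carleman_const n B c) + carleman_const n B c"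

lemma carleman_const_pos: "0 < c \<Longrightarrow> 0 \<le> B \<Longrightarrow> 0 < carleman_const n B c"
  unfolding carleman_const_def by (intro divide_pos_pos mult_pos_pos add_pos_nonneg mult_nonneg_nonneg add_nonneg_nonneg divide_nonneg_nonneg) auto

context stokes_pair begin

text \<open>The second estimate is the Carleman inequality for \<open>u\<close> with exponent \<open>0\<close>.  For the
  first, the Carleman inequality for \<open>v\<close> with exponent \<open>1\<close> and the gradient bound reduce
  the left hand side to \<open>\<integral> s \<phi> W (|dv|\<^sup>2 + cu)\<close>.  By \<open>norm_split\<close>
  this is at most a multiple of the first term on the right plus \<open>\<integral> s \<phi> W
  |u|\<^sup>2\<close>, and the second estimate controls the latter with the factor \<open>1 /
  \<tau>\<^sup>2\<close>.\<close>

lemma estimates: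
  fixes s \<tau> \<alpha> :: real
  assumes s: "1 \<le> s" and t: "1 \<le> \<tau>" "2 * carleman_threshold CARD('d) B c \<le> c * \<tau>" and al: "\<alpha> \<noteq> - 1"
  defines "f \<equiv> \<lambda>x. exp (\<tau> * \<psi> x)" and "W \<equiv> \<lambda>x. exp (2 * s * exp (\<tau> * \<psi> x))"
  shows "integral\<^sup>L lborel (\<lambda>x. W x * (\<Sum>j\<in>UNIV. (norm (v1 j x))\<^sup>2) + s\<^sup>2 * \<tau>\<^sup>2 * (f x)\<^sup>2 * W x * (norm (v x))\<^sup>2)
      \<le> stokes_const CARD('d) B c \<alpha> * integral\<^sup>L lborel (\<lambda>x. s * f x * W x * (norm (dv x + of_real \<alpha> * (q x + dv x)))\<^sup>2
        + 1 / \<tau>\<^sup>2 * W x * (norm (u.Du x))\<^sup>2)" (is ?A)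
    and "integral\<^sup>L lborel (\<lambda>x. s * \<tau>\<^sup>2 * f x * W x * (cu x + (norm (q x))\<^sup>2))
      \<le> stokes_const CARD('d) B c \<alpha> * integral\<^sup>L lborel (\<lambda>x. W x * (norm (u.Du x))\<^sup>2)" (is ?B)
proof -
  let ?I = "integral\<^sup>L lborel" and ?n = "real CARD('d)"
  let ?C0 = "carleman_const CARD('d) B c"
  have C0: "0 < ?C0" using carleman_const_pos u.nondeg(1) u.B by blast
  have W0: "W x = carleman_weight \<psi> s \<tau> 0 x" for x by (simp add: W_def carleman_weight_def)
  have W1: "carleman_weight \<psi> s \<tau> 1 x = f x * W x" for x using carleman_weight_shift[of \<psi> s \<tau> 1 x] by (simp add: W0 f_def)
  have Wp: "0 < W x" and fp: "0 < f x" for x by (simp_all add: W_def f_def)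
  have cU: "continuous_on U dv" "continuous_on U q" "continuous_on U cu"
    by (rule continuous_on_subset[OF _ subset_UNIV]; rule cont)+
  have cW: "continuous_on U W" "continuous_on U f"
    unfolding W_def f_def by (intro continuous_intros u.cont_psi)+
  note ci = continuous_intros u.contU v.contU u.contDu v.contDu cW cU
  note [simp] = u.zero v.zero zero u.Du_zero v.Du_zero
  let ?e = "\<lambda>x. norm (dv x + of_real \<alpha> * (q x + dv x))"
  let ?E1 = "\<lambda>x. s * f x * W x * (?e x)\<^sup>2" and ?E2 = "\<lambda>x. W x * (norm (u.Du x))\<^sup>2"
  let ?G = "\<lambda>x. W x * (\<Sum>j\<in>UNIV. (norm (v1 j x))\<^sup>2)" and ?X = "\<lambda>x. (f x)\<^sup>2 * W x * (norm (v x))\<^sup>2"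
  let ?Y = "\<lambda>x. f x * W x * (norm (v.Du x))\<^sup>2" and ?Z = "\<lambda>x. W x * (norm (v.Du x))\<^sup>2"
  let ?J = "\<lambda>x. f x * W x * (norm (u x))\<^sup>2"
  have i: "integrable lborel ?E1" "integrable lborel ?E2" "integrable lborel ?G" "integrable lborel ?X"
    "integrable lborel ?Y" "integrable lborel ?Z" "integrable lborel ?J"
    by (rule u.integrable_on_support; auto intro!: ci)+
  have E: "0 \<le> ?I ?E1" "0 \<le> ?I ?E2"
    using s by (auto intro!: integral_nonneg_AE AE_I2 mult_nonneg_nonneg less_imp_le[OF Wp] less_imp_le[OF fp])
  have car: "s * \<tau>\<^sup>2 * ?I ?J \<le> ?C0 * ?I ?E2"
    using u.carleman_estimate[of s \<tau> 0] s t unfolding carleman_const_def carleman_threshold_def W0 f_def by simp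
  have ff: "exp (\<tau> * \<psi> x) = f x" for x by (simp add: f_def)
  have "s * \<tau>\<^sup>2 * ?I (\<lambda>x. f x * (f x * W x) * (norm (v x))\<^sup>2) \<le> ?C0 * ?I ?Y"
    using v.carleman_estimate[of s \<tau> 1] s t unfolding W1 ff carleman_const_def carleman_threshold_def by simp
  then have "s * \<tau>\<^sup>2 * ?I ?X \<le> ?C0 * ?I ?Y"
    by (simp add: power2_eq_square mult.assoc)
  from mult_left_mono[OF this, of s] have X: "s\<^sup>2 * \<tau>\<^sup>2 * ?I ?X \<le> ?C0 * (s * ?I ?Y)"
    using s by (simp add: power2_eq_square mult_ac)
  have "?I ?Z \<le> ?I (\<lambda>x. s * ?Y x)"
  proof (intro integral_mono i)
    show "?Z x \<le> s * ?Y x" for x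
    proof (cases "x \<in> U")
      case True
      have "1 \<le> f x" unfolding f_def using u.phi_ge_1[OF True, of \<tau>] t by simp
      then have "1 * 1 \<le> s * f x" using s by (intro mult_mono) auto
      from mult_right_mono[OF this, of "?Z x"] Wp[of x] show ?thesis by (simp add: mult_ac)
    next
      case False
      then have "x \<notin> K" using u.K by auto
      then show ?thesis by simp
    qed
  qed (use i in auto)
  then have Y0: "?I ?Z \<le> s * ?I ?Y" by simp
  have G: "?I ?G \<le> 2 * ?I ?Z + 36 * ?n^3 * B\<^sup>2 * (s\<^sup>2 * \<tau>\<^sup>2) * ?I ?X"
    using v.weighted_gradient_bound[of s \<tau> 0] s t unfolding W0 f_def by simp
  let ?a = "2 / (1 + \<alpha>)\<^sup>2" and ?b = "1 + 2 * \<alpha>\<^sup>2 / (1 + \<alpha>)\<^sup>2"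
  have b0: "0 \<le> ?a" "0 \<le> ?b" by simp_all
  have "s * ?I ?Y = ?I (\<lambda>x. s * ?Y x)" by simp
  also have "\<dots> \<le> ?I (\<lambda>x. ?a * ?E1 x + ?b * s * ?J x)"
  proof (intro integral_mono)
    show "s * ?Y x \<le> ?a * ?E1 x + ?b * s * ?J x" for x
    proof -
      have "(norm (dv x))\<^sup>2 + cu x \<le> ?a * (?e x)\<^sup>2 + ?b * ((norm (q x))\<^sup>2 + cu x)"
      proof -
        have "0 \<le> 2 * \<alpha>\<^sup>2 / (1 + \<alpha>)\<^sup>2 * cu x" using cu[of x] by simp
        moreover have "?b * ((norm (q x))\<^sup>2 + cu x) = 2 * \<alpha>\<^sup>2 / (1 + \<alpha>)\<^sup>2 * (norm (q x))\<^sup>2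
            + (norm (q x))\<^sup>2 + (cu x + 2 * \<alpha>\<^sup>2 / (1 + \<alpha>)\<^sup>2 * cu x)" by (simp add: algebra_simps add_divide_distrib)
        ultimately show ?thesis
          using norm_split[OF al, of "dv x" "q x"] zero_le_power2[of "norm (q x)"] by linarith
      qed
      from mult_left_mono[OF this, of "s * f x * W x"] show ?thesis
        using s Wp[of x] fp[of x] unfolding nu nv by (simp add: algebra_simps add_divide_distrib)
    qed
  qed (use i in auto)
  also have "\<dots> = ?a * ?I ?E1 + ?b * (s * ?I ?J)" using i by simp
  also have "s * ?I ?J \<le> ?C0 * (1 / \<tau>\<^sup>2 * ?I ?E2)"
    using car t(1) by (simp add: field_simps)
  finally have Y: "s * ?I ?Y \<le> ?a * ?I ?E1 + ?b * (?C0 * (1 / \<tau>\<^sup>2 * ?I ?E2))"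
    using b0 by (simp add: mult_left_mono)
  let ?C4 = "2 + (1 + 36 * ?n^3 * B\<^sup>2) * ?C0"
  let ?E3 = "1 / \<tau>\<^sup>2 * ?I ?E2"
  have C4: "0 \<le> ?C4" using C0 by (intro add_nonneg_nonneg mult_nonneg_nonneg) auto
  have E3: "0 \<le> ?E3" using E(2) by simp
  have lhs: "?I (\<lambda>x. ?G x + s\<^sup>2 * \<tau>\<^sup>2 * (f x)\<^sup>2 * W x * (norm (v x))\<^sup>2) = ?I ?G + s\<^sup>2 * \<tau>\<^sup>2 * ?I ?X"
    using i by (simp add: mult.assoc)
  have rhs: "?I (\<lambda>x. ?E1 x + 1 / \<tau>\<^sup>2 * W x * (norm (u.Du x))\<^sup>2) = ?I ?E1 + ?E3"
    using i by (simp add: mult.assoc)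
  have "?I ?G + s\<^sup>2 * \<tau>\<^sup>2 * ?I ?X \<le> 2 * (s * ?I ?Y) + (1 + 36 * ?n^3 * B\<^sup>2) * (s\<^sup>2 * \<tau>\<^sup>2 * ?I ?X)"
    using G Y0 by (simp add: algebra_simps)
  also have "\<dots> \<le> 2 * (s * ?I ?Y) + (1 + 36 * ?n^3 * B\<^sup>2) * (?C0 * (s * ?I ?Y))"
    by (intro add_left_mono mult_left_mono X) simp
  also have "\<dots> = ?C4 * (s * ?I ?Y)" by (simp add: algebra_simps)
  also have "\<dots> \<le> ?C4 * (?a * ?I ?E1 + ?b * (?C0 * ?E3))" by (intro mult_left_mono Y C4)
  also have "\<dots> \<le> ?C4 * ((?a + ?b * ?C0) * (?I ?E1 + ?E3))"
  proof (intro mult_left_mono C4)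
    have "0 \<le> ?b * ?C0 * ?I ?E1" "0 \<le> ?a * ?E3" using b0 C0 E E3 by (intro mult_nonneg_nonneg; simp)+
    then show "?a * ?I ?E1 + ?b * (?C0 * ?E3) \<le> (?a + ?b * ?C0) * (?I ?E1 + ?E3)"
      by (simp only: distrib_left distrib_right mult.assoc)
  qed
  also have "\<dots> \<le> stokes_const CARD('d) B c \<alpha> * (?I ?E1 + ?E3)"
  proof -
    have "0 \<le> ?C0 * (?I ?E1 + ?E3)"
      by (intro mult_nonneg_nonneg add_nonneg_nonneg E(1) E3 less_imp_le[OF C0])
    then show ?thesis
      unfolding stokes_const_def distrib_right[of "?C4 * (?a + ?b * ?C0)" ?C0] mult.assoc[of ?C4] by linarith
  qed
  finally show ?A unfolding lhs rhs .
  have "?I (\<lambda>x. s * \<tau>\<^sup>2 * f x * W x * (cu x + (norm (q x))\<^sup>2)) = s * \<tau>\<^sup>2 * ?I ?J"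
    by (simp add: nu add.commute mult.assoc)
  also have "\<dots> \<le> ?C0 * ?I ?E2" by (rule car)
  also have "\<dots> \<le> stokes_const CARD('d) B c \<alpha> * ?I ?E2"
    using E(2) C4 b0 C0 unfolding stokes_const_def by (intro mult_right_mono) auto
  finally show ?B .
qed

end

text \<open>The two inequalities of the theorem with all differential expressions replaced by arbitrary functions.  They are
  needed once with classical derivatives of test functions and once with weak derivatives.\<close>

definition stokes_estimates :: "(real^'d::finite) set \<Rightarrow> (real^'d \<Rightarrow> real) \<Rightarrow> real \<Rightarrow> real \<Rightarrow> real \<Rightarrow> real
    \<Rightarrow> (real^'d \<Rightarrow> complex^'d^'d) \<Rightarrow> (real^'d \<Rightarrow> complex^'d) \<Rightarrow> (real^'d \<Rightarrow> complex) \<Rightarrow> (real^'d \<Rightarrow> complex)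
    \<Rightarrow> (real^'d \<Rightarrow> complex^'d) \<Rightarrow> (real^'d \<Rightarrow> 'c::real_normed_vector) \<Rightarrow> bool" where
  "stokes_estimates U \<psi> \<alpha> C \<tau> s J z d p F w \<longleftrightarrow>
     (\<integral>\<^sup>+x. ennreal (((norm (J x))\<^sup>2 + s\<^sup>2 * \<tau>\<^sup>2 * exp (2 * \<tau> * \<psi> x) * (norm (z x))\<^sup>2)
         * exp (2 * s * exp (\<tau> * \<psi> x))) \<partial>lebesgue_on U)
     \<le> ennreal C * (\<integral>\<^sup>+x. ennreal
         ((s * exp (\<tau> * \<psi> x) * (norm (d x + complex_of_real \<alpha> * p x))\<^sup>2 + (1 / \<tau>\<^sup>2) * (norm (F x))\<^sup>2)
         * exp (2 * s * exp (\<tau> * \<psi> x))) \<partial>lebesgue_on U)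
   \<and> (\<integral>\<^sup>+x. ennreal (s * \<tau>\<^sup>2 * exp (\<tau> * \<psi> x) * ((norm (w x))\<^sup>2 + (norm (d x - p x))\<^sup>2)
         * exp (2 * s * exp (\<tau> * \<psi> x))) \<partial>lebesgue_on U)
     \<le> ennreal C * (\<integral>\<^sup>+x. ennreal ((norm (F x))\<^sup>2 * exp (2 * s * exp (\<tau> * \<psi> x))) \<partial>lebesgue_on U)"

lemma nn_integral_compact_support:
  fixes f :: "real^'d::finite \<Rightarrow> real"
  assumes "open U" "compact K" "K \<subseteq> U" "continuous_on U f" "\<And>x. x \<notin> K \<Longrightarrow> f x = 0" "\<And>x. 0 \<le> f x"
  shows "(\<integral>\<^sup>+x. ennreal (f x) \<partial>lebesgue_on U) = ennreal (integral\<^sup>L lborel f)"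
proof -
  have U: "U \<in> sets lebesgue" using assms(1) by (simp add: borel_open)
  have i: "integrable lborel f"
    by (intro integrable_compact_support[OF _ assms(2,5)]
        continuous_on_extend_zero[OF assms(1) compact_imp_closed[OF assms(2)] assms(3,4,5)])
  have "(\<integral>\<^sup>+x. ennreal (f x) \<partial>lebesgue_on U) = (\<integral>\<^sup>+x. ennreal (f x) * indicator U x \<partial>lebesgue)"
    by (rule nn_integral_restrict_space) (use U in simp)
  also have "\<dots> = (\<integral>\<^sup>+x. ennreal (f x) \<partial>lebesgue)"
  proof (intro nn_integral_cong)
    show "ennreal (f x) * indicator U x = ennreal (f x)" for x
      using assms(3) assms(5)[of x] by (cases "x \<in> K") auto
  qed
  also have "\<dots> = (\<integral>\<^sup>+x. ennreal (f x) \<partial>lborel)" by (rule nn_integral_completion)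
  also have "\<dots> = ennreal (integral\<^sup>L lborel f)"
    by (rule nn_integral_eq_integral[OF i]) (simp add: assms(6))
  finally show ?thesis .
qed

context stokes_pair begin

lemma stokes_estimates_of_pair:
  fixes J :: "real^'d \<Rightarrow> complex^'d^'d" and z F :: "real^'d \<Rightarrow> complex^'d" and w :: "real^'d \<Rightarrow> 'c::real_normed_vector"
  assumes s: "1 \<le> s" and t: "1 \<le> \<tau>" "2 * carleman_threshold CARD('d) B c \<le> c * \<tau>" and al: "\<alpha> \<noteq> - 1"
    and J: "\<And>x. (norm (J x))\<^sup>2 = (\<Sum>j\<in>UNIV. (norm (v1 j x))\<^sup>2)" and z: "\<And>x. (norm (z x))\<^sup>2 = (norm (v x))\<^sup>2"
    and \<pi>: "\<And>x. \<pi> x = q x + dv x" and F: "\<And>x. (norm (F x))\<^sup>2 = (norm (u.Du x))\<^sup>2" and w: "\<And>x. (norm (w x))\<^sup>2 = cu x"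
  shows "stokes_estimates U \<psi> \<alpha> (stokes_const CARD('d) B c \<alpha>) \<tau> s J z dv \<pi> F w"
proof -
  let ?C = "stokes_const CARD('d) B c \<alpha>" and ?W = "\<lambda>x. exp (2 * s * exp (\<tau> * \<psi> x))"
  have C: "0 \<le> ?C" using carleman_const_pos[OF u.nondeg(1) u.B, of "CARD('d)"] unfolding stokes_const_def
    by (intro add_nonneg_nonneg mult_nonneg_nonneg) auto
  have cU: "continuous_on U dv" "continuous_on U q" "continuous_on U cu"
    by (rule continuous_on_subset[OF _ subset_UNIV]; rule cont)+
  note ci = continuous_intros u.contU v.contU u.contDu v.contDu cU u.cont_psi
  note [simp] = u.zero v.zero zero u.Du_zero v.Du_zero
  note nn = nn_integral_compact_support[OF u.U u.K]
  have e2: "exp (2 * \<tau> * \<psi> x) = (exp (\<tau> * \<psi> x))\<^sup>2" for x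
    by (simp add: power2_eq_square mult_exp_exp)
  have np: "norm (dv x - \<pi> x) = norm (q x)" for x by (simp add: \<pi>)
  have 1: "(\<integral>\<^sup>+x. ennreal (((norm (J x))\<^sup>2 + s\<^sup>2 * \<tau>\<^sup>2 * exp (2 * \<tau> * \<psi> x) * (norm (z x))\<^sup>2) * ?W x) \<partial>lebesgue_on U)
    = ennreal (integral\<^sup>L lborel (\<lambda>x. ?W x * (\<Sum>j\<in>UNIV. (norm (v1 j x))\<^sup>2) + s\<^sup>2 * \<tau>\<^sup>2 * (exp (\<tau> * \<psi> x))\<^sup>2 * ?W x * (norm (v x))\<^sup>2))"
    unfolding e2 J z
    by (subst nn[symmetric]) (auto intro!: ci nn_integral_cong add_nonneg_nonneg mult_nonneg_nonneg sum_nonneg simp: algebra_simps)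
  have 2: "(\<integral>\<^sup>+x. ennreal ((s * exp (\<tau> * \<psi> x) * (norm (dv x + complex_of_real \<alpha> * \<pi> x))\<^sup>2 + (1 / \<tau>\<^sup>2) * (norm (F x))\<^sup>2) * ?W x) \<partial>lebesgue_on U)
    = ennreal (integral\<^sup>L lborel (\<lambda>x. s * exp (\<tau> * \<psi> x) * ?W x * (norm (dv x + of_real \<alpha> * (q x + dv x)))\<^sup>2
        + 1 / \<tau>\<^sup>2 * ?W x * (norm (u.Du x))\<^sup>2))"
    using s t(1) by (subst nn[symmetric]) (auto intro!: ci nn_integral_cong add_nonneg_nonneg mult_nonneg_nonneg simp: \<pi> F algebra_simps)
  have 3: "(\<integral>\<^sup>+x. ennreal (s * \<tau>\<^sup>2 * exp (\<tau> * \<psi> x) * ((norm (w x))\<^sup>2 + (norm (dv x - \<pi> x))\<^sup>2) * ?W x) \<partial>lebesgue_on U)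
    = ennreal (integral\<^sup>L lborel (\<lambda>x. s * \<tau>\<^sup>2 * exp (\<tau> * \<psi> x) * ?W x * (cu x + (norm (q x))\<^sup>2)))"
    using s t(1) by (subst nn[symmetric]) (auto intro!: ci nn_integral_cong add_nonneg_nonneg mult_nonneg_nonneg cu simp: w np algebra_simps)
  have 4: "(\<integral>\<^sup>+x. ennreal ((norm (F x))\<^sup>2 * ?W x) \<partial>lebesgue_on U) = ennreal (integral\<^sup>L lborel (\<lambda>x. ?W x * (norm (u.Du x))\<^sup>2))"
    by (subst nn[symmetric]) (auto intro!: ci nn_integral_cong simp: F mult_ac)
  show ?thesis
    unfolding stokes_estimates_def 1 2 3 4 using estimates[OF s t al] C by (simp add: ennreal_mult'[symmetric] ennreal_leI)
qed

end

section \<open>Smooth functions and their jets\<close>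

definition smooth :: "(real^'d::finite \<Rightarrow> complex) \<Rightarrow> bool" where
  "smooth f \<longleftrightarrow> (\<forall>k. C_on k UNIV f)"

lemma smooth_pderiv_at: "smooth f \<Longrightarrow> smooth (pderiv_at j f)"
  unfolding smooth_def using C_on.simps(2) by blast

lemma smooth_cont: "smooth f \<Longrightarrow> continuous_on UNIV f"
  unfolding smooth_def using C_on.simps(1) by blast

lemma smooth_has_pd: "smooth f \<Longrightarrow> has_pd j f (pderiv_at j f x) x"
  using C_on.simps(2)[of 0 UNIV f] unfolding smooth_def differentiable_on_def
  by (intro has_pd_pderiv_at) auto

lemma smooth_commute: "smooth f \<Longrightarrow> pderiv_at l (pderiv_at j f) x = pderiv_at j (pderiv_at l f) x"
  by (rule pd_commute[of j f "pderiv_at j f" l "pderiv_at l f"])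
    (auto intro: smooth_has_pd smooth_cont smooth_pderiv_at)

lemma pderiv_at_off_support:
  assumes "smooth f" "closed K" "\<And>x. x \<notin> K \<Longrightarrow> f x = 0" "x \<notin> K"
  shows "pderiv_at j f x = 0"
  by (rule has_pd_unique[OF smooth_has_pd[OF assms(1)] has_pd_off_support[OF assms(2,3,4)]])

text \<open>A function with its first and second derivatives, all vanishing off \<open>K\<close>.  Closure under pairing,
  sums and differences assembles the fields \<open>(q, w)\<close> from derivatives of scalar test functions.\<close>

definition jet2 :: "(real^'d::finite) set \<Rightarrow> (real^'d \<Rightarrow> 'b::real_normed_vector) \<Rightarrow> ('d \<Rightarrow> real^'d \<Rightarrow> 'b)
    \<Rightarrow> ('d \<Rightarrow> 'd \<Rightarrow> real^'d \<Rightarrow> 'b) \<Rightarrow> bool" where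
  "jet2 K f f1 f2 \<longleftrightarrow> (\<forall>j x. has_pd j f (f1 j x) x) \<and> (\<forall>l j x. has_pd l (f1 j) (f2 l j x) x)
     \<and> (\<forall>l j x. f2 l j x = f2 j l x) \<and> continuous_on UNIV f \<and> (\<forall>j. continuous_on UNIV (f1 j))
     \<and> (\<forall>l j. continuous_on UNIV (f2 l j))
     \<and> (\<forall>x. x \<notin> K \<longrightarrow> f x = 0 \<and> (\<forall>j. f1 j x = 0) \<and> (\<forall>l j. f2 l j x = 0))"

lemma jet2_smooth:
  assumes "smooth f" "closed K" "\<And>x. x \<notin> K \<Longrightarrow> f x = 0"
  shows "jet2 K f (\<lambda>j. pderiv_at j f) (\<lambda>l j. pderiv_at l (pderiv_at j f))"
proof -
  have 1: "pderiv_at j f x = 0" if "x \<notin> K" for j x using pderiv_at_off_support[OF assms that] .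
  have 2: "pderiv_at l (pderiv_at j f) x = 0" if "x \<notin> K" for l j x
    using pderiv_at_off_support[OF smooth_pderiv_at[OF assms(1)] assms(2) 1 that] .
  show ?thesis unfolding jet2_def using assms(1,3) 1 2
    by (auto intro: smooth_has_pd smooth_cont smooth_pderiv_at smooth_commute)
qed

lemma jet2_zero: "jet2 K (\<lambda>x. 0) (\<lambda>j x. 0) (\<lambda>l j x. 0)"
  unfolding jet2_def by (auto intro: has_pd_const)

lemma jet2_Pair: "jet2 K f f1 f2 \<Longrightarrow> jet2 K g g1 g2 \<Longrightarrow>
  jet2 K (\<lambda>x. (f x, g x)) (\<lambda>j x. (f1 j x, g1 j x)) (\<lambda>l j x. (f2 l j x, g2 l j x))"
  unfolding jet2_def by (auto intro!: has_pd_Pair continuous_intros simp: zero_prod_def)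

lemma jet2_add: "jet2 K f f1 f2 \<Longrightarrow> jet2 K g g1 g2 \<Longrightarrow>
  jet2 K (\<lambda>x. f x + g x) (\<lambda>j x. f1 j x + g1 j x) (\<lambda>l j x. f2 l j x + g2 l j x)"
  unfolding jet2_def by (auto intro!: has_pd_add continuous_intros)

lemma jet2_diff: "jet2 K f f1 f2 \<Longrightarrow> jet2 K g g1 g2 \<Longrightarrow>
  jet2 K (\<lambda>x. f x - g x) (\<lambda>j x. f1 j x - g1 j x) (\<lambda>l j x. f2 l j x - g2 l j x)"
  unfolding jet2_def by (auto intro!: has_pd_diff continuous_intros)

lemma clifford_jetI:
  assumes "clifford A" "open U" "compact K" "K \<subseteq> U" "jet2 K u u1 u2"
  shows "clifford_jet A U K u u1 u2"
  using assms unfolding clifford_jet_def clifford_jet_axioms_def jet2_def by blast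

section \<open>Divergence and curl as Clifford systems\<close>

text \<open>A jet \<open>Z i js\<close> holds the derivative of the \<open>i\<close>-th component along the list
  \<open>js\<close>.  The same expressions serve for classical and for weak derivatives.\<close>

definition jet_jacobian :: "('d \<Rightarrow> 'd list \<Rightarrow> real^'d::finite \<Rightarrow> complex) \<Rightarrow> real^'d \<Rightarrow> complex^'d^'d" where
  "jet_jacobian Z x = (\<chi> i j. Z i [j] x)"
definition jet_value :: "('d \<Rightarrow> 'd list \<Rightarrow> real^'d::finite \<Rightarrow> complex) \<Rightarrow> real^'d \<Rightarrow> complex^'d" where
  "jet_value Z x = (\<chi> i. Z i [] x)"
definition jet_div :: "('d \<Rightarrow> 'd list \<Rightarrow> real^'d::finite \<Rightarrow> complex) \<Rightarrow> real^'d \<Rightarrow> complex" where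
  "jet_div Z x = (\<Sum>j\<in>UNIV. Z j [j] x)"
definition jet_rhs :: "('d \<Rightarrow> 'd list \<Rightarrow> real^'d::finite \<Rightarrow> complex) \<Rightarrow> ('d list \<Rightarrow> real^'d \<Rightarrow> complex) \<Rightarrow> real^'d \<Rightarrow> complex^'d" where
  "jet_rhs Z P x = (\<chi> i. P [i] x - (\<Sum>j\<in>UNIV. Z i [j, j] x))"
definition jet_curl2 :: "(2 \<Rightarrow> 2 list \<Rightarrow> real^2 \<Rightarrow> complex) \<Rightarrow> real^2 \<Rightarrow> complex" where
  "jet_curl2 Z x = Z 2 [1] x - Z 1 [2] x"
definition jet_curl3 :: "(3 \<Rightarrow> 3 list \<Rightarrow> real^3 \<Rightarrow> complex) \<Rightarrow> real^3 \<Rightarrow> complex^3" where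
  "jet_curl3 Z x = vector [Z 3 [2] x - Z 2 [3] x, Z 1 [3] x - Z 3 [1] x, Z 2 [1] x - Z 1 [2] x]"

lemma norm_vec_sq: "(norm (x :: 'a::real_normed_vector^'n))\<^sup>2 = (\<Sum>i\<in>UNIV. (norm (x $ i))\<^sup>2)"
  by (simp add: norm_vec_def L2_set_def sum_nonneg)

lemma norm_Pair_sq: "(norm (a, b))\<^sup>2 = (norm a)\<^sup>2 + (norm b)\<^sup>2"
  by (simp add: norm_Pair)

text \<open>The matrices of \<open>(q, w) \<mapsto> (\<partial>\<^sub>1 q + \<partial>\<^sub>2 w, \<partial>\<^sub>2 q -
  \<partial>\<^sub>1 w)\<close>, the Cauchy--Riemann operator.  Applied to \<open>(z\<^sub>1, z\<^sub>2)\<close>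
  it gives \<open>(div z, - curl z)\<close>.\<close>

definition dirac2 :: "2 \<Rightarrow> complex \<times> complex \<Rightarrow> complex \<times> complex" where
  "dirac2 j x = (if j = 1 then (fst x, - snd x) else (snd x, fst x))"

text \<open>The matrices of \<open>(q, w) \<mapsto> (\<nabla> q + curl w, div w)\<close> on four components.  Applied to
  \<open>(0, z)\<close> it gives \<open>(curl z, div z)\<close>.\<close>

definition dirac3 :: "3 \<Rightarrow> complex \<times> complex \<times> complex \<times> complex \<Rightarrow> complex \<times> complex \<times> complex \<times> complex" where
  "dirac3 j x = (case x of (q, a, b, c) \<Rightarrow>
     if j = 1 then (q, - c, b, a) else if j = 2 then (c, q, - a, b) else (- b, a, q, c))"

lemma clifford_dirac2: "clifford dirac2"
proof (rule clifford.intro)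
  show "linear (dirac2 j)" for j by (rule linearI) (auto simp: dirac2_def)
  show "inner (dirac2 j x) (dirac2 k y) + inner (dirac2 k x) (dirac2 j y) = (if j = k then 2 * inner x y else 0)" for j k x y
    using exhaust_2[of j] exhaust_2[of k] by (auto simp: dirac2_def inner_prod_def)
qed

lemma clifford_dirac3: "clifford dirac3"
proof (rule clifford.intro)
  show "linear (dirac3 j)" for j by (rule linearI) (auto simp: dirac3_def)
  show "inner (dirac3 j x) (dirac3 k y) + inner (dirac3 k x) (dirac3 j y) = (if j = k then 2 * inner x y else 0)" for j k x y
    using exhaust_3[of j] exhaust_3[of k] by (cases x; cases y) (auto simp: dirac3_def inner_prod_def)
qed

lemma common_support:
  fixes \<eta> :: "'d::finite \<Rightarrow> real^'d \<Rightarrow> complex"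
  assumes "\<And>i. test_fun U (\<eta> i)" "test_fun U \<pi>"
  obtains K where "compact K" "K \<subseteq> U" "\<And>i x. x \<notin> K \<Longrightarrow> \<eta> i x = 0" "\<And>x. x \<notin> K \<Longrightarrow> \<pi> x = 0"
proof
  let ?K = "(\<Union>i. closure {x. \<eta> i x \<noteq> 0}) \<union> closure {x. \<pi> x \<noteq> 0}"
  show "compact ?K" "?K \<subseteq> U" using assms unfolding test_fun_def by (auto intro!: compact_UN)
  show "\<eta> i x = 0" if "x \<notin> ?K" for i x using that closure_subset[of "{x. \<eta> i x \<noteq> 0}"] by auto
  show "\<pi> x = 0" if "x \<notin> ?K" for x using that closure_subset[of "{x. \<pi> x \<noteq> 0}"] by auto
qed

lemma test_fun_smooth: "test_fun U \<eta> \<Longrightarrow> smooth \<eta>" by (simp add: test_fun_def smooth_def)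

lemma pderivs_simps: "pderivs [] f = f" "pderivs (j # js) f = pderiv_at j (pderivs js f)"
  by (simp_all add: pderivs_def)

lemma stokes_estimates_of_jets:
  fixes A :: "'d::finite \<Rightarrow> 'v::euclidean_space \<Rightarrow> 'v" and w :: "real^'d \<Rightarrow> 'c::real_normed_vector"
  assumes cu: "clifford_jet A U K u u1 u2" and cv: "clifford_jet A U K v v1 v2" and wf: "weight_function U \<psi> p p' B c"
    and s: "1 \<le> s" and t: "1 \<le> \<tau>" "2 * carleman_threshold CARD('d) B c \<le> c * \<tau>" and al: "\<alpha> \<noteq> - 1"
    and cont: "continuous_on UNIV dv" "continuous_on UNIV q" "continuous_on UNIV w"
    and zero: "\<And>x. x \<notin> K \<Longrightarrow> dv x = 0 \<and> q x = 0 \<and> w x = 0"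
    and nu: "\<And>x. (norm (u x))\<^sup>2 = (norm (q x))\<^sup>2 + (norm (w x))\<^sup>2"
    and nv: "\<And>x. (norm (\<Sum>j\<in>UNIV. A j (v1 j x)))\<^sup>2 = (norm (dv x))\<^sup>2 + (norm (w x))\<^sup>2"
    and J: "\<And>x. (norm (J x))\<^sup>2 = (\<Sum>j\<in>UNIV. (norm (v1 j x))\<^sup>2)" and z: "\<And>x. (norm (z x))\<^sup>2 = (norm (v x))\<^sup>2"
    and \<pi>: "\<And>x. \<pi> x = q x + dv x" and F: "\<And>x. (norm (F x))\<^sup>2 = (norm (\<Sum>j\<in>UNIV. A j (u1 j x)))\<^sup>2"
  shows "stokes_estimates U \<psi> \<alpha> (stokes_const CARD('d) B c \<alpha>) \<tau> s J z dv \<pi> F w"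
proof -
  have "stokes_pair A U K u u1 u2 v v1 v2 \<psi> p p' B c dv q (\<lambda>x. (norm (w x))\<^sup>2)"
    by (intro stokes_pair.intro carleman.intro stokes_pair_axioms.intro cu cv wf)
      (use zero in \<open>auto simp: nu clifford_jet.Du_def[OF cv] nv intro!: continuous_intros cont\<close>)
  moreover have "(norm (F x))\<^sup>2 = (norm (clifford_jet.Du A u1 x))\<^sup>2" for x
    by (simp add: F clifford_jet.Du_def[OF cu])
  ultimately show ?thesis by (rule stokes_pair.stokes_estimates_of_pair[OF _ s t al J z \<pi> _ refl])
qed

text \<open>With \<open>q = p - div z\<close> and \<open>w = curl z\<close>, commuting mixed derivatives turns
  \<open>\<partial>\<^sub>1 q + \<partial>\<^sub>2 w\<close> and \<open>\<partial>\<^sub>2 q - \<partial>\<^sub>1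
  w\<close> into the components of \<open>\<nabla> p - \<Delta> z\<close>.\<close>

lemma stokes_estimates_test_fun2:
  fixes U :: "(real^2) set" and \<eta> :: "2 \<Rightarrow> real^2 \<Rightarrow> complex"
  assumes U: "open U" and wf: "weight_function U \<psi> p p' B c"
    and s: "1 \<le> s" and t: "1 \<le> \<tau>" "2 * carleman_threshold 2 B c \<le> c * \<tau>" and al: "\<alpha> \<noteq> - 1"
    and \<eta>: "\<And>i. test_fun U (\<eta> i)" and \<pi>: "test_fun U \<pi>"
  defines "Z \<equiv> \<lambda>i js. pderivs js (\<eta> i)" and "P \<equiv> \<lambda>js. pderivs js \<pi>"
  shows "stokes_estimates U \<psi> \<alpha> (stokes_const 2 B c \<alpha>) \<tau> s (jet_jacobian Z) (jet_value Z) (jet_div Z) (P []) (jet_rhs Z P) (jet_curl2 Z)"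
proof -
  obtain K where K: "compact K" "K \<subseteq> U" and K0: "\<And>i x. x \<notin> K \<Longrightarrow> \<eta> i x = 0" "\<And>x. x \<notin> K \<Longrightarrow> \<pi> x = 0"
    using common_support[of U \<eta> \<pi>] \<eta> \<pi> by metis
  note ct = smooth_cont[OF test_fun_smooth[OF \<eta>]] smooth_cont[OF test_fun_smooth[OF \<pi>]]
    smooth_cont[OF smooth_pderiv_at[OF test_fun_smooth[OF \<eta>]]]
  note cl = compact_imp_closed[OF K(1)]
  note sm = test_fun_smooth[OF \<eta>] test_fun_smooth[OF \<pi>]
  note sm1 = smooth_pderiv_at[OF sm(1)]
  have K1: "\<And>i j x. x \<notin> K \<Longrightarrow> pderiv_at j (\<eta> i) x = 0" using pderiv_at_off_support[OF sm(1) cl K0(1)] .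
  note e = jet2_smooth[OF sm(1) cl K0(1)] and pj = jet2_smooth[OF sm(2) cl K0(2)]
    and d = jet2_smooth[OF sm1 cl K1]
  note ju = jet2_Pair[OF jet2_diff[OF pj jet2_add[OF d[of 1 1] d[of 2 2]]] jet2_diff[OF d[of 1 2] d[of 2 1]]]
  note jv = jet2_Pair[OF e[of 1] e[of 2]]
  note cu = clifford_jetI[OF clifford_dirac2 U K ju] and cv = clifford_jetI[OF clifford_dirac2 U K jv]
  let ?q = "\<lambda>x. \<pi> x - (pderiv_at 1 (\<eta> 1) x + pderiv_at 2 (\<eta> 2) x)"
  have t': "2 * carleman_threshold CARD(2) B c \<le> c * \<tau>" using t(2) by simp
  have "stokes_estimates U \<psi> \<alpha> (stokes_const CARD(2) B c \<alpha>) \<tau> s (jet_jacobian Z) (jet_value Z) (jet_div Z) (P []) (jet_rhs Z P) (jet_curl2 Z)"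
    by (rule stokes_estimates_of_jets[OF cu cv wf s t(1) t' al, where q = ?q])
     (auto simp: norm_Pair_sq norm_vec_sq jet_jacobian_def jet_value_def jet_div_def jet_curl2_def jet_rhs_def Z_def P_def pderivs_simps
        sum_2 dirac2_def K0 K1 smooth_commute[OF sm(1), of 2 1] norm_minus_commute algebra_simps
        intro!: continuous_intros ct)
  then show ?thesis by simp
qed

lemma vector_3_vec_lambda: "(vector [a, b, c] :: 'a::zero^3) = (\<chi> i. if i = 1 then a else if i = 2 then b else c)"
  by (simp add: vec_eq_iff forall_3)

lemma continuous_on_vector_3:
  fixes a b c :: "'a::topological_space \<Rightarrow> complex"
  assumes "continuous_on S a" "continuous_on S b" "continuous_on S c"
  shows "continuous_on S (\<lambda>x. vector [a x, b x, c x] :: complex^3)"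
proof -
  have "continuous_on S (\<lambda>x. if i = 1 then a x else if i = 2 then b x else c x)" for i :: 3
    using assms by (cases "i = 1"; cases "i = 2") simp_all
  then show ?thesis unfolding vector_3_vec_lambda by (rule continuous_on_vec_lambda)
qed

text \<open>The scalar slot of the field belonging to \<open>z\<close> is zero, and \<open>div (curl z) = 0\<close> makes
  the last component of \<open>D (q, w)\<close> vanish, so that again the size of \<open>D (q, w)\<close> is that
  of \<open>\<nabla> p - \<Delta> z\<close>.\<close>

lemma stokes_estimates_test_fun3:
  fixes U :: "(real^3) set" and \<eta> :: "3 \<Rightarrow> real^3 \<Rightarrow> complex"
  assumes U: "open U" and wf: "weight_function U \<psi> p p' B c"
    and s: "1 \<le> s" and t: "1 \<le> \<tau>" "2 * carleman_threshold 3 B c \<le> c * \<tau>" and al: "\<alpha> \<noteq> - 1"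
    and \<eta>: "\<And>i. test_fun U (\<eta> i)" and \<pi>: "test_fun U \<pi>"
  defines "Z \<equiv> \<lambda>i js. pderivs js (\<eta> i)" and "P \<equiv> \<lambda>js. pderivs js \<pi>"
  shows "stokes_estimates U \<psi> \<alpha> (stokes_const 3 B c \<alpha>) \<tau> s (jet_jacobian Z) (jet_value Z) (jet_div Z) (P []) (jet_rhs Z P) (jet_curl3 Z)"
proof -
  obtain K where K: "compact K" "K \<subseteq> U" and K0: "\<And>i x. x \<notin> K \<Longrightarrow> \<eta> i x = 0" "\<And>x. x \<notin> K \<Longrightarrow> \<pi> x = 0"
    using common_support[of U \<eta> \<pi>] \<eta> \<pi> by metis
  note ct = smooth_cont[OF test_fun_smooth[OF \<eta>]] smooth_cont[OF test_fun_smooth[OF \<pi>]]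
    smooth_cont[OF smooth_pderiv_at[OF test_fun_smooth[OF \<eta>]]]
  note cl = compact_imp_closed[OF K(1)]
  note sm = test_fun_smooth[OF \<eta>] test_fun_smooth[OF \<pi>]
  note sm1 = smooth_pderiv_at[OF sm(1)]
  have K1: "\<And>i j x. x \<notin> K \<Longrightarrow> pderiv_at j (\<eta> i) x = 0" using pderiv_at_off_support[OF sm(1) cl K0(1)] .
  note e = jet2_smooth[OF sm(1) cl K0(1)] and pj = jet2_smooth[OF sm(2) cl K0(2)]
    and d = jet2_smooth[OF sm1 cl K1]
  note ju = jet2_Pair[OF jet2_diff[OF pj jet2_add[OF jet2_add[OF d[of 1 1] d[of 2 2]] d[of 3 3]]]
      jet2_Pair[OF jet2_diff[OF d[of 2 3] d[of 3 2]]
      jet2_Pair[OF jet2_diff[OF d[of 3 1] d[of 1 3]] jet2_diff[OF d[of 1 2] d[of 2 1]]]]]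
  note jv = jet2_Pair[OF jet2_zero jet2_Pair[OF e[of 1] jet2_Pair[OF e[of 2] e[of 3]]]]
  note cu = clifford_jetI[OF clifford_dirac3 U K ju] and cv = clifford_jetI[OF clifford_dirac3 U K jv]
  let ?q = "\<lambda>x. \<pi> x - (pderiv_at 1 (\<eta> 1) x + pderiv_at 2 (\<eta> 2) x + pderiv_at 3 (\<eta> 3) x)"
  have t': "2 * carleman_threshold CARD(3) B c \<le> c * \<tau>" using t(2) by simp
  have "stokes_estimates U \<psi> \<alpha> (stokes_const CARD(3) B c \<alpha>) \<tau> s (jet_jacobian Z) (jet_value Z) (jet_div Z) (P []) (jet_rhs Z P) (jet_curl3 Z)"
    by (rule stokes_estimates_of_jets[OF cu cv wf s t(1) t' al, where q = ?q])
     (auto simp: norm_Pair_sq norm_vec_sq jet_jacobian_def jet_value_def jet_div_def jet_curl3_def jet_rhs_def Z_def P_def pderivs_simps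
        sum_3 dirac3_def K0 K1 smooth_commute[OF sm(1), of 2 1] smooth_commute[OF sm(1), of 3 1] smooth_commute[OF sm(1), of 3 2]
        norm_minus_commute vec_eq_iff forall_3 algebra_simps
        intro!: continuous_intros ct continuous_on_vector_3)
  then show ?thesis by simp
qed

section \<open>Bump functions and the fundamental lemma\<close>

text \<open>The functions \<open>t powr (- m) * exp (- 1 / t)\<close>, extended by zero.  The powers are included because
  differentiation produces them.\<close>

definition flat :: "nat \<Rightarrow> real \<Rightarrow> real" where
  "flat m t = (if t > 0 then (1 / t) ^ m * exp (- (1 / t)) else 0)"

lemma flat_tendsto_0: "(flat m \<longlongrightarrow> 0) (at 0)"
proof -
  have "(flat m \<longlongrightarrow> 0) (at_left 0)"
    by (rule tendsto_eventually) (auto simp: flat_def eventually_at_left_field intro!: exI[of _ "-1"])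
  moreover have "((\<lambda>t. inverse t ^ m / exp (inverse t)) \<longlongrightarrow> (0::real)) (at_right 0)"
    by (rule filterlim_compose[OF tendsto_power_div_exp_0 filterlim_inverse_at_top_right])
  then have "(flat m \<longlongrightarrow> 0) (at_right 0)"
    by (rule filterlim_cong[THEN iffD1, OF refl refl, rotated])
      (auto simp: flat_def eventually_at_right_field exp_minus divide_inverse intro!: exI[of _ 1])
  ultimately show ?thesis by (simp add: filterlim_split_at)
qed

text \<open>At \<open>0\<close> the difference quotient of \<open>flat m\<close> is \<open>flat (m + 1)\<close>, which tends
  to zero.\<close>

lemma flat_deriv: "(flat m has_real_derivative (flat (m + 2) t - real m * flat (m + 1) t)) (at t)"
proof -
  consider "t > 0" | "t < 0" | "t = 0" by linarith
  then show ?thesis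
  proof cases
    case 1
    have r: "((\<lambda>t. 1 / t) has_real_derivative - (1 / t\<^sup>2)) (at t)"
      using 1 by (auto intro!: derivative_eq_intros simp: power2_eq_square)
    have "((\<lambda>t. (1 / t) ^ m * exp (- (1 / t))) has_real_derivative (flat (m + 2) t - real m * flat (m + 1) t)) (at t)"
      by (rule DERIV_cong[OF DERIV_mult[OF DERIV_power[OF r] DERIV_fun_exp[OF DERIV_minus[OF r]]]])
        (use 1 in \<open>cases m; simp add: flat_def power2_eq_square field_simps\<close>)
    then show ?thesis
      by (rule has_field_derivative_transform_within_open[of _ _ _ "{0<..}"]) (use 1 in \<open>auto simp: flat_def\<close>)
  next
    case 2
    have "((\<lambda>t. 0) has_real_derivative (flat (m + 2) t - real m * flat (m + 1) t)) (at t)"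
      using 2 by (simp add: flat_def)
    then show ?thesis
      by (rule has_field_derivative_transform_within_open[of _ _ _ "{..<0}"]) (use 2 in \<open>auto simp: flat_def\<close>)
  next
    case 3
    have "(\<lambda>h. (flat m (0 + h) - flat m 0) / h) = flat (Suc m)"
      by (auto simp: fun_eq_iff flat_def)
    then show ?thesis using flat_tendsto_0[of "Suc m"] 3 by (simp add: DERIV_def flat_def[of _ 0])
  qed
qed

text \<open>An algebra that is closed under partial derivatives, so that all of its members are smooth.  Only affine
  functions of a single coordinate are inserted into \<open>flat\<close>: this is enough for products over the
  faces of a box.\<close>

inductive_set bump_algebra :: "(real^'d::finite \<Rightarrow> complex) set" where
  const: "(\<lambda>x. c) \<in> bump_algebra"
| flat: "(\<lambda>x. of_real (flat m (\<sigma> * x $ j + a))) \<in> bump_algebra"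
| add: "f \<in> bump_algebra \<Longrightarrow> g \<in> bump_algebra \<Longrightarrow> (\<lambda>x. f x + g x) \<in> bump_algebra"
| mult: "f \<in> bump_algebra \<Longrightarrow> g \<in> bump_algebra \<Longrightarrow> (\<lambda>x. f x * g x) \<in> bump_algebra"

lemma bump_algebra_pd:
  fixes f :: "real^'d::finite \<Rightarrow> complex"
  assumes "f \<in> bump_algebra"
  shows "(\<forall>x. f differentiable (at x)) \<and> (\<exists>g\<in>bump_algebra. \<forall>x. has_pd i f (g x) x)"
  using assms
proof induction
  case (const c)
  show ?case by (auto intro!: bexI[OF _ bump_algebra.const[of 0]] has_pd_const)
next
  case (flat m \<sigma> j a)
  have l: "((\<lambda>x::real^'d. \<sigma> * x $ j + a) has_derivative (\<lambda>h. \<sigma> * h $ j)) (at x)" for x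
    by (auto intro!: derivative_eq_intros bounded_linear_imp_has_derivative[OF bounded_linear_vec_nth])
  have 1: "(\<lambda>x::real^'d. of_real (flat m (\<sigma> * x $ j + a)) :: complex) differentiable (at x)" for x
    using bounded_linear.has_derivative[OF bounded_linear_of_real
        has_derivative_compose[OF l flat_deriv[THEN has_field_derivative_imp_has_derivative]]]
    unfolding differentiable_def by blast
  define k where "k = (if i = j then \<sigma> else 0)"
  have p: "has_pd i (\<lambda>x::real^'d. \<sigma> * x $ j + a) k x" for x
    unfolding has_pd_def k_def by (auto simp: axis_def intro!: derivative_eq_intros)
  have "has_pd i (\<lambda>x::real^'d. of_real (flat m (\<sigma> * x $ j + a)) :: complex)
     (of_real (k *\<^sub>R (flat (m + 2) (\<sigma> * x $ j + a) - real m * flat (m + 1) (\<sigma> * x $ j + a)))) x" for x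
    by (intro has_pd_linear[OF bounded_linear_of_real] has_pd_chain p
        flat_deriv[unfolded has_real_derivative_iff_has_vector_derivative])
  then have 2: "has_pd i (\<lambda>x::real^'d. of_real (flat m (\<sigma> * x $ j + a)) :: complex)
     (of_real k * (of_real (flat (m + 2) (\<sigma> * x $ j + a)) + of_real (- real m) * of_real (flat (m + 1) (\<sigma> * x $ j + a)))) x" for x
    by simp
  show ?case
    by (intro conjI allI 1 bexI[of _ "\<lambda>x. of_real k * (of_real (flat (m + 2) (\<sigma> * x $ j + a)) + of_real (- real m) * of_real (flat (m + 1) (\<sigma> * x $ j + a)))"] 2
        bump_algebra.intros)
next
  case (add f g)
  then obtain f' g' where *: "f' \<in> bump_algebra" "g' \<in> bump_algebra" "\<And>x. has_pd i f (f' x) x" "\<And>x. has_pd i g (g' x) x"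
    by blast
  show ?case
  proof
    show "\<forall>x. (\<lambda>x. f x + g x) differentiable (at x)" using add by (auto intro: differentiable_add)
    show "\<exists>h\<in>bump_algebra. \<forall>x. has_pd i (\<lambda>x. f x + g x) (h x) x"
      by (rule bexI[OF _ bump_algebra.add[OF *(1,2)]]) (blast intro: has_pd_add *)
  qed
next
  case (mult f g)
  then obtain f' g' where *: "f' \<in> bump_algebra" "g' \<in> bump_algebra" "\<And>x. has_pd i f (f' x) x" "\<And>x. has_pd i g (g' x) x"
    by blast
  show ?case
  proof
    show "\<forall>x. (\<lambda>x. f x * g x) differentiable (at x)" using mult by (auto intro: differentiable_mult)
    show "\<exists>h\<in>bump_algebra. \<forall>x. has_pd i (\<lambda>x. f x * g x) (h x) x"
      by (rule bexI[OF _ bump_algebra.add[OF bump_algebra.mult[OF mult(1) *(2)] bump_algebra.mult[OF *(1) mult(2)]]])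
        (blast intro: has_pd_mult *)
  qed
qed

text \<open>Induction on the order of differentiability, for all members of the algebra at once.\<close>

lemma bump_algebra_smooth: "f \<in> bump_algebra \<Longrightarrow> C_on k UNIV f"
proof (induction k arbitrary: f)
  case 0
  then show ?case using bump_algebra_pd[OF 0, of undefined]
    by (auto intro!: continuous_at_imp_continuous_on differentiable_imp_continuous_within)
next
  case (Suc k)
  have d: "f differentiable (at x)" for x using bump_algebra_pd[OF Suc.prems] by blast
  have "pderiv_at j f \<in> bump_algebra" for j
  proof -
    obtain g where g: "g \<in> bump_algebra" "\<And>x. has_pd j f (g x) x" using bump_algebra_pd[OF Suc.prems, of j] by blast
    have "pderiv_at j f = g" using has_pd_unique[OF has_pd_pderiv_at[OF d] g(2)] by (auto simp: fun_eq_iff)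
    then show ?thesis using g by simp
  qed
  then show ?case using d Suc.IH by (auto simp: differentiable_on_def)
qed

lemma bump_algebra_prod: "finite I \<Longrightarrow> (\<And>i. i \<in> I \<Longrightarrow> f i \<in> bump_algebra) \<Longrightarrow> (\<lambda>x. \<Prod>i\<in>I. f i x) \<in> bump_algebra"
  by (induction I rule: finite_induct) (auto intro: bump_algebra.intros)

text \<open>Positive exactly on the open box when \<open>n > 0\<close>, and increasing to its indicator as \<open>n\<close>
  grows.\<close>

definition box_bump :: "real^'d::finite \<Rightarrow> real^'d \<Rightarrow> nat \<Rightarrow> real^'d \<Rightarrow> complex" where
  "box_bump a b n x = (\<Prod>j\<in>UNIV. of_real (flat 0 (real n * x $ j + - (real n * a $ j))) * of_real (flat 0 (- real n * x $ j + real n * b $ j)))"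

lemma flat0: "0 \<le> flat 0 t" "flat 0 t \<le> 1" "t \<le> 0 \<Longrightarrow> flat 0 t = 0"
  by (auto simp: flat_def)

lemma flat0_tendsto: "t > 0 \<Longrightarrow> (\<lambda>n. flat 0 (real n * t)) \<longlonglongrightarrow> 1"
proof -
  assume t: "t > 0"
  have "(\<lambda>n. exp (- (1 / (real n * t)))) \<longlonglongrightarrow> exp (- 0)"
  proof (intro tendsto_intros)
    have "(\<lambda>n. (1 / t) * (1 / real n)) \<longlonglongrightarrow> (1 / t) * 0" by (intro tendsto_intros lim_1_over_n)
    then show "(\<lambda>n. 1 / (real n * t)) \<longlonglongrightarrow> 0" by (simp add: mult.commute)
  qed
  then have "(\<lambda>n. exp (- (1 / (real n * t)))) \<longlonglongrightarrow> 1" by simp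
  then show ?thesis
    by (rule Lim_transform_eventually)
      (use t in \<open>auto intro: eventually_mono[OF eventually_gt_at_top[of 0]] simp: flat_def\<close>)
qed

lemma box_bump_zero: "x \<notin> box a b \<Longrightarrow> box_bump a b n x = 0"
proof -
  assume "x \<notin> box a b"
  then obtain j where "x $ j \<le> a $ j \<or> b $ j \<le> x $ j" by (auto simp: mem_box_cart not_less)
  then have "flat 0 (real n * x $ j + - (real n * a $ j)) = 0 \<or> flat 0 (- real n * x $ j + real n * b $ j) = 0"
    by (auto intro!: flat0(3) simp: mult_left_mono)
  then show ?thesis unfolding box_bump_def by (intro prod_zero) auto
qed

lemma box_bump_bound: "norm (box_bump a b n x) \<le> 1"
  unfolding box_bump_def prod_norm[symmetric]
  by (intro prod_le_1) (auto simp: norm_mult flat0 intro!: mult_le_one)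

lemma box_bump_tendsto: "(\<lambda>n. box_bump a b n x) \<longlonglongrightarrow> indicator (box a b) x"
proof (cases "x \<in> box a b")
  case True
  have "(\<lambda>n. box_bump a b n x) \<longlonglongrightarrow> (\<Prod>j\<in>(UNIV::'a set). of_real 1 * of_real 1)"
    unfolding box_bump_def
  proof (intro tendsto_prod tendsto_mult tendsto_of_real)
    fix j
    have "x $ j - a $ j > 0" "b $ j - x $ j > 0" using True by (auto simp: mem_box_cart)
    from this[THEN flat0_tendsto]
    show "(\<lambda>n. flat 0 (real n * x $ j + - (real n * a $ j))) \<longlonglongrightarrow> 1" "(\<lambda>n. flat 0 (- real n * x $ j + real n * b $ j)) \<longlonglongrightarrow> 1"
      by (simp_all add: algebra_simps)
  qed
  then show ?thesis using True by simp
qed (simp add: box_bump_zero)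

lemma test_fun_box_bump:
  assumes "cbox a b \<subseteq> U" shows "test_fun U (box_bump a b n)"
proof -
  have "(\<lambda>x. \<Prod>j\<in>UNIV. of_real (flat 0 (real n * x $ j + - (real n * a $ j))) * of_real (flat 0 (- real n * x $ j + real n * b $ j))) \<in> bump_algebra"
    by (intro bump_algebra_prod bump_algebra.mult bump_algebra.flat) simp
  then have 1: "box_bump a b n \<in> bump_algebra" by (simp add: box_bump_def[abs_def])
  have "{x. box_bump a b n x \<noteq> 0} \<subseteq> cbox a b" using box_bump_zero box_subset_cbox by blast
  then have 2: "closure {x. box_bump a b n x \<noteq> 0} \<subseteq> cbox a b" by (simp add: closure_minimal closed_cbox)
  then have "compact (closure {x. box_bump a b n x \<noteq> 0})"
    using bounded_subset[OF bounded_cbox 2] by (simp add: compact_eq_bounded_closed)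
  then show ?thesis using 1 2 assms bump_algebra_smooth unfolding test_fun_def by blast
qed

text \<open>Test \<open>h\<close> with \<open>box_bump a b n\<close> and let \<open>n\<close> tend to infinity; \<open>norm
  h\<close> dominates.\<close>

lemma integral_box_zero:
  fixes h :: "real^'d::finite \<Rightarrow> complex"
  assumes U: "open U" and h: "integrable (lebesgue_on U) h"
    and zero: "\<And>\<eta>. test_fun U \<eta> \<Longrightarrow> integral\<^sup>L (lebesgue_on U) (\<lambda>x. h x * \<eta> x) = 0"
    and ab: "cbox a b \<subseteq> U"
  shows "integral (cbox a b) h = 0"
proof -
  have Us: "U \<in> sets lebesgue" using U by (simp add: borel_open)
  have meas: "box_bump a b n \<in> borel_measurable (lebesgue_on U)" for n
  proof -
    have "continuous_on UNIV (box_bump a b n)"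
      using smooth_cont[OF test_fun_smooth[OF test_fun_box_bump[OF ab]]] .
    then show ?thesis using continuous_imp_measurable_on_sets_lebesgue[OF _ Us] continuous_on_subset by blast
  qed
  have hm: "h \<in> borel_measurable (lebesgue_on U)" using h by simp
  have "(\<lambda>n. integral\<^sup>L (lebesgue_on U) (\<lambda>x. h x * box_bump a b n x)) \<longlonglongrightarrow> integral\<^sup>L (lebesgue_on U) (\<lambda>x. h x * indicator (box a b) x)"
  proof (rule integral_dominated_convergence[where w = "\<lambda>x. norm (h x)"])
    show "(\<lambda>x. h x * indicator (box a b) x) \<in> borel_measurable (lebesgue_on U)"
      by (intro borel_measurable_times hm borel_measurable_indicator) (auto simp: sets_restrict_space Us intro!: image_eqI[of _ _ "box a b"] dest: subsetD[OF box_subset_cbox, THEN subsetD[OF ab]])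
    show "(\<lambda>x. h x * box_bump a b n x) \<in> borel_measurable (lebesgue_on U)" for n
      by (intro borel_measurable_times hm meas)
    show "AE x in lebesgue_on U. (\<lambda>n. h x * box_bump a b n x) \<longlonglongrightarrow> h x * indicator (box a b) x"
      by (intro AE_I2 tendsto_intros box_bump_tendsto)
    show "AE x in lebesgue_on U. norm (h x * box_bump a b n x) \<le> norm (h x)" for n
      using box_bump_bound[of a b n] by (intro AE_I2) (simp add: norm_mult mult_left_le)
  qed (use h in auto)
  then have z: "integral\<^sup>L (lebesgue_on U) (\<lambda>x. h x * indicator (box a b) x) = 0"
    using zero[OF test_fun_box_bump[OF ab]] by (simp add: LIMSEQ_const_iff)
  have sub: "box a b \<subseteq> U" using ab box_subset_cbox by blast
  have hb: "integrable (lebesgue_on (box a b)) h"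
  proof -
    have "set_integrable lebesgue U h" using h Us by (simp add: integrable_restrict_space set_integrable_def)
    then have "set_integrable lebesgue (box a b) h" by (rule set_integrable_subset) (use sub in auto)
    then show ?thesis by (simp add: integrable_restrict_space set_integrable_def)
  qed
  have "integral\<^sup>L (lebesgue_on U) (\<lambda>x. h x * indicator (box a b) x) = integral\<^sup>L lebesgue (\<lambda>x. indicator U x *\<^sub>R (h x * indicator (box a b) x))"
    by (rule integral_restrict_space) (use Us in simp)
  also have "(\<lambda>x. indicator U x *\<^sub>R (h x * indicator (box a b) x)) = (\<lambda>x. indicator (box a b) x *\<^sub>R h x)"
    using sub by (auto simp: fun_eq_iff indicator_def)
  also have "integral\<^sup>L lebesgue (\<lambda>x. indicator (box a b) x *\<^sub>R h x) = integral\<^sup>L (lebesgue_on (box a b)) h"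
    by (rule integral_restrict_space[symmetric]) simp
  also have "\<dots> = integral (box a b) h" by (rule lebesgue_integral_eq_integral[OF hb]) simp
  finally show ?thesis using z by (simp add: integral_open_interval)
qed

text \<open>All small cubes with corner \<open>x\<close> have integral zero, and by the differentiation theorem their
  averages converge to \<open>h x\<close> for almost every \<open>x\<close>.\<close>

lemma fundamental_lemma:
  fixes h :: "real^'d::finite \<Rightarrow> complex"
  assumes U: "open U" and h: "integrable (lebesgue_on U) h"
    and zero: "\<And>\<eta>. test_fun U \<eta> \<Longrightarrow> integral\<^sup>L (lebesgue_on U) (\<lambda>x. h x * \<eta> x) = 0"
  shows "AE x in lebesgue_on U. h x = 0"
proof -
  have Us: "U \<in> sets lebesgue" using U by (simp add: borel_open)
  define H where "H x = (if x \<in> U then h x else 0)" for x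
  have "h absolutely_integrable_on U" using h Us by (simp add: integrable_restrict_space set_integrable_def)
  then have "H absolutely_integrable_on UNIV" unfolding H_def by (simp add: absolutely_integrable_restrict_UNIV)
  then have "H absolutely_integrable_on cbox a b" for a b by (rule set_integrable_subset) auto
  then have "H integrable_on cbox a b" for a b by (rule set_lebesgue_integral_eq_integral(1))
  from integrable_ccontinuous_explicit[OF this] obtain N where N: "negligible N"
    and lim: "\<And>x e. x \<notin> N \<Longrightarrow> 0 < e \<Longrightarrow> \<exists>d>0. \<forall>r. 0 < r \<and> r < d \<longrightarrow>
         norm (integral (cbox x (x + r *\<^sub>R One)) H /\<^sub>R r ^ DIM(real^'d) - H x) < e"
    by blast
  have "h x = 0" if x: "x \<in> U" "x \<notin> N" for x
  proof (rule ccontr)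
    assume "h x \<noteq> 0"
    then have "norm (H x) > 0" using x by (simp add: H_def)
    from lim[OF x(2) this] obtain d where d: "d > 0"
      "\<And>r. 0 < r \<Longrightarrow> r < d \<Longrightarrow> norm (integral (cbox x (x + r *\<^sub>R One)) H /\<^sub>R r ^ DIM(real^'d) - H x) < norm (H x)" by blast
    obtain e where e: "e > 0" "ball x e \<subseteq> U" using U x(1) open_contains_ball by blast
    \<comment> \<open>small enough for the differentiation theorem and for the cube of side \<open>r\<close> to stay inside the ball of radius \<open>e\<close>\<close>
    define r where "r = min (d / 2) (e / (2 * (norm (One::real^'d) + 1)))"
    have n: "norm (One::real^'d) + 1 > 0" using norm_ge_zero[of "One::real^'d"] by linarith
    have r: "0 < r" "r < d" using d e n by (auto simp: r_def)
    have "cbox x (x + r *\<^sub>R One) \<subseteq> ball x e"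
    proof
      fix y assume y: "y \<in> cbox x (x + r *\<^sub>R One)"
      have "norm (y - x) \<le> norm (r *\<^sub>R (One::real^'d))"
      proof (rule norm_le_componentwise)
        fix b :: "real^'d" assume b: "b \<in> Basis"
        have "x \<bullet> b \<le> y \<bullet> b" "y \<bullet> b \<le> (x + r *\<^sub>R One) \<bullet> b" using y b unfolding mem_box by blast+
        then show "\<bar>(y - x) \<bullet> b\<bar> \<le> \<bar>(r *\<^sub>R One) \<bullet> b\<bar>" by (simp add: inner_diff_left inner_add_left)
      qed
      also have "\<dots> = r * norm (One::real^'d)" using r by simp
      also have "\<dots> \<le> r * (norm (One::real^'d) + 1)" using r by simp
      also have "\<dots> \<le> e / (2 * (norm (One::real^'d) + 1)) * (norm (One::real^'d) + 1)"
        using n by (intro mult_right_mono) (auto simp: r_def)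
      also have "e / (2 * D) * D = e / 2" if "D > 0" for D :: real using that by simp
      note this[OF n]
      finally show "y \<in> ball x e" using e(1) by (simp add: dist_norm norm_minus_commute)
    qed
    then have sub: "cbox x (x + r *\<^sub>R One) \<subseteq> U" using e by blast
    have "integral (cbox x (x + r *\<^sub>R One)) H = integral (cbox x (x + r *\<^sub>R One)) h"
      by (rule integral_cong) (use sub in \<open>auto simp: H_def\<close>)
    also have "\<dots> = 0" by (rule integral_box_zero[OF U h zero sub])
    finally show False using d(2)[OF r] by simp
  qed
  then have "{x \<in> U. h x \<noteq> 0} \<subseteq> N" by blast
  moreover have "N \<in> null_sets lebesgue" using N by (simp add: negligible_iff_null_sets)
  ultimately have "AE x in lebesgue. x \<in> U \<longrightarrow> h x = 0"
    by (intro AE_I'[of N]) auto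
  then show ?thesis using Us by (simp add: AE_restrict_space_iff)
qed

section \<open>Weak derivatives\<close>

lemma L2_measurable: "f \<in> L2 U \<Longrightarrow> f \<in> borel_measurable (lebesgue_on U)" by (simp add: L2_def)

lemma norm_diff_sq: "(norm (a - b))\<^sup>2 \<le> 2 * (norm a)\<^sup>2 + 2 * (norm (b::'a::real_normed_vector))\<^sup>2"
proof -
  have "(norm (a - b))\<^sup>2 \<le> (norm a + norm b)\<^sup>2" by (intro power_mono norm_triangle_ineq4) simp
  also have "\<dots> \<le> 2 * (norm a)\<^sup>2 + 2 * (norm b)\<^sup>2"
    using zero_le_power2[of "norm a - norm b"] by (simp add: power2_eq_square algebra_simps)
  finally show ?thesis .
qed

lemma L2_diff:
  assumes "f \<in> L2 U" "g \<in> L2 U" shows "(\<lambda>x. f x - g x) \<in> L2 U"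
proof -
  have m: "(\<lambda>x. f x - g x) \<in> borel_measurable (lebesgue_on U)" using assms by (auto simp: L2_def)
  have "integrable (lebesgue_on U) (\<lambda>x. 2 * (norm (f x))\<^sup>2 + 2 * (norm (g x))\<^sup>2)" using assms by (auto simp: L2_def)
  then have "integrable (lebesgue_on U) (\<lambda>x. (norm (f x - g x))\<^sup>2)"
    by (rule Bochner_Integration.integrable_bound) (use m norm_diff_sq in auto)
  then show ?thesis using m by (simp add: L2_def)
qed

lemma L2_integrable:
  fixes U :: "(real^'d::finite) set"
  assumes "open U" "bounded U" "f \<in> L2 U" shows "integrable (lebesgue_on U) f"
proof -
  interpret finite_measure "lebesgue_on U"
    using finite_measure_lebesgue_on[OF lmeasurable_open[OF assms(2,1)]] .
  have "integrable (lebesgue_on U) (\<lambda>x. 1 + (norm (f x))\<^sup>2)" using assms(3) by (auto simp: L2_def)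
  then show ?thesis
  proof (rule Bochner_Integration.integrable_bound)
    have "norm (f x) \<le> 1 + (norm (f x))\<^sup>2" for x
    proof -
      have "0 \<le> (norm (f x))\<^sup>2 + 1 - 2 * norm (f x)"
        using zero_le_power2[of "norm (f x) - 1"] unfolding power2_diff by simp
      then show ?thesis using norm_ge_zero[of "f x"] by linarith
    qed
    then show "AE x in lebesgue_on U. norm (f x) \<le> norm (1 + (norm (f x))\<^sup>2)" by auto
  qed (use assms(3) in \<open>simp add: L2_def\<close>)
qed

lemma test_fun_bounded:
  assumes "test_fun U \<eta>" obtains M where "\<And>x. norm (\<eta> x) \<le> M"
proof -
  let ?K = "closure {x. \<eta> x \<noteq> 0}"
  have "compact (\<eta> ` ?K)" using assms smooth_cont[OF test_fun_smooth[OF assms]]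
    by (auto simp: test_fun_def intro!: compact_continuous_image intro: continuous_on_subset)
  then obtain M where M: "\<And>y. y \<in> \<eta> ` ?K \<Longrightarrow> norm y \<le> M"
    using compact_imp_bounded[of "\<eta> ` ?K"] unfolding bounded_iff by metis
  have "norm (\<eta> x) \<le> \<bar>M\<bar>" for x
  proof (cases "\<eta> x = 0")
    case False
    then have "x \<in> ?K" using closure_subset[of "{x. \<eta> x \<noteq> 0}"] by auto
    then show ?thesis using M[of "\<eta> x"] by simp
  qed simp
  then show ?thesis by (rule that)
qed

lemma smooth_measurable:
  assumes "smooth f" "U \<in> sets lebesgue" shows "f \<in> borel_measurable (lebesgue_on U)"
  using continuous_imp_measurable_on_sets_lebesgue[OF continuous_on_subset[OF smooth_cont[OF assms(1)] subset_UNIV] assms(2)] .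

lemma integrable_mult_test:
  assumes "open U" "integrable (lebesgue_on U) f" "test_fun U \<eta>"
  shows "integrable (lebesgue_on U) (\<lambda>x. f x * \<eta> x)"
proof -
  obtain M where M: "\<And>x. norm (\<eta> x) \<le> M" using test_fun_bounded[OF assms(3)] by blast
  have M0: "0 \<le> M" by (rule order_trans[OF norm_ge_zero M])
  have U: "U \<in> sets lebesgue" using assms(1) by (simp add: borel_open)
  have "integrable (lebesgue_on U) (\<lambda>x. M * norm (f x))" using assms(2) by simp
  then show ?thesis
  proof (rule Bochner_Integration.integrable_bound)
    show "AE x in lebesgue_on U. norm (f x * \<eta> x) \<le> norm (M * norm (f x))"
      using M M0 by (intro AE_I2) (simp add: norm_mult mult.commute mult_right_mono)
  qed (use assms(2) smooth_measurable[OF test_fun_smooth[OF assms(3)] U] in auto)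
qed

lemma weak_deriv_props:
  assumes "f \<in> Sobolev k U" "length js \<le> k"
  shows "weak_deriv U js f \<in> L2 U" "has_weak_deriv U js f (weak_deriv U js f)"
proof -
  have "\<exists>g. g \<in> L2 U \<and> has_weak_deriv U js f g" using assms unfolding Sobolev_def by blast
  from someI_ex[OF this] show "weak_deriv U js f \<in> L2 U" "has_weak_deriv U js f (weak_deriv U js f)"
    by (simp_all add: weak_deriv_def)
qed

text \<open>The weak derivative of order zero is chosen among all square integrable functions with the same pairings as
  \<open>f\<close>, so the fundamental lemma applies to the difference.\<close>

lemma weak_deriv_Nil:
  assumes U: "open U" "bounded U" and f: "f \<in> Sobolev k U"
  shows "AE x in lebesgue_on U. weak_deriv U [] f x = f x"
proof -
  let ?g = "weak_deriv U [] f"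
  have g: "?g \<in> L2 U" "has_weak_deriv U [] f ?g" using weak_deriv_props[OF f, of "[]"] by auto
  have fL: "f \<in> L2 U" using f by (simp add: Sobolev_def)
  note i = L2_integrable[OF U fL] L2_integrable[OF U g(1)]
  have "AE x in lebesgue_on U. ?g x - f x = 0"
  proof (rule fundamental_lemma[OF U(1) L2_integrable[OF U L2_diff[OF g(1) fL]]])
    fix \<eta> assume \<eta>: "test_fun U \<eta>"
    have "integral\<^sup>L (lebesgue_on U) (\<lambda>x. f x * \<eta> x) = integral\<^sup>L (lebesgue_on U) (\<lambda>x. ?g x * \<eta> x)"
      using g(2) \<eta> by (simp add: has_weak_deriv_def pderivs_simps)
    then show "integral\<^sup>L (lebesgue_on U) (\<lambda>x. (?g x - f x) * \<eta> x) = 0"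
      using integrable_mult_test[OF U(1) i(1) \<eta>] integrable_mult_test[OF U(1) i(2) \<eta>]
      by (simp add: left_diff_distrib)
  qed
  then show ?thesis by auto
qed

section \<open>Convergence in the mean square\<close>

definition L2conv :: "(real^'d::finite) set \<Rightarrow> (nat \<Rightarrow> real^'d \<Rightarrow> 'v::euclidean_space) \<Rightarrow> (real^'d \<Rightarrow> 'v) \<Rightarrow> bool" where
  "L2conv U fn f \<longleftrightarrow> f \<in> borel_measurable (lebesgue_on U) \<and> (\<forall>n. fn n \<in> borel_measurable (lebesgue_on U))
    \<and> (\<lambda>n. \<integral>\<^sup>+x. ennreal ((norm (f x - fn n x))\<^sup>2) \<partial>lebesgue_on U) \<longlonglongrightarrow> 0"

lemma tendsto_0_ennreal_le:
  fixes f g :: "nat \<Rightarrow> ennreal"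
  assumes "\<And>n. f n \<le> ennreal c * g n" "g \<longlonglongrightarrow> 0" shows "f \<longlonglongrightarrow> 0"
proof -
  have "(\<lambda>n. ennreal c * g n) \<longlonglongrightarrow> ennreal c * 0"
    by (intro ennreal_tendsto_cmult assms) simp
  then have "(\<lambda>n. ennreal c * g n) \<longlonglongrightarrow> 0" by simp
  then show ?thesis
    by (rule tendsto_sandwich[OF _ _ tendsto_const, rotated 2]) (use assms(1) in auto)
qed

lemma L2conv_linear:
  fixes T :: "'v::euclidean_space \<Rightarrow> 'w::euclidean_space"
  assumes T: "bounded_linear T" and f: "L2conv U fn f"
  shows "L2conv U (\<lambda>n x. T (fn n x)) (\<lambda>x. T (f x))"
proof -
  obtain K where K: "K > 0" "\<And>x. norm (T x) \<le> norm x * K" using bounded_linear.pos_bounded[OF T] by blast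
  have m[measurable]: "f \<in> borel_measurable (lebesgue_on U)" "fn n \<in> borel_measurable (lebesgue_on U)" for n
    using f by (auto simp: L2conv_def)
  have Tm: "T \<in> borel_measurable borel"
    by (intro borel_measurable_continuous_onI bounded_linear.continuous_on[OF T] continuous_on_id)
  have "(norm (T a - T b))\<^sup>2 \<le> K\<^sup>2 * (norm (a - b))\<^sup>2" for a b
  proof -
    have "(norm (T (a - b)))\<^sup>2 \<le> (norm (a - b) * K)\<^sup>2" by (intro power_mono K) simp
    then show ?thesis by (simp add: linear_diff[OF bounded_linear.linear[OF T]] power_mult_distrib mult.commute)
  qed
  note Td = this
  have "(\<integral>\<^sup>+x. ennreal ((norm (T (f x) - T (fn n x)))\<^sup>2) \<partial>lebesgue_on U)
    \<le> (\<integral>\<^sup>+x. ennreal (K\<^sup>2) * ennreal ((norm (f x - fn n x))\<^sup>2) \<partial>lebesgue_on U)" for n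
    by (intro nn_integral_mono) (subst ennreal_mult'[symmetric], simp, rule ennreal_leI[OF Td])
  also have "\<And>n. (\<integral>\<^sup>+x. ennreal (K\<^sup>2) * ennreal ((norm (f x - fn n x))\<^sup>2) \<partial>lebesgue_on U)
    = ennreal (K\<^sup>2) * (\<integral>\<^sup>+x. ennreal ((norm (f x - fn n x))\<^sup>2) \<partial>lebesgue_on U)"
    by (rule nn_integral_cmult) measurable
  finally have "(\<lambda>n. \<integral>\<^sup>+x. ennreal ((norm (T (f x) - T (fn n x)))\<^sup>2) \<partial>lebesgue_on U) \<longlonglongrightarrow> 0"
    by (rule tendsto_0_ennreal_le) (use f in \<open>simp add: L2conv_def\<close>)
  then show ?thesis
    using measurable_compose[OF m(1) Tm] measurable_compose[OF m(2) Tm] by (simp add: L2conv_def)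
qed

lemma ennreal_double_sum:
  "0 \<le> a \<Longrightarrow> 0 \<le> b \<Longrightarrow> ennreal (2 * a + 2 * b) = ennreal 2 * (ennreal a + ennreal b)"
  by (simp only: distrib_left ennreal_plus ennreal_mult zero_le_numeral mult_nonneg_nonneg)

lemma L2conv_diff:
  assumes f: "L2conv U fn f" and g: "L2conv U gn g"
  shows "L2conv U (\<lambda>n x. fn n x - gn n x) (\<lambda>x. f x - g x)"
proof -
  have m[measurable]: "f \<in> borel_measurable (lebesgue_on U)" "g \<in> borel_measurable (lebesgue_on U)"
    "fn n \<in> borel_measurable (lebesgue_on U)" "gn n \<in> borel_measurable (lebesgue_on U)" for n
    using f g by (auto simp: L2conv_def)
  have nd: "(norm ((a - b) - (c - d)))\<^sup>2 \<le> 2 * (norm (a - c))\<^sup>2 + 2 * (norm (b - d))\<^sup>2" for a b c d :: 'b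
    using norm_diff_sq[of "a - c" "b - d"] by (simp add: algebra_simps)
  have "(\<integral>\<^sup>+x. ennreal ((norm ((f x - g x) - (fn n x - gn n x)))\<^sup>2) \<partial>lebesgue_on U)
    \<le> (\<integral>\<^sup>+x. ennreal 2 * (ennreal ((norm (f x - fn n x))\<^sup>2) + ennreal ((norm (g x - gn n x))\<^sup>2)) \<partial>lebesgue_on U)" for n
    by (intro nn_integral_mono, subst ennreal_double_sum[symmetric]) (simp_all only: zero_le_power2 ennreal_leI nd)
  also have "\<And>n. (\<integral>\<^sup>+x. ennreal 2 * (ennreal ((norm (f x - fn n x))\<^sup>2) + ennreal ((norm (g x - gn n x))\<^sup>2)) \<partial>lebesgue_on U)
    = ennreal 2 * ((\<integral>\<^sup>+x. ennreal ((norm (f x - fn n x))\<^sup>2) \<partial>lebesgue_on U) + (\<integral>\<^sup>+x. ennreal ((norm (g x - gn n x))\<^sup>2) \<partial>lebesgue_on U))"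
  proof -
    have 1: "(\<lambda>x. ennreal ((norm (f x - fn n x))\<^sup>2)) \<in> borel_measurable (lebesgue_on U)"
      "(\<lambda>x. ennreal ((norm (g x - gn n x))\<^sup>2)) \<in> borel_measurable (lebesgue_on U)" for n by measurable
    show "\<And>n. (\<integral>\<^sup>+x. ennreal 2 * (ennreal ((norm (f x - fn n x))\<^sup>2) + ennreal ((norm (g x - gn n x))\<^sup>2)) \<partial>lebesgue_on U)
    = ennreal 2 * ((\<integral>\<^sup>+x. ennreal ((norm (f x - fn n x))\<^sup>2) \<partial>lebesgue_on U) + (\<integral>\<^sup>+x. ennreal ((norm (g x - gn n x))\<^sup>2) \<partial>lebesgue_on U))"
      by (simp only: nn_integral_cmult nn_integral_add 1 borel_measurable_add)
  qed
  finally have "(\<lambda>n. \<integral>\<^sup>+x. ennreal ((norm ((f x - g x) - (fn n x - gn n x)))\<^sup>2) \<partial>lebesgue_on U) \<longlonglongrightarrow> 0"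
  proof (rule tendsto_0_ennreal_le)
    show "(\<lambda>n. (\<integral>\<^sup>+x. ennreal ((norm (f x - fn n x))\<^sup>2) \<partial>lebesgue_on U) + (\<integral>\<^sup>+x. ennreal ((norm (g x - gn n x))\<^sup>2) \<partial>lebesgue_on U)) \<longlonglongrightarrow> 0"
      using tendsto_add[of "\<lambda>n. \<integral>\<^sup>+x. ennreal ((norm (f x - fn n x))\<^sup>2) \<partial>lebesgue_on U" 0 sequentially
          "\<lambda>n. \<integral>\<^sup>+x. ennreal ((norm (g x - gn n x))\<^sup>2) \<partial>lebesgue_on U" 0] f g by (simp add: L2conv_def)
  qed
  moreover have "(\<lambda>x. f x - g x) \<in> borel_measurable (lebesgue_on U)"
    "(\<lambda>x. fn n x - gn n x) \<in> borel_measurable (lebesgue_on U)" for n by measurable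
  ultimately show ?thesis by (simp add: L2conv_def)
qed

lemma L2conv_zero: "L2conv U (\<lambda>n x. 0) (\<lambda>x. 0)" by (simp add: L2conv_def)

lemma L2conv_add:
  assumes f: "L2conv U fn f" and g: "L2conv U gn g"
  shows "L2conv U (\<lambda>n x. fn n x + gn n x) (\<lambda>x. f x + g x)"
  using L2conv_diff[OF f L2conv_diff[OF L2conv_zero g]] by simp

lemma L2conv_sum:
  "(\<And>i. i \<in> I \<Longrightarrow> L2conv U (fn i) (f i)) \<Longrightarrow> L2conv U (\<lambda>n x. \<Sum>i\<in>I. fn i n x) (\<lambda>x. \<Sum>i\<in>I. f i x)"
  by (induction I rule: infinite_finite_induct) (auto intro: L2conv_zero L2conv_add)

lemma bounded_linear_axis: "bounded_linear (axis i :: 'a::euclidean_space \<Rightarrow> 'a^'n)"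
  by (intro linear_conv_bounded_linear[THEN iffD1] linearI) (auto simp: axis_def vec_eq_iff)

lemma vec_lambda_axis: "(\<chi> i. f i) = (\<Sum>i\<in>UNIV. axis i (f i :: 'a::euclidean_space))"
  by (simp add: vec_eq_iff axis_def sum.delta)

lemma L2conv_vec:
  fixes f :: "'n::finite \<Rightarrow> real^'d::finite \<Rightarrow> 'v::euclidean_space"
  assumes "\<And>i. L2conv U (fn i) (f i)"
  shows "L2conv U (\<lambda>n x. \<chi> i. fn i n x) (\<lambda>x. \<chi> i. f i x)"
  unfolding vec_lambda_axis by (intro L2conv_sum L2conv_linear[OF bounded_linear_axis] assms)

lemma weighted_norm_sq_le:
  fixes c c' :: "'v::real_normed_vector"
  assumes "0 \<le> v" "v \<le> M"
  shows "v * (norm c)\<^sup>2 \<le> 2 * (v * (norm c')\<^sup>2) + 2 * M * (norm (c - c'))\<^sup>2"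
proof -
  have "(norm c)\<^sup>2 \<le> 2 * (norm (c - c'))\<^sup>2 + 2 * (norm c')\<^sup>2"
    using norm_diff_sq[of "c - c'" "- c'"] by simp
  from mult_left_mono[OF this assms(1)]
  have "v * (norm c)\<^sup>2 \<le> 2 * (v * (norm c')\<^sup>2) + 2 * (v * (norm (c - c'))\<^sup>2)"
    unfolding distrib_left by (simp add: mult.left_commute)
  moreover have "v * (norm (c - c'))\<^sup>2 \<le> M * (norm (c - c'))\<^sup>2" using assms by (intro mult_right_mono) auto
  ultimately show ?thesis by linarith
qed

text \<open>Replacing functions by approximations costs a factor two and the weighted error.  The factor two comes from
  squaring the triangle inequality pointwise, before integrating.\<close>

lemma weighted_nn_integral_le:
  fixes f f' :: "real^'d::finite \<Rightarrow> 'v::euclidean_space" and g g' :: "real^'d \<Rightarrow> 'w::euclidean_space"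
  assumes m: "f \<in> borel_measurable (lebesgue_on U)" "f' \<in> borel_measurable (lebesgue_on U)"
      "g \<in> borel_measurable (lebesgue_on U)" "g' \<in> borel_measurable (lebesgue_on U)"
      "w \<in> borel_measurable (lebesgue_on U)" "v \<in> borel_measurable (lebesgue_on U)"
    and w: "\<And>x. x \<in> U \<Longrightarrow> 0 \<le> w x \<and> w x \<le> M" "\<And>x. x \<in> U \<Longrightarrow> 0 \<le> v x \<and> v x \<le> M" and M: "0 \<le> M"
  shows "(\<integral>\<^sup>+x. ennreal (w x * (norm (f x))\<^sup>2 + v x * (norm (g x))\<^sup>2) \<partial>lebesgue_on U)
    \<le> 2 * (\<integral>\<^sup>+x. ennreal (w x * (norm (f' x))\<^sup>2 + v x * (norm (g' x))\<^sup>2) \<partial>lebesgue_on U)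
      + ennreal (2 * M) * ((\<integral>\<^sup>+x. ennreal ((norm (f x - f' x))\<^sup>2) \<partial>lebesgue_on U) + (\<integral>\<^sup>+x. ennreal ((norm (g x - g' x))\<^sup>2) \<partial>lebesgue_on U))"
proof -
  have "(\<integral>\<^sup>+x. ennreal (w x * (norm (f x))\<^sup>2 + v x * (norm (g x))\<^sup>2) \<partial>lebesgue_on U)
    \<le> (\<integral>\<^sup>+x. ennreal 2 * ennreal (w x * (norm (f' x))\<^sup>2 + v x * (norm (g' x))\<^sup>2)
        + ennreal (2 * M) * (ennreal ((norm (f x - f' x))\<^sup>2) + ennreal ((norm (g x - g' x))\<^sup>2)) \<partial>lebesgue_on U)"
  proof (rule nn_integral_mono)
    fix x assume "x \<in> space (lebesgue_on U)"
    then have x: "x \<in> U" by (simp add: space_restrict_space)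
    have n: "0 \<le> w x * (norm (f' x))\<^sup>2 + v x * (norm (g' x))\<^sup>2" using w x by simp
    have "ennreal (w x * (norm (f x))\<^sup>2 + v x * (norm (g x))\<^sup>2) \<le>
      ennreal (2 * (w x * (norm (f' x))\<^sup>2 + v x * (norm (g' x))\<^sup>2) + 2 * M * ((norm (f x - f' x))\<^sup>2 + (norm (g x - g' x))\<^sup>2))"
      using weighted_norm_sq_le[of "w x" M "f x" "f' x"] weighted_norm_sq_le[of "v x" M "g x" "g' x"] w[OF x]
      unfolding distrib_left by (intro ennreal_leI) linarith
    also have "\<dots> = ennreal 2 * ennreal (w x * (norm (f' x))\<^sup>2 + v x * (norm (g' x))\<^sup>2)
        + ennreal (2 * M) * (ennreal ((norm (f x - f' x))\<^sup>2) + ennreal ((norm (g x - g' x))\<^sup>2))"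
    proof -
      have "ennreal (2 * P + 2 * M * (Q + R)) = ennreal 2 * ennreal P + ennreal (2 * M) * (ennreal Q + ennreal R)"
        if "0 \<le> P" "0 \<le> Q" "0 \<le> R" for P Q R
        using that M by (simp add: ennreal_mult ennreal_numeral[symmetric] del: ennreal_numeral)
      from this[OF n] show ?thesis by simp
    qed
    finally show "ennreal (w x * (norm (f x))\<^sup>2 + v x * (norm (g x))\<^sup>2) \<le> \<dots>" .
  qed
  also have "\<dots> = ennreal 2 * (\<integral>\<^sup>+x. ennreal (w x * (norm (f' x))\<^sup>2 + v x * (norm (g' x))\<^sup>2) \<partial>lebesgue_on U)
      + ennreal (2 * M) * ((\<integral>\<^sup>+x. ennreal ((norm (f x - f' x))\<^sup>2) \<partial>lebesgue_on U) + (\<integral>\<^sup>+x. ennreal ((norm (g x - g' x))\<^sup>2) \<partial>lebesgue_on U))"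
  proof -
    note m[measurable]
    have 1: "(\<lambda>x. ennreal ((norm (f x - f' x))\<^sup>2)) \<in> borel_measurable (lebesgue_on U)"
      "(\<lambda>x. ennreal ((norm (g x - g' x))\<^sup>2)) \<in> borel_measurable (lebesgue_on U)"
      "(\<lambda>x. ennreal (w x * (norm (f' x))\<^sup>2 + v x * (norm (g' x))\<^sup>2)) \<in> borel_measurable (lebesgue_on U)"
      by measurable
    show ?thesis
      using 1 by (subst nn_integral_add; simp add: nn_integral_cmult nn_integral_add)
  qed
  finally show ?thesis by simp
qed

text \<open>The factor \<open>4\<close> comes from using \<open>weighted_nn_integral_le\<close> once on each side.\<close>

lemma weighted_limit:
  assumes f: "L2conv U fn f" and g: "L2conv U gn g" and h: "L2conv U hn h" and k: "L2conv U kn k"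
    and m: "\<And>i. w i \<in> borel_measurable (lebesgue_on U)"
    and w: "\<And>i x. x \<in> U \<Longrightarrow> 0 \<le> w i x \<and> w i x \<le> (M::real)" and M: "0 \<le> M" and C: "0 \<le> C"
    and le: "\<And>n. (\<integral>\<^sup>+x. ennreal (w (0::nat) x * (norm (fn n x))\<^sup>2 + w 1 x * (norm (gn n x))\<^sup>2) \<partial>lebesgue_on U)
      \<le> ennreal C * (\<integral>\<^sup>+x. ennreal (w 2 x * (norm (hn n x))\<^sup>2 + w 3 x * (norm (kn n x))\<^sup>2) \<partial>lebesgue_on U)"
  shows "(\<integral>\<^sup>+x. ennreal (w 0 x * (norm (f x))\<^sup>2 + w 1 x * (norm (g x))\<^sup>2) \<partial>lebesgue_on U)
      \<le> ennreal (4 * C) * (\<integral>\<^sup>+x. ennreal (w 2 x * (norm (h x))\<^sup>2 + w 3 x * (norm (k x))\<^sup>2) \<partial>lebesgue_on U)"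
    (is "?L \<le> _ * ?R")
proof -
  define e where "e n = (\<integral>\<^sup>+x. ennreal ((norm (f x - fn n x))\<^sup>2) \<partial>lebesgue_on U) + (\<integral>\<^sup>+x. ennreal ((norm (g x - gn n x))\<^sup>2) \<partial>lebesgue_on U)" for n
  define d where "d n = (\<integral>\<^sup>+x. ennreal ((norm (h x - hn n x))\<^sup>2) \<partial>lebesgue_on U) + (\<integral>\<^sup>+x. ennreal ((norm (k x - kn n x))\<^sup>2) \<partial>lebesgue_on U)" for n
  have "e \<longlonglongrightarrow> 0 + 0" "d \<longlonglongrightarrow> 0 + 0"
    unfolding e_def[abs_def] d_def[abs_def] by (intro tendsto_add; use f g h k in \<open>simp add: L2conv_def\<close>)+
  then have ed: "e \<longlonglongrightarrow> 0" "d \<longlonglongrightarrow> 0" by simp_all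
  have "?L \<le> ennreal (4 * C) * ?R + (ennreal (4 * C * M) * d n + ennreal (2 * M) * e n)" for n
  proof -
    let ?Ln = "\<integral>\<^sup>+x. ennreal (w 0 x * (norm (fn n x))\<^sup>2 + w 1 x * (norm (gn n x))\<^sup>2) \<partial>lebesgue_on U"
    let ?Rn = "\<integral>\<^sup>+x. ennreal (w 2 x * (norm (hn n x))\<^sup>2 + w 3 x * (norm (kn n x))\<^sup>2) \<partial>lebesgue_on U"
    have "?L \<le> 2 * ?Ln + ennreal (2 * M) * e n"
      unfolding e_def using f g m w M by (intro weighted_nn_integral_le) (auto simp: L2conv_def)
    also have "\<dots> \<le> 2 * (ennreal C * ?Rn) + ennreal (2 * M) * e n"
      by (intro add_right_mono mult_left_mono le) simp
    also have "?Rn \<le> 2 * ?R + ennreal (2 * M) * d n"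
      unfolding d_def norm_minus_commute[of "h _"] norm_minus_commute[of "k _"]
      using h k m w M by (intro weighted_nn_integral_le) (auto simp: L2conv_def)
    also have "2 * (ennreal C * (2 * ?R + ennreal (2 * M) * d n)) = ennreal (4 * C) * ?R + ennreal (4 * C * M) * d n"
    proof -
      have "ennreal (4 * C) = 2 * (ennreal C * 2)" "ennreal (4 * C * M) = 2 * (ennreal C * ennreal (2 * M))"
        using C M by (simp_all add: ennreal_mult' ennreal_mult ennreal_numeral[symmetric] mult_ac del: ennreal_numeral)
          (simp_all add: ennreal_mult'[symmetric] ennreal_mult[symmetric])
      then show ?thesis by (simp only: distrib_left mult.assoc)
    qed
    finally show ?thesis by (simp add: add.assoc mult_left_mono)
  qed
  moreover have "(\<lambda>n. ennreal (4 * C) * ?R + (ennreal (4 * C * M) * d n + ennreal (2 * M) * e n))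
     \<longlonglongrightarrow> ennreal (4 * C) * ?R + (ennreal (4 * C * M) * 0 + ennreal (2 * M) * 0)"
    by (intro tendsto_add tendsto_const ennreal_tendsto_cmult ed) auto
  ultimately have "?L \<le> ennreal (4 * C) * ?R + (ennreal (4 * C * M) * 0 + ennreal (2 * M) * 0)"
    by (intro LIMSEQ_le_const) auto
  then show ?thesis by simp
qed

section \<open>From test functions to Sobolev functions\<close>

lemma smooth_pderivs: "smooth f \<Longrightarrow> smooth (pderivs js f)"
  by (induction js) (auto simp: pderivs_simps smooth_pderiv_at)

lemma pderivs_off_support:
  assumes "smooth f" "closed K" "\<And>x. x \<notin> K \<Longrightarrow> f x = 0" shows "x \<notin> K \<Longrightarrow> pderivs js f x = 0"
proof (induction js arbitrary: x)
  case (Cons j js)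
  show ?case unfolding pderivs_simps
    by (rule pderiv_at_off_support[OF smooth_pderivs[OF assms(1)] assms(2) Cons.IH Cons.prems])
qed (simp add: pderivs_simps assms(3))

lemma pderivs_test_fun_L2:
  assumes U: "open U" and \<eta>: "test_fun U \<eta>" shows "pderivs js \<eta> \<in> L2 U"
proof -
  let ?K = "closure {x. \<eta> x \<noteq> 0}"
  have K: "compact ?K" "?K \<subseteq> U" using \<eta> by (auto simp: test_fun_def)
  have Us: "U \<in> sets lebesgue" using U by (simp add: borel_open)
  note sm = smooth_pderivs[OF test_fun_smooth[OF \<eta>], of js]
  have 0: "\<eta> x = 0" if "x \<notin> ?K" for x using that closure_subset[of "{x. \<eta> x \<noteq> 0}"] by auto
  have z: "pderivs js \<eta> x = 0" if "x \<notin> ?K" for x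
    by (rule pderivs_off_support[OF test_fun_smooth[OF \<eta>] closed_closure 0 that])
  have "integrable lborel (\<lambda>x. (norm (pderivs js \<eta> x))\<^sup>2)"
    by (rule integrable_compact_support[OF _ K(1)]) (auto intro!: continuous_intros smooth_cont sm simp: z)
  then have "integrable lebesgue (\<lambda>x. (norm (pderivs js \<eta> x))\<^sup>2)"
    by (simp add: integrable_completion borel_measurable_integrable)
  then have "integrable lebesgue (\<lambda>x. indicator U x *\<^sub>R (norm (pderivs js \<eta> x))\<^sup>2)"
    by (rule integrable_mult_indicator[OF Us])
  then have "integrable (lebesgue_on U) (\<lambda>x. (norm (pderivs js \<eta> x))\<^sup>2)"
    using Us by (simp add: integrable_restrict_space)
  then show ?thesis using smooth_measurable[OF sm Us] by (simp add: L2_def)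
qed

text \<open>A single sequence serves for all derivatives up to order \<open>k\<close>; this is needed because the estimates
  combine different derivatives of the same function.\<close>

lemma approximating_sequence:
  assumes U: "open U" and f: "f \<in> Sobolev0 k U"
  shows "\<exists>\<eta>. (\<forall>n. test_fun U (\<eta> n)) \<and> (\<forall>js. length js \<le> k \<longrightarrow> L2conv U (\<lambda>n. pderivs js (\<eta> n)) (weak_deriv U js f))"
proof -
  have S: "f \<in> Sobolev k U" using f by (simp add: Sobolev0_def)
  have "\<exists>\<eta>. test_fun U \<eta> \<and> (\<forall>js. length js \<le> k \<longrightarrow>
        integral\<^sup>L (lebesgue_on U) (\<lambda>x. (norm (weak_deriv U js f x - pderivs js \<eta> x))\<^sup>2) < inverse (real (Suc n)))" for n
    using f unfolding Sobolev0_def by simp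
  then obtain \<eta> where \<eta>: "\<And>n. test_fun U (\<eta> n)"
    and le: "\<And>n js. length js \<le> k \<Longrightarrow>
        integral\<^sup>L (lebesgue_on U) (\<lambda>x. (norm (weak_deriv U js f x - pderivs js (\<eta> n) x))\<^sup>2) < inverse (real (Suc n))"
    by metis
  have "L2conv U (\<lambda>n. pderivs js (\<eta> n)) (weak_deriv U js f)" if js: "length js \<le> k" for js
  proof -
    let ?w = "weak_deriv U js f"
    have w: "?w \<in> L2 U" by (rule weak_deriv_props(1)[OF S js])
    have d: "pderivs js (\<eta> n) \<in> L2 U" for n by (rule pderivs_test_fun_L2[OF U \<eta>])
    have "(\<integral>\<^sup>+x. ennreal ((norm (?w x - pderivs js (\<eta> n) x))\<^sup>2) \<partial>lebesgue_on U) \<le> ennreal (inverse (real (Suc n)))" for n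
    proof -
      have "integrable (lebesgue_on U) (\<lambda>x. (norm (?w x - pderivs js (\<eta> n) x))\<^sup>2)"
        using L2_diff[OF w d] by (simp add: L2_def)
      from nn_integral_eq_integral[OF this] le[OF js, of n] show ?thesis
        by (simp add: ennreal_leI)
    qed
    then have le': "(\<integral>\<^sup>+x. ennreal ((norm (?w x - pderivs js (\<eta> n) x))\<^sup>2) \<partial>lebesgue_on U)
        \<le> ennreal 1 * ennreal (inverse (real (Suc n)))" for n by simp
    have "(\<lambda>n. ennreal (inverse (real (Suc n)))) \<longlonglongrightarrow> ennreal 0"
      by (intro tendsto_ennrealI LIMSEQ_inverse_real_of_nat)
    then have "(\<lambda>n. \<integral>\<^sup>+x. ennreal ((norm (?w x - pderivs js (\<eta> n) x))\<^sup>2) \<partial>lebesgue_on U) \<longlonglongrightarrow> 0"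
      by (intro tendsto_0_ennreal_le[OF le']) simp
    then show ?thesis using L2_measurable[OF w] L2_measurable[OF d] by (simp add: L2conv_def)
  qed
  then show ?thesis using \<eta> by blast
qed

lemma L2conv_cong_AE:
  assumes "L2conv U fn f" "AE x in lebesgue_on U. f x = g x" "g \<in> borel_measurable (lebesgue_on U)"
  shows "L2conv U fn g"
proof -
  have "(\<integral>\<^sup>+x. ennreal ((norm (g x - fn n x))\<^sup>2) \<partial>lebesgue_on U) = (\<integral>\<^sup>+x. ennreal ((norm (f x - fn n x))\<^sup>2) \<partial>lebesgue_on U)" for n
    by (rule nn_integral_cong_AE) (use assms(2) in auto)
  then show ?thesis using assms(1,3) by (simp add: L2conv_def)
qed

lemma bounded_weight:
  fixes \<psi> :: "'x \<Rightarrow> real" and G :: "real \<Rightarrow> real"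
  assumes "\<And>x. x \<in> U \<Longrightarrow> \<bar>\<psi> x\<bar> \<le> Q" "continuous_on UNIV G"
  shows "\<exists>M\<ge>0. \<forall>x\<in>U. G (\<psi> x) \<le> M"
proof -
  have "compact (G ` {- Q..Q})" by (intro compact_continuous_image continuous_on_subset[OF assms(2)]) auto
  then obtain M where M: "\<And>y. y \<in> G ` {- Q..Q} \<Longrightarrow> norm y \<le> M"
    using compact_imp_bounded[of "G ` {- Q..Q}"] unfolding bounded_iff by metis
  have "G (\<psi> x) \<le> \<bar>M\<bar>" if "x \<in> U" for x
  proof -
    have "\<psi> x \<in> {- Q..Q}" using assms(1)[OF that] by auto
    then show ?thesis using M[of "G (\<psi> x)"] by auto
  qed
  then show ?thesis by (intro exI[of _ "\<bar>M\<bar>"]) auto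
qed

text \<open>Each integrand is a sum of two weighted squares of expressions that are linear in the derivatives, so these
  expressions converge in the mean square and \<open>weighted_limit\<close> applies to either inequality.\<close>

lemma stokes_estimates_Sobolev0:
  fixes U :: "(real^'d::finite) set" and cu :: "('d \<Rightarrow> 'd list \<Rightarrow> real^'d \<Rightarrow> complex) \<Rightarrow> real^'d \<Rightarrow> 'c::euclidean_space"
  assumes U: "open U" "bounded U" and \<psi>: "continuous_on U \<psi>" "\<And>x. x \<in> U \<Longrightarrow> \<bar>\<psi> x\<bar> \<le> Q"
    and s: "0 \<le> s" and t: "0 < \<tau>" and C: "0 \<le> C"
    and cu: "\<And>Zn Z. (\<And>i j. L2conv U (\<lambda>n. Zn n i [j]) (Z i [j])) \<Longrightarrow> L2conv U (\<lambda>n. cu (Zn n)) (cu Z)"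
    and test: "\<And>\<eta> \<pi>. (\<And>i. test_fun U (\<eta> i)) \<Longrightarrow> test_fun U \<pi> \<Longrightarrow>
      stokes_estimates U \<psi> \<alpha> C \<tau> s (jet_jacobian (\<lambda>i js. pderivs js (\<eta> i))) (jet_value (\<lambda>i js. pderivs js (\<eta> i)))
        (jet_div (\<lambda>i js. pderivs js (\<eta> i))) \<pi> (jet_rhs (\<lambda>i js. pderivs js (\<eta> i)) (\<lambda>js. pderivs js \<pi>))
        (cu (\<lambda>i js. pderivs js (\<eta> i)))"
    and z: "\<And>i. cmp z i \<in> Sobolev0 2 U" and p: "p \<in> Sobolev0 1 U"
  shows "stokes_estimates U \<psi> \<alpha> (4 * C) \<tau> s (wjacobian U z) z (wdiv U z) p (\<lambda>x. wgrad U p x - wlaplace U z x)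
    (cu (\<lambda>i js. weak_deriv U js (cmp z i)))"
proof -
  have Us: "U \<in> sets lebesgue" using U(1) by (simp add: borel_open)
  have "\<forall>i. \<exists>\<eta>. (\<forall>n. test_fun U (\<eta> n)) \<and> (\<forall>js. length js \<le> 2 \<longrightarrow> L2conv U (\<lambda>n. pderivs js (\<eta> n)) (weak_deriv U js (cmp z i)))"
    using approximating_sequence[OF U(1) z] by blast
  then obtain \<eta> where \<eta>: "\<And>i n. test_fun U (\<eta> i n)"
    and \<eta>c: "\<And>i js. length js \<le> 2 \<Longrightarrow> L2conv U (\<lambda>n. pderivs js (\<eta> i n)) (weak_deriv U js (cmp z i))"
    by metis
  obtain \<pi> where \<pi>: "\<And>n. test_fun U (\<pi> n)"
    and \<pi>c: "\<And>js. length js \<le> 1 \<Longrightarrow> L2conv U (\<lambda>n. pderivs js (\<pi> n)) (weak_deriv U js p)"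
    using approximating_sequence[OF U(1) p] by blast
  have Sz: "cmp z i \<in> Sobolev 2 U" for i using z[of i] by (simp add: Sobolev0_def)
  have Sp: "p \<in> Sobolev 1 U" using p by (simp add: Sobolev0_def)
  have \<eta>0: "L2conv U (\<lambda>n. \<eta> i n) (cmp z i)" for i
  proof -
    have "L2conv U (\<lambda>n. \<eta> i n) (weak_deriv U [] (cmp z i))" using \<eta>c[of "[]" i] by (simp add: pderivs_simps)
    then show ?thesis
      by (rule L2conv_cong_AE[OF _ weak_deriv_Nil[OF U Sz]]) (use Sz[of i] in \<open>simp add: Sobolev_def L2_def\<close>)
  qed
  have \<pi>0: "L2conv U \<pi> p"
  proof -
    have "L2conv U \<pi> (weak_deriv U [] p)" using \<pi>c[of "[]"] by (simp add: pderivs_simps)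
    then show ?thesis
      by (rule L2conv_cong_AE[OF _ weak_deriv_Nil[OF U Sp]]) (use Sp in \<open>simp add: Sobolev_def L2_def\<close>)
  qed
  let ?Zn = "\<lambda>n i js. pderivs js (\<eta> i n)" and ?Z = "\<lambda>i js. weak_deriv U js (cmp z i)"
  let ?F = "\<lambda>x. wgrad U p x - wlaplace U z x" and ?Fn = "\<lambda>n. jet_rhs (?Zn n) (\<lambda>js. pderivs js (\<pi> n))"
  have cJ: "L2conv U (\<lambda>n. jet_jacobian (?Zn n)) (wjacobian U z)"
    unfolding jet_jacobian_def[abs_def] wjacobian_def[abs_def] by (intro L2conv_vec \<eta>c) simp
  have cz: "L2conv U (\<lambda>n. jet_value (?Zn n)) z"
  proof -
    have "L2conv U (\<lambda>n x. \<chi> i. \<eta> i n x) (\<lambda>x. \<chi> i. cmp z i x)" by (intro L2conv_vec \<eta>0)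
    then show ?thesis by (simp add: jet_value_def[abs_def] pderivs_simps cmp_def)
  qed
  have cd: "L2conv U (\<lambda>n. jet_div (?Zn n)) (wdiv U z)"
    unfolding jet_div_def[abs_def] wdiv_def[abs_def] by (intro L2conv_sum \<eta>c) simp
  have cF: "L2conv U ?Fn ?F"
  proof -
    have "L2conv U (\<lambda>n x. \<chi> i. pderivs [i] (\<pi> n) x - (\<Sum>j\<in>UNIV. pderivs [j, j] (\<eta> i n) x))
       (\<lambda>x. \<chi> i. weak_deriv U [i] p x - (\<Sum>j\<in>UNIV. weak_deriv U [j, j] (cmp z i) x))"
      by (intro L2conv_vec L2conv_diff L2conv_sum \<eta>c \<pi>c) simp_all
    moreover have "?F = (\<lambda>x. \<chi> i. weak_deriv U [i] p x - (\<Sum>j\<in>UNIV. weak_deriv U [j, j] (cmp z i) x))"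
      by (simp add: fun_eq_iff vec_eq_iff wgrad_def wlaplace_def)
    ultimately show ?thesis by (simp add: jet_rhs_def[abs_def])
  qed
  have cc: "L2conv U (\<lambda>n. cu (?Zn n)) (cu ?Z)" by (intro cu \<eta>c) simp
  have ca: "L2conv U (\<lambda>n x. jet_div (?Zn n) x + of_real \<alpha> * \<pi> n x) (\<lambda>x. wdiv U z x + of_real \<alpha> * p x)"
    by (intro L2conv_add cd L2conv_linear[OF bounded_linear_mult_right] \<pi>0)
  have cb: "L2conv U (\<lambda>n x. jet_div (?Zn n) x - \<pi> n x) (\<lambda>x. wdiv U z x - p x)"
    by (intro L2conv_diff cd \<pi>0)
  \<comment> \<open>The weights as functions of the value of \<open>\<psi>\<close>: \<open>G\<close> for the first inequality, \<open>H\<close> for the second.  The second one has a single square on the right, hence the zero weight.\<close>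
  define W where "W t = exp (2 * s * exp (\<tau> * t))" for t
  define G where "G i t = (if i = (0::nat) then W t else if i = 1 then s\<^sup>2 * \<tau>\<^sup>2 * exp (2 * \<tau> * t) * W t
    else if i = 2 then s * exp (\<tau> * t) * W t else 1 / \<tau>\<^sup>2 * W t)" for i t
  define H where "H i t = (if i = (2::nat) then 0 else if i = 3 then W t else s * \<tau>\<^sup>2 * exp (\<tau> * t) * W t)" for i t
  have cont: "continuous_on UNIV (G i)" "continuous_on UNIV (H i)" for i
    unfolding G_def H_def W_def using t by (cases "i = 0"; cases "i = 1"; cases "i = 2"; cases "i = 3"; auto intro!: continuous_intros)+
  have nonneg: "0 \<le> G i t" "0 \<le> H i t" for i t using s by (auto simp: G_def H_def W_def)
  have meas: "(\<lambda>x. G i (\<psi> x)) \<in> borel_measurable (lebesgue_on U)" "(\<lambda>x. H i (\<psi> x)) \<in> borel_measurable (lebesgue_on U)" for i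
    by (intro continuous_imp_measurable_on_sets_lebesgue[OF _ Us] continuous_on_compose2[OF cont(1) \<psi>(1)]
        continuous_on_compose2[OF cont(2) \<psi>(1)]; simp)+
  have "\<exists>M\<ge>0. \<forall>x\<in>U. G i (\<psi> x) \<le> M" "\<exists>M\<ge>0. \<forall>x\<in>U. H i (\<psi> x) \<le> M" for i
    by (rule bounded_weight[OF \<psi>(2) cont(1)] bounded_weight[OF \<psi>(2) cont(2)]; assumption)+
  then obtain MG MH where M: "\<And>i. MG i \<ge> 0" "\<And>i x. x \<in> U \<Longrightarrow> G i (\<psi> x) \<le> MG i"
    "\<And>i. MH i \<ge> 0" "\<And>i x. x \<in> U \<Longrightarrow> H i (\<psi> x) \<le> MH i" by metis
  have Gb: "0 \<le> G i (\<psi> x) \<and> G i (\<psi> x) \<le> MG 0 + MG 1 + MG 2 + MG 3" if "x \<in> U" for i x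
  proof -
    have "G i (\<psi> x) = G 0 (\<psi> x) \<or> G i (\<psi> x) = G 1 (\<psi> x) \<or> G i (\<psi> x) = G 2 (\<psi> x) \<or> G i (\<psi> x) = G 3 (\<psi> x)"
      by (simp add: G_def)
    then show ?thesis
      using nonneg(1)[of i "\<psi> x"] M(1)[of 0] M(1)[of 1] M(1)[of 2] M(1)[of 3]
        M(2)[OF that, of 0] M(2)[OF that, of 1] M(2)[OF that, of 2] M(2)[OF that, of 3] by linarith
  qed
  have Hb: "0 \<le> H i (\<psi> x) \<and> H i (\<psi> x) \<le> MH 0 + MH 2 + MH 3" if "x \<in> U" for i x
  proof -
    have "H i (\<psi> x) = H 0 (\<psi> x) \<or> H i (\<psi> x) = H 2 (\<psi> x) \<or> H i (\<psi> x) = H 3 (\<psi> x)"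
      by (simp add: H_def)
    then show ?thesis
      using nonneg(2)[of i "\<psi> x"] M(3)[of 0] M(3)[of 2] M(3)[of 3]
        M(4)[OF that, of 0] M(4)[OF that, of 2] M(4)[OF that, of 3] by linarith
  qed
  have tn: "stokes_estimates U \<psi> \<alpha> C \<tau> s (jet_jacobian (?Zn n)) (jet_value (?Zn n)) (jet_div (?Zn n)) (\<pi> n) (?Fn n) (cu (?Zn n))" for n
    by (rule test[OF \<eta> \<pi>])
  have lim1: "(\<integral>\<^sup>+x. ennreal (G 0 (\<psi> x) * (norm (wjacobian U z x))\<^sup>2 + G 1 (\<psi> x) * (norm (z x))\<^sup>2) \<partial>lebesgue_on U)
      \<le> ennreal (4 * C) * (\<integral>\<^sup>+x. ennreal (G 2 (\<psi> x) * (norm (wdiv U z x + of_real \<alpha> * p x))\<^sup>2 + G 3 (\<psi> x) * (norm (?F x))\<^sup>2) \<partial>lebesgue_on U)"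
  proof (rule weighted_limit[OF cJ cz ca cF meas(1) Gb _ C])
    show "(\<integral>\<^sup>+x. ennreal (G 0 (\<psi> x) * (norm (jet_jacobian (?Zn n) x))\<^sup>2 + G 1 (\<psi> x) * (norm (jet_value (?Zn n) x))\<^sup>2) \<partial>lebesgue_on U)
      \<le> ennreal C * (\<integral>\<^sup>+x. ennreal (G 2 (\<psi> x) * (norm (jet_div (?Zn n) x + of_real \<alpha> * \<pi> n x))\<^sup>2 + G 3 (\<psi> x) * (norm (?Fn n x))\<^sup>2) \<partial>lebesgue_on U)" for n
      using tn[of n] by (simp add: stokes_estimates_def G_def W_def algebra_simps)
  qed (use M in auto)
  have lim2: "(\<integral>\<^sup>+x. ennreal (H 0 (\<psi> x) * (norm (cu ?Z x))\<^sup>2 + H 1 (\<psi> x) * (norm (wdiv U z x - p x))\<^sup>2) \<partial>lebesgue_on U)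
      \<le> ennreal (4 * C) * (\<integral>\<^sup>+x. ennreal (H 2 (\<psi> x) * (norm (?F x))\<^sup>2 + H 3 (\<psi> x) * (norm (?F x))\<^sup>2) \<partial>lebesgue_on U)"
  proof (rule weighted_limit[OF cc cb cF cF meas(2) Hb _ C])
    show "(\<integral>\<^sup>+x. ennreal (H 0 (\<psi> x) * (norm (cu (?Zn n) x))\<^sup>2 + H 1 (\<psi> x) * (norm (jet_div (?Zn n) x - \<pi> n x))\<^sup>2) \<partial>lebesgue_on U)
      \<le> ennreal C * (\<integral>\<^sup>+x. ennreal (H 2 (\<psi> x) * (norm (?Fn n x))\<^sup>2 + H 3 (\<psi> x) * (norm (?Fn n x))\<^sup>2) \<partial>lebesgue_on U)" for n
      using tn[of n] by (simp add: stokes_estimates_def H_def W_def algebra_simps)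
  qed (use M in auto)
  show ?thesis using lim1 lim2 by (simp add: stokes_estimates_def G_def H_def W_def algebra_simps)
qed

section \<open>Existence of the constants\<close>

lemma C_closure_bounded:
  assumes "bounded S" "C_closure k S f" "length js \<le> k"
  shows "\<exists>M. \<forall>x\<in>S. norm (pderivs js f x) \<le> M"
proof -
  obtain g where g: "continuous_on (closure S) g" "\<And>x. x \<in> S \<Longrightarrow> g x = pderivs js f x"
    using assms(2,3) unfolding C_closure_def by metis
  have "compact (g ` closure S)" using g(1) assms(1) by (intro compact_continuous_image) auto
  then obtain M where M: "\<And>y. y \<in> g ` closure S \<Longrightarrow> norm y \<le> M"
    using compact_imp_bounded[of "g ` closure S"] unfolding bounded_iff by metis
  have "norm (pderivs js f x) \<le> M" if "x \<in> S" for x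
    using M[OF imageI, of x] g(2)[OF that] subsetD[OF closure_subset that] by simp
  then show ?thesis by blast
qed

lemma weight_function_exists:
  fixes U :: "(real^'d::finite) set"
  assumes U: "open U" "bounded U" and \<psi>: "C_closure 2 U \<psi>" and pos: "\<forall>x\<in>U. 0 < \<psi> x"
    and c: "c > 0" "\<forall>x\<in>U. c \<le> norm (grad \<psi> x)"
  shows "\<exists>B. weight_function U \<psi> (\<lambda>i. pderiv_at i \<psi>) (\<lambda>i k. pderiv_at i (pderiv_at k \<psi>)) B (c\<^sup>2)"
proof -
  have 2: "C_on 2 U \<psi>" using \<psi> by (simp add: C_closure_def)
  then have d: "\<psi> differentiable_on U" "\<And>k. pderiv_at k \<psi> differentiable_on U"
    "\<And>i k. continuous_on U (pderiv_at i (pderiv_at k \<psi>))"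
    by (simp_all add: numeral_2_eq_2)
  have at: "f differentiable (at x)" if "f differentiable_on U" "x \<in> U" for f :: "real^'d \<Rightarrow> real" and x
    using that U(1) at_within_open[of x U] unfolding differentiable_on_def by metis
  have "\<exists>M. \<forall>x\<in>U. \<bar>pderiv_at i \<psi> x\<bar> \<le> M" for i
    using C_closure_bounded[OF U(2) \<psi>, of "[i]"] by (simp add: pderivs_simps)
  then obtain M1 where M1: "\<And>i x. x \<in> U \<Longrightarrow> \<bar>pderiv_at i \<psi> x\<bar> \<le> M1 i" by metis
  have "\<exists>M. \<forall>x\<in>U. \<bar>pderiv_at i (pderiv_at k \<psi>) x\<bar> \<le> M" for i k
    using C_closure_bounded[OF U(2) \<psi>, of "[i, k]"] by (simp add: pderivs_simps)
  then obtain M2 where M2: "\<And>i k x. x \<in> U \<Longrightarrow> \<bar>pderiv_at i (pderiv_at k \<psi>) x\<bar> \<le> M2 i k" by metis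
  define B where "B = (\<Sum>i\<in>UNIV. \<bar>M1 i\<bar>) + (\<Sum>i\<in>UNIV. \<Sum>k\<in>UNIV. \<bar>M2 i k\<bar>)"
  have n: "0 \<le> (\<Sum>i\<in>UNIV. \<bar>M1 i\<bar>)" "0 \<le> (\<Sum>i\<in>UNIV. \<Sum>k\<in>UNIV. \<bar>M2 i k\<bar>)" by (intro sum_nonneg; simp)+
  have B1: "M1 i \<le> B" for i
    using member_le_sum[of i UNIV "\<lambda>i. \<bar>M1 i\<bar>"] n by (simp add: B_def)
  have B2: "M2 i k \<le> B" for i k
  proof -
    have "\<bar>M2 i k\<bar> \<le> (\<Sum>k\<in>UNIV. \<bar>M2 i k\<bar>)" by (rule member_le_sum) auto
    also have "\<dots> \<le> (\<Sum>i\<in>UNIV. \<Sum>k\<in>UNIV. \<bar>M2 i k\<bar>)"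
      by (rule member_le_sum[of i UNIV "\<lambda>i. \<Sum>k\<in>UNIV. \<bar>M2 i k\<bar>"]) (auto intro: sum_nonneg)
    finally show ?thesis using n unfolding B_def by linarith
  qed
  show ?thesis
  proof (intro exI[of _ B] weight_function.intro)
    show "c\<^sup>2 \<le> (\<Sum>m\<in>UNIV. (pderiv_at m \<psi> x)\<^sup>2)" if "x \<in> U" for x
    proof -
      have "c\<^sup>2 \<le> (norm (grad \<psi> x))\<^sup>2" using c that by (intro power_mono) auto
      then show ?thesis by (simp add: norm_vec_sq grad_def)
    qed
    show "\<bar>pderiv_at i \<psi> x\<bar> \<le> B" if "x \<in> U" for x i by (rule order_trans[OF M1[OF that] B1])
    show "\<bar>pderiv_at i (pderiv_at k \<psi>) x\<bar> \<le> B" if "x \<in> U" for x i k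
      by (rule order_trans[OF M2[OF that] B2])
    show "0 \<le> B" using n by (simp add: B_def)
  qed (use d at pos c(1) in \<open>auto intro!: has_pd_pderiv_at differentiable_imp_continuous_on\<close>)
qed

text \<open>The threshold for \<open>s\<close> is \<open>1\<close>; the one for \<open>\<tau>\<close> comes from
  \<open>carleman_threshold\<close> and exceeds \<open>1\<close> by the maximum with \<open>2\<close>.\<close>

lemma stokes_estimates_exist:
  fixes U :: "(real^'d::finite) set" and cu :: "('d \<Rightarrow> 'd list \<Rightarrow> real^'d \<Rightarrow> complex) \<Rightarrow> real^'d \<Rightarrow> 'c::euclidean_space"
  assumes U: "open U" "bounded U" and \<psi>: "C_closure 2 U \<psi>" and pos: "\<forall>x\<in>U. 0 < \<psi> x"
    and grad: "\<exists>c>0. \<forall>x\<in>U. c \<le> norm (grad \<psi> x)"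
    and cu: "\<And>Zn Z. (\<And>i j. L2conv U (\<lambda>n. Zn n i [j]) (Z i [j])) \<Longrightarrow> L2conv U (\<lambda>n. cu (Zn n)) (cu Z)"
    and test: "\<And>p p' B c s \<tau> \<eta> \<pi>. weight_function U \<psi> p p' B c \<Longrightarrow> 1 \<le> s \<Longrightarrow> 1 \<le> \<tau> \<Longrightarrow> 2 * carleman_threshold N B c \<le> c * \<tau> \<Longrightarrow>
      (\<And>i. test_fun U (\<eta> i)) \<Longrightarrow> test_fun U \<pi> \<Longrightarrow>
      stokes_estimates U \<psi> \<alpha> (stokes_const N B c \<alpha>) \<tau> s (jet_jacobian (\<lambda>i js. pderivs js (\<eta> i))) (jet_value (\<lambda>i js. pderivs js (\<eta> i)))
        (jet_div (\<lambda>i js. pderivs js (\<eta> i))) \<pi> (jet_rhs (\<lambda>i js. pderivs js (\<eta> i)) (\<lambda>js. pderivs js \<pi>))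
        (cu (\<lambda>i js. pderivs js (\<eta> i)))"
  shows "\<exists>C>0. \<exists>\<tau>0>1. \<forall>\<tau>\<ge>\<tau>0. \<exists>s0. \<forall>s\<ge>s0. \<forall>z p. (\<forall>i. cmp z i \<in> Sobolev0 2 U) \<and> p \<in> Sobolev0 1 U \<longrightarrow>
    stokes_estimates U \<psi> \<alpha> C \<tau> s (wjacobian U z) z (wdiv U z) p (\<lambda>x. wgrad U p x - wlaplace U z x)
    (cu (\<lambda>i js. weak_deriv U js (cmp z i)))"
proof -
  obtain c' where c': "c' > 0" "\<forall>x\<in>U. c' \<le> norm (grad \<psi> x)" using grad by blast
  define c where "c = c'\<^sup>2"
  obtain B where wf: "weight_function U \<psi> (\<lambda>i. pderiv_at i \<psi>) (\<lambda>i k. pderiv_at i (pderiv_at k \<psi>)) B c"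
    unfolding c_def using weight_function_exists[OF U \<psi> pos c'] by blast
  obtain Q where Q: "\<And>x. x \<in> U \<Longrightarrow> \<bar>\<psi> x\<bar> \<le> Q"
    using C_closure_bounded[OF U(2) \<psi>, of "[]"] by (auto simp: pderivs_simps)
  have cB: "0 < c" "0 \<le> B" using wf by (auto simp: weight_function_def)
  have cont: "continuous_on U \<psi>" using wf by (simp add: weight_function_def)
  have C0: "0 < carleman_const N B c" by (rule carleman_const_pos[OF cB])
  have C: "0 < stokes_const N B c \<alpha>"
    unfolding stokes_const_def using C0 by (intro add_nonneg_pos mult_nonneg_nonneg add_nonneg_nonneg) auto
  let ?t = "max 2 (2 * carleman_threshold N B c / c)"
  have "stokes_estimates U \<psi> \<alpha> (4 * stokes_const N B c \<alpha>) \<tau> s (wjacobian U z) z (wdiv U z) p (\<lambda>x. wgrad U p x - wlaplace U z x)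
    (cu (\<lambda>i js. weak_deriv U js (cmp z i)))"
    if t: "?t \<le> \<tau>" and s: "1 \<le> s" and z: "\<forall>i. cmp z i \<in> Sobolev0 2 U" and p: "p \<in> Sobolev0 1 U" for \<tau> s z p
  proof (rule stokes_estimates_Sobolev0[OF U cont Q _ _ less_imp_le[OF C] cu])
    have "2 * carleman_threshold N B c / c \<le> \<tau>" using t by simp
    then have t2: "2 * carleman_threshold N B c \<le> c * \<tau>" using cB by (simp add: pos_divide_le_eq mult.commute)
    have t1: "1 \<le> \<tau>" using t by simp
    show "stokes_estimates U \<psi> \<alpha> (stokes_const N B c \<alpha>) \<tau> s (jet_jacobian (\<lambda>i js. pderivs js (\<eta> i))) (jet_value (\<lambda>i js. pderivs js (\<eta> i)))
        (jet_div (\<lambda>i js. pderivs js (\<eta> i))) \<pi> (jet_rhs (\<lambda>i js. pderivs js (\<eta> i)) (\<lambda>js. pderivs js \<pi>))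
        (cu (\<lambda>i js. pderivs js (\<eta> i)))" if "\<And>i. test_fun U (\<eta> i)" "test_fun U \<pi>" for \<eta> \<pi>
      by (rule test[OF wf s t1 t2 that])
  qed (use t s z p in auto)
  then show ?thesis using C by (intro exI[of _ "4 * stokes_const N B c \<alpha>"] conjI exI[of _ ?t] allI impI exI[of _ 1]) auto
qed

lemma L2conv_curl2:
  "(\<And>i j. L2conv U (\<lambda>n. Zn n i [j]) (Z i [j])) \<Longrightarrow> L2conv U (\<lambda>n. jet_curl2 (Zn n)) (jet_curl2 Z)"
  unfolding jet_curl2_def[abs_def] by (intro L2conv_diff)

lemma L2conv_curl3:
  assumes "\<And>i j. L2conv U (\<lambda>n. Zn n i [j]) (Z i [j])" shows "L2conv U (\<lambda>n. jet_curl3 (Zn n)) (jet_curl3 Z)"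
proof -
  have "L2conv U (\<lambda>n x. if i = 1 then Zn n 3 [2] x - Zn n 2 [3] x else if i = 2 then Zn n 1 [3] x - Zn n 3 [1] x else Zn n 2 [1] x - Zn n 1 [2] x)
    (\<lambda>x. if i = 1 then Z 3 [2] x - Z 2 [3] x else if i = 2 then Z 1 [3] x - Z 3 [1] x else Z 2 [1] x - Z 1 [2] x)" for i :: 3
    using L2conv_diff[OF assms assms] by (cases "i = 1"; cases "i = 2") simp_all
  then show ?thesis unfolding jet_curl3_def[abs_def] vector_3_vec_lambda by (rule L2conv_vec)
qed

lemma stokes_estimates_dim2:
  fixes U :: "(real^2) set"
  assumes "\<alpha> \<noteq> - 1" and U: "open U" "bounded U" and \<psi>: "C_closure 2 U \<psi>" "\<forall>x\<in>U. 0 < \<psi> x"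
    "\<exists>c>0. \<forall>x\<in>U. c \<le> norm (grad \<psi> x)"
  shows "\<exists>C>0. \<exists>\<tau>0>1. \<forall>\<tau>\<ge>\<tau>0. \<exists>s0. \<forall>s\<ge>s0. \<forall>z p. (\<forall>i. cmp z i \<in> Sobolev0 2 U) \<and> p \<in> Sobolev0 1 U \<longrightarrow>
    stokes_estimates U \<psi> \<alpha> C \<tau> s (wjacobian U z) z (wdiv U z) p (\<lambda>x. wgrad U p x - wlaplace U z x) (wcurl2 U z)"
proof -
  have w: "wcurl2 U z = jet_curl2 (\<lambda>i js. weak_deriv U js (cmp z i))" for z
    by (simp add: fun_eq_iff wcurl2_def jet_curl2_def)
  show ?thesis unfolding w
  proof (rule stokes_estimates_exist[OF U \<psi>])
    show "L2conv U (\<lambda>n. jet_curl2 (Zn n)) (jet_curl2 Z)" if "\<And>i j. L2conv U (\<lambda>n. Zn n i [j]) (Z i [j])" for Zn Z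
      by (rule L2conv_curl2, rule that)
    show "stokes_estimates U \<psi> \<alpha> (stokes_const 2 B c \<alpha>) \<tau> s (jet_jacobian (\<lambda>i js. pderivs js (\<eta> i))) (jet_value (\<lambda>i js. pderivs js (\<eta> i)))
        (jet_div (\<lambda>i js. pderivs js (\<eta> i))) \<pi> (jet_rhs (\<lambda>i js. pderivs js (\<eta> i)) (\<lambda>js. pderivs js \<pi>))
        (jet_curl2 (\<lambda>i js. pderivs js (\<eta> i)))"
      if "weight_function U \<psi> p p' B c" "1 \<le> s" "1 \<le> \<tau>" "2 * carleman_threshold 2 B c \<le> c * \<tau>"
        "\<And>i. test_fun U (\<eta> i)" "test_fun U \<pi>" for p p' B c s \<tau> \<eta> \<pi>
      using stokes_estimates_test_fun2[OF U(1) that(1-4) assms(1) that(5,6)] by (simp add: pderivs_simps)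
  qed
qed

lemma stokes_estimates_dim3:
  fixes U :: "(real^3) set"
  assumes "\<alpha> \<noteq> - 1" and U: "open U" "bounded U" and \<psi>: "C_closure 2 U \<psi>" "\<forall>x\<in>U. 0 < \<psi> x"
    "\<exists>c>0. \<forall>x\<in>U. c \<le> norm (grad \<psi> x)"
  shows "\<exists>C>0. \<exists>\<tau>0>1. \<forall>\<tau>\<ge>\<tau>0. \<exists>s0. \<forall>s\<ge>s0. \<forall>z p. (\<forall>i. cmp z i \<in> Sobolev0 2 U) \<and> p \<in> Sobolev0 1 U \<longrightarrow>
    stokes_estimates U \<psi> \<alpha> C \<tau> s (wjacobian U z) z (wdiv U z) p (\<lambda>x. wgrad U p x - wlaplace U z x) (wcurl3 U z)"
proof -
  have w: "wcurl3 U z = jet_curl3 (\<lambda>i js. weak_deriv U js (cmp z i))" for z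
    by (simp add: fun_eq_iff wcurl3_def jet_curl3_def)
  show ?thesis unfolding w
  proof (rule stokes_estimates_exist[OF U \<psi>])
    show "L2conv U (\<lambda>n. jet_curl3 (Zn n)) (jet_curl3 Z)" if "\<And>i j. L2conv U (\<lambda>n. Zn n i [j]) (Z i [j])" for Zn Z
      by (rule L2conv_curl3, rule that)
    show "stokes_estimates U \<psi> \<alpha> (stokes_const 3 B c \<alpha>) \<tau> s (jet_jacobian (\<lambda>i js. pderivs js (\<eta> i))) (jet_value (\<lambda>i js. pderivs js (\<eta> i)))
        (jet_div (\<lambda>i js. pderivs js (\<eta> i))) \<pi> (jet_rhs (\<lambda>i js. pderivs js (\<eta> i)) (\<lambda>js. pderivs js \<pi>))
        (jet_curl3 (\<lambda>i js. pderivs js (\<eta> i)))"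
      if "weight_function U \<psi> p p' B c" "1 \<le> s" "1 \<le> \<tau>" "2 * carleman_threshold 3 B c \<le> c * \<tau>"
        "\<And>i. test_fun U (\<eta> i)" "test_fun U \<pi>" for p p' B c s \<tau> \<eta> \<pi>
      using stokes_estimates_test_fun3[OF U(1) that(1-4) assms(1) that(5,6)] by (simp add: pderivs_simps)
  qed
qed

theorem corollary26:
  fixes \<alpha> :: real
  assumes "\<alpha> \<noteq> - 1"
  shows "
    (\<forall>(U :: (real^2) set) (\<psi> :: real^2 \<Rightarrow> real).
      U \<noteq> {} \<and> bounded U \<and> open_class_C 2 U \<and>
      C_closure 2 U \<psi> \<and> (\<forall>x\<in>U. 0 < \<psi> x) \<and> (\<exists>c>0. \<forall>x\<in>U. c \<le> norm (grad \<psi> x)) \<longrightarrow>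
      (\<exists>C>0. \<exists>\<tau>0>1. \<forall>\<tau>\<ge>\<tau>0. \<exists>s0. \<forall>s\<ge>s0.
        \<forall>(z :: real^2 \<Rightarrow> complex^2) (p :: real^2 \<Rightarrow> complex).
          (\<forall>i. cmp z i \<in> Sobolev0 2 U) \<and> p \<in> Sobolev0 1 U \<longrightarrow>
          (\<integral>\<^sup>+x. ennreal (((norm (wjacobian U z x))\<^sup>2
                 + s\<^sup>2 * \<tau>\<^sup>2 * exp (2 * \<tau> * \<psi> x) * (norm (z x))\<^sup>2)
               * exp (2 * s * exp (\<tau> * \<psi> x))) \<partial>lebesgue_on U)
          \<le> ennreal C * (\<integral>\<^sup>+x. ennreal
               ((s * exp (\<tau> * \<psi> x) * (norm (wdiv U z x + complex_of_real \<alpha> * p x))\<^sup>2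
                 + (1 / \<tau>\<^sup>2) * (norm (wgrad U p x - wlaplace U z x))\<^sup>2)
               * exp (2 * s * exp (\<tau> * \<psi> x))) \<partial>lebesgue_on U)
          \<and>
          (\<integral>\<^sup>+x. ennreal (s * \<tau>\<^sup>2 * exp (\<tau> * \<psi> x)
               * ((norm (wcurl2 U z x))\<^sup>2 + (norm (wdiv U z x - p x))\<^sup>2)
               * exp (2 * s * exp (\<tau> * \<psi> x))) \<partial>lebesgue_on U)
          \<le> ennreal C * (\<integral>\<^sup>+x. ennreal ((norm (wgrad U p x - wlaplace U z x))\<^sup>2
               * exp (2 * s * exp (\<tau> * \<psi> x))) \<partial>lebesgue_on U)))
    \<and>
    (\<forall>(U :: (real^3) set) (\<psi> :: real^3 \<Rightarrow> real).
      U \<noteq> {} \<and> bounded U \<and> open_class_C 2 U \<and>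
      C_closure 2 U \<psi> \<and> (\<forall>x\<in>U. 0 < \<psi> x) \<and> (\<exists>c>0. \<forall>x\<in>U. c \<le> norm (grad \<psi> x)) \<longrightarrow>
      (\<exists>C>0. \<exists>\<tau>0>1. \<forall>\<tau>\<ge>\<tau>0. \<exists>s0. \<forall>s\<ge>s0.
        \<forall>(z :: real^3 \<Rightarrow> complex^3) (p :: real^3 \<Rightarrow> complex).
          (\<forall>i. cmp z i \<in> Sobolev0 2 U) \<and> p \<in> Sobolev0 1 U \<longrightarrow>
          (\<integral>\<^sup>+x. ennreal (((norm (wjacobian U z x))\<^sup>2
                 + s\<^sup>2 * \<tau>\<^sup>2 * exp (2 * \<tau> * \<psi> x) * (norm (z x))\<^sup>2)
               * exp (2 * s * exp (\<tau> * \<psi> x))) \<partial>lebesgue_on U)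
          \<le> ennreal C * (\<integral>\<^sup>+x. ennreal
               ((s * exp (\<tau> * \<psi> x) * (norm (wdiv U z x + complex_of_real \<alpha> * p x))\<^sup>2
                 + (1 / \<tau>\<^sup>2) * (norm (wgrad U p x - wlaplace U z x))\<^sup>2)
               * exp (2 * s * exp (\<tau> * \<psi> x))) \<partial>lebesgue_on U)
          \<and>
          (\<integral>\<^sup>+x. ennreal (s * \<tau>\<^sup>2 * exp (\<tau> * \<psi> x)
               * ((norm (wcurl3 U z x))\<^sup>2 + (norm (wdiv U z x - p x))\<^sup>2)
               * exp (2 * s * exp (\<tau> * \<psi> x))) \<partial>lebesgue_on U)
          \<le> ennreal C * (\<integral>\<^sup>+x. ennreal ((norm (wgrad U p x - wlaplace U z x))\<^sup>2
               * exp (2 * s * exp (\<tau> * \<psi> x))) \<partial>lebesgue_on U)))"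
proof (intro conjI allI impI, goal_cases)
  case (1 U \<psi>)
  then show ?case
    by (intro stokes_estimates_dim2[OF assms, unfolded stokes_estimates_def]) (simp_all add: open_class_C_def)
next
  case (2 U \<psi>)
  then show ?case
    by (intro stokes_estimates_dim3[OF assms, unfolded stokes_estimates_def]) (simp_all add: open_class_C_def)
qed

end
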